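(* Assume that (B1) the covariates are bounded by a finite constant $K>0$, namely $\|\boldsymbol X\|_\infty\le K$; (B2) the smallest eigenvalue $\Lambda_{\min}^2$ of $\boldsymbol\Sigma$ is strictly positive with $1/\Lambda_{\min}^2=O(1)$, and $\max_j\Sigma_{j,j}=O(1)$; (B3) $\|\boldsymbol X_{-r}\boldsymbol\gamma_r\|_\infty=O(K)$ and $\max_r\mathbb E(z_{r,1}^4)=O(K^4)$, where $z_{r,1}$ is the first element of $\boldsymbol z_r=\boldsymbol x_r-\boldsymbol X_{-r}\boldsymbol\gamma_r$. Then there exist constants $C>0$ and $c>0$, not depending on $N_b$, such that the following holds. Suppose the tuning parameters are $\lambda_j=C\sqrt{\log p/N_j}$, $j=1,\dots,b$, the first batch size satisfies $n_1\ge c\,s_r^2\log p$, and $$s_0s_r\frac{\log p}{\sqrt{N_b}}=o(1),\qquad s_r^2\,\frac{\log p}{N_b}\,\log N_b=o(1).$$ Then for any $r=1,\dots,p$ and sufficiently large $N_b$, $$\frac{\widehat\beta^{(b)}_{\mathrm{on},r}-\beta_{0,r}}{\widehat\tau_r^{(b)}}=W_r+\Delta_r,\qquad W_r=\frac{\widehat{\boldsymbol z}_r^\top\boldsymbol\epsilon}{\|\widehat{\boldsymbol z}_r\|_2},\qquad |\Delta_r|=o_{\mathbb P}(1).$$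
   Context: Model. Data arrive in $b\ge 2$ batches $\{\boldsymbol y^{(j)},\boldsymbol X^{(j)}\}$, $j=1,\dots,b$, with $\boldsymbol y^{(j)}=\boldsymbol X^{(j)}\boldsymbol\beta_0+\boldsymbol\epsilon^{(j)}$, where $\boldsymbol y^{(j)}\in\mathbb R^{n_j}$, $\boldsymbol X^{(j)}$ is an $n_j\times p$ random design matrix, $\boldsymbol\beta_0=(\beta_{0,1},\dots,\beta_{0,p})^\top\in\mathbb R^p$ is unknown and sparse, and the errors $\epsilon_i^{(j)}$ are i.i.d. with mean zero and finite variance $\sigma_\epsilon^2$. Put $N_j=\sum_{i=1}^j n_i$. High dimension is allowed: $p\ge N_b$ is permitted. Let $\boldsymbol X,\boldsymbol y,\boldsymbol\epsilon$ be the vertical stacks of $\boldsymbol X^{(j)},\boldsymbol y^{(j)},\boldsymbol\epsilon^{(j)}$, $j=1,\dots,b$. The rows of $\boldsymbol X$ are i.i.d.; $\boldsymbol\Sigma$ is the covariance matrix of a row and $\boldsymbol\Theta=\boldsymbol\Sigma^{-1}$. For a matrix or vector $\boldsymbol A=(a_{ij})$, $\|\boldsymbol A\|_\infty=\max_{i,j}|a_{ij}|$. Notation. $\boldsymbol x_r$ (resp. $\boldsymbol x_r^{(j)}$) is the $r$-th column of $\boldsymbol X$ (resp. $\boldsymbol X^{(j)}$), and $\boldsymbol X_{-r}$ (resp. $\boldsymbol X_{-r}^{(j)}$) is $\boldsymbol X$ (resp. $\boldsymbol X^{(j)}$) with the $r$-th column removed. $\boldsymbol\gamma_r=\arg\min_{\boldsymbol\gamma\in\mathbb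 R^{p-1}}\mathbb E\|\boldsymbol x_r-\boldsymbol X_{-r}\boldsymbol\gamma\|_2^2$. Sparsity levels: $s_0=|\{j:\beta_{0,j}\ne0\}|$ and $s_r=|\{k\ne r:\boldsymbol\Theta_{k,r}\neq0\}|$. Estimators. With tuning parameters $\lambda_1,\dots,\lambda_b$, the online lasso estimator is $$\widehat{\boldsymbol\beta}^{(b)}=\arg\min_{\boldsymbol\beta\in\mathbb R^p}\Big\{\tfrac1{2N_b}\sum_{j=1}^b\|\boldsymbol y^{(j)}-\boldsymbol X^{(j)}\boldsymbol\beta\|_2^2+\lambda_b\|\boldsymbol\beta\|_1\Big\}.$$ For each $j=1,\dots,b$, $$\widehat{\boldsymbol\gamma}_r^{(j)}=\arg\min_{\boldsymbol\gamma\in\mathbb R^{p-1}}\Big\{\tfrac1{2N_j}\sum_{i=1}^j\|\boldsymbol x_r^{(i)}-\boldsymbol X_{-r}^{(i)}\boldsymbol\gamma\|_2^2+\lambda_j\|\boldsymbol\gamma\|_1\Big\},\qquad \widehat{\boldsymbol z}_r^{(j)}=\boldsymbol x_r^{(j)}-\boldsymbol X_{-r}^{(j)}\widehat{\boldsymbol\gamma}_r^{(j)},$$ and $\widehat{\boldsymbol z}_r=((\widehat{\boldsymbol z}_r^{(1)})^\top,\dots,(\widehat{\boldsymbol z}_r^{(b)})^\top)^\top\in\mathbb R^{N_b}$. The online debiased lasso (ODL) estimator of $\beta_{0,r}$ is $$\widehat\beta^{(b)}_{\mathrm{on},r}=\widehat\beta_r^{(b)}+\Big\{\sum_{j=1}^b(\widehat{\boldsymbol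 z}_r^{(j)})^\top\boldsymbol x_r^{(j)}\Big\}^{-1}\Big\{\sum_{j=1}^b(\widehat{\boldsymbol z}_r^{(j)})^\top\boldsymbol y^{(j)}-\sum_{j=1}^b(\widehat{\boldsymbol z}_r^{(j)})^\top\boldsymbol X^{(j)}\widehat{\boldsymbol\beta}^{(b)}\Big\},$$ and $$\widehat\tau_r^{(b)}=\frac{\sqrt{\sum_{j=1}^b(\widehat{\boldsymbol z}_r^{(j)})^\top\widehat{\boldsymbol z}_r^{(j)}}}{\sum_{j=1}^b(\widehat{\boldsymbol z}_r^{(j)})^\top\boldsymbol x_r^{(j)}}.$$ Asymptotics: all $o(\cdot)$, $O(\cdot)$, $o_{\mathbb P}(\cdot)$ are along a sequence of such models with cumulative sample size $N_b\to\infty$, where $p,b,n_j,s_0,s_r,\boldsymbol\Sigma,\boldsymbol\beta_0$ may vary; $X_N=o_{\mathbb P}(Y_N)$ means $X_N/Y_N\to0$ in probability.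
   Formalization: The first rate condition is read with max(1, s_r) in place of s_r, since for s_r = 0 the claim as written fails (Rademacher design, log p of order N^2); the design X is taken to be independent of the errors, as is implicit in the model. *)

theory Defs
  imports
    "HOL-Probability.Probability"
    "Jordan_Normal_Form.Gauss_Jordan_Elimination"
    "Jordan_Normal_Form.Char_Poly"
begin

text \<open>
  A vector in \<open>\<real>\<^sup>q\<close> is a function \<open>nat \<Rightarrow> real\<close> of which only the values at indices below \<open>q\<close>
  are used.  A vector of coefficients for the covariates other than the \<open>r\<close>-th keeps the original
  column numbering: only its values at indices \<open>k < p\<close>, \<open>k \<noteq> r\<close> are used, so it stands for an
  element of \<open>\<real>\<^bsup>p-1\<^esup>\<close>.  Columns and observations are numbered from 0, batches from 1.
  \<open>design m i k\<close> and \<open>noise m i\<close> are the entries of the stacked design and error; batch \<open>j\<close>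
  consists of the rows \<open>batch_rows m j\<close>.
\<close>

record 'w stream_data =
  law :: "'w measure"
  batches :: nat
  batch_size :: "nat \<Rightarrow> nat"
  covariates :: nat
  design :: "nat \<Rightarrow> nat \<Rightarrow> 'w \<Rightarrow> real"
  noise :: "nat \<Rightarrow> 'w \<Rightarrow> real"
  beta0 :: "nat \<Rightarrow> real"

definition cum_size :: "'w stream_data \<Rightarrow> nat \<Rightarrow> nat" where
  "cum_size m j = (\<Sum>i=1..j. batch_size m i)"

definition total_size :: "'w stream_data \<Rightarrow> nat" where
  "total_size m = cum_size m (batches m)"

definition batch_rows :: "'w stream_data \<Rightarrow> nat \<Rightarrow> nat set" where
  "batch_rows m j = {cum_size m (j - 1)..<cum_size m j}"

definition lin_pred :: "'w stream_data \<Rightarrow> (nat \<Rightarrow> real) \<Rightarrow> nat \<Rightarrow> 'w \<Rightarrow> real" where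
  "lin_pred m \<beta> i \<omega> = (\<Sum>k<covariates m. design m i k \<omega> * \<beta> k)"

definition lin_pred_without ::
    "'w stream_data \<Rightarrow> nat \<Rightarrow> (nat \<Rightarrow> real) \<Rightarrow> nat \<Rightarrow> 'w \<Rightarrow> real" where
  "lin_pred_without m r \<gamma> i \<omega> = (\<Sum>k\<in>{..<covariates m} - {r}. design m i k \<omega> * \<gamma> k)"

definition response :: "'w stream_data \<Rightarrow> nat \<Rightarrow> 'w \<Rightarrow> real" where
  "response m i \<omega> = lin_pred m (beta0 m) i \<omega> + noise m i \<omega>"

text \<open>
  The rows of the design are i.i.d., the errors are i.i.d. with mean zero and variance \<open>\<sigma>\<^sup>2\<close>,
  and the design is independent of the errors (their joint law is the product of the laws).
\<close>

definition linear_stream_model :: "real \<Rightarrow> 'w stream_data \<Rightarrow> bool" where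
  "linear_stream_model \<sigma> m \<longleftrightarrow>
     (let M = law m; N = total_size m; p = covariates m;
          row = (\<lambda>i \<omega>. \<lambda>k\<in>{..<p}. design m i k \<omega>);
          R = PiM {..<p} (\<lambda>_. borel :: real measure)
      in prob_space M
       \<and> 2 \<le> batches m \<and> (\<forall>j\<in>{1..batches m}. 1 \<le> batch_size m j)
       \<and> prob_space.indep_vars M (\<lambda>_. R) row {..<N}
       \<and> (\<forall>i<N. distr M R (row i) = distr M R (row 0))
       \<and> prob_space.indep_vars M (\<lambda>_. borel) (noise m) {..<N}
       \<and> (\<forall>i<N. distr M borel (noise m i) = distr M borel (noise m 0))
       \<and> (\<forall>i<N. integrable M (\<lambda>\<omega>. (noise m i \<omega>)\<^sup>2)
              \<and> prob_space.expectation M (noise m i) = 0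
              \<and> prob_space.variance M (noise m i) = \<sigma>\<^sup>2)
       \<and> distr M (PiM {..<N} (\<lambda>_. R) \<Otimes>\<^sub>M PiM {..<N} (\<lambda>_. borel))
           (\<lambda>\<omega>. (\<lambda>i\<in>{..<N}. row i \<omega>, \<lambda>i\<in>{..<N}. noise m i \<omega>))
         = distr M (PiM {..<N} (\<lambda>_. R)) (\<lambda>\<omega>. \<lambda>i\<in>{..<N}. row i \<omega>)
           \<Otimes>\<^sub>M distr M (PiM {..<N} (\<lambda>_. borel)) (\<lambda>\<omega>. \<lambda>i\<in>{..<N}. noise m i \<omega>))"

definition Sigma_mat :: "'w stream_data \<Rightarrow> real mat" where
  "Sigma_mat m = mat (covariates m) (covariates m) (\<lambda>(k, l).
     \<integral>\<omega>. (design m 0 k \<omega> - (\<integral>\<omega>'. design m 0 k \<omega>' \<partial>law m))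
        * (design m 0 l \<omega> - (\<integral>\<omega>'. design m 0 l \<omega>' \<partial>law m)) \<partial>law m)"

definition Theta_mat :: "'w stream_data \<Rightarrow> real mat" where
  "Theta_mat m = the (mat_inverse (Sigma_mat m))"

definition min_eigenvalue :: "real mat \<Rightarrow> real" where
  "min_eigenvalue A = Min {e. eigenvalue A e}"

definition s_zero :: "'w stream_data \<Rightarrow> nat" where
  "s_zero m = card {k. k < covariates m \<and> beta0 m k \<noteq> 0}"

definition s_node :: "'w stream_data \<Rightarrow> nat \<Rightarrow> nat" where
  "s_node m r = card {k. k < covariates m \<and> k \<noteq> r \<and> Theta_mat m $$ (k, r) \<noteq> 0}"

definition node_resid ::
    "'w stream_data \<Rightarrow> nat \<Rightarrow> (nat \<Rightarrow> real) \<Rightarrow> nat \<Rightarrow> 'w \<Rightarrow> real" where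
  "node_resid m r \<gamma> i \<omega> = design m i r \<omega> - lin_pred_without m r \<gamma> i \<omega>"

definition gamma_node :: "'w stream_data \<Rightarrow> nat \<Rightarrow> nat \<Rightarrow> real" where
  "gamma_node m r =
     arg_min (\<lambda>\<gamma>. \<integral>\<omega>. (\<Sum>i<total_size m. (node_resid m r \<gamma> i \<omega>)\<^sup>2) \<partial>law m) (\<lambda>_. True)"

definition lasso_obj :: "'w stream_data \<Rightarrow> real \<Rightarrow> 'w \<Rightarrow> (nat \<Rightarrow> real) \<Rightarrow> real" where
  "lasso_obj m lam \<omega> \<beta> =
     1 / (2 * real (total_size m)) *
       (\<Sum>j=1..batches m. \<Sum>i\<in>batch_rows m j. (response m i \<omega> - lin_pred m \<beta> i \<omega>)\<^sup>2)
     + lam * (\<Sum>k<covariates m. \<bar>\<beta> k\<bar>)"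

definition node_obj ::
    "'w stream_data \<Rightarrow> nat \<Rightarrow> nat \<Rightarrow> real \<Rightarrow> 'w \<Rightarrow> (nat \<Rightarrow> real) \<Rightarrow> real" where
  "node_obj m r j lam \<omega> \<gamma> =
     1 / (2 * real (cum_size m j)) *
       (\<Sum>i=1..j. \<Sum>t\<in>batch_rows m i. (node_resid m r \<gamma> t \<omega>)\<^sup>2)
     + lam * (\<Sum>k\<in>{..<covariates m} - {r}. \<bar>\<gamma> k\<bar>)"

text \<open>
  Lasso minimizers need not be unique, so an estimator is any measurable choice of a minimizer.
\<close>

definition is_online_lasso ::
    "'w stream_data \<Rightarrow> (nat \<Rightarrow> real) \<Rightarrow> ('w \<Rightarrow> nat \<Rightarrow> real) \<Rightarrow> bool" where
  "is_online_lasso m lam bh \<longleftrightarrow>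
     (\<forall>k<covariates m. (\<lambda>\<omega>. bh \<omega> k) \<in> borel_measurable (law m)) \<and>
     (\<forall>\<omega>\<in>space (law m). is_arg_min (lasso_obj m (lam (batches m)) \<omega>) (\<lambda>_. True) (bh \<omega>))"

definition is_node_lasso ::
    "'w stream_data \<Rightarrow> nat \<Rightarrow> (nat \<Rightarrow> real) \<Rightarrow> (nat \<Rightarrow> 'w \<Rightarrow> nat \<Rightarrow> real) \<Rightarrow> bool" where
  "is_node_lasso m r lam gh \<longleftrightarrow>
     (\<forall>j\<in>{1..batches m}.
        (\<forall>k\<in>{..<covariates m} - {r}. (\<lambda>\<omega>. gh j \<omega> k) \<in> borel_measurable (law m)) \<and>
        (\<forall>\<omega>\<in>space (law m). is_arg_min (node_obj m r j (lam j) \<omega>) (\<lambda>_. True) (gh j \<omega>)))"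

text \<open>
  \<open>zhat_prod m r gh v \<omega>\<close> is the sum over the batches of the inner products of the nodewise
  residual vector of the batch with the corresponding block of \<open>v\<close>, which is also the inner
  product of the stacked residual vector with \<open>v\<close>.
\<close>

definition zhat_prod ::
    "'w stream_data \<Rightarrow> nat \<Rightarrow> (nat \<Rightarrow> 'w \<Rightarrow> nat \<Rightarrow> real) \<Rightarrow> (nat \<Rightarrow> 'w \<Rightarrow> real) \<Rightarrow> 'w \<Rightarrow> real" where
  "zhat_prod m r gh v \<omega> =
     (\<Sum>j=1..batches m. \<Sum>i\<in>batch_rows m j. node_resid m r (gh j \<omega>) i \<omega> * v i \<omega>)"

definition zhat_norm ::
    "'w stream_data \<Rightarrow> nat \<Rightarrow> (nat \<Rightarrow> 'w \<Rightarrow> nat \<Rightarrow> real) \<Rightarrow> 'w \<Rightarrow> real" where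
  "zhat_norm m r gh \<omega> =
     sqrt (\<Sum>j=1..batches m. \<Sum>i\<in>batch_rows m j. (node_resid m r (gh j \<omega>) i \<omega>)\<^sup>2)"

definition odl ::
    "'w stream_data \<Rightarrow> nat \<Rightarrow> ('w \<Rightarrow> nat \<Rightarrow> real) \<Rightarrow> (nat \<Rightarrow> 'w \<Rightarrow> nat \<Rightarrow> real) \<Rightarrow> 'w \<Rightarrow> real" where
  "odl m r bh gh \<omega> =
     bh \<omega> r + inverse (zhat_prod m r gh (\<lambda>i. design m i r) \<omega>) *
       (zhat_prod m r gh (response m) \<omega> - zhat_prod m r gh (lin_pred m (bh \<omega>)) \<omega>)"

definition tau_hat ::
    "'w stream_data \<Rightarrow> nat \<Rightarrow> (nat \<Rightarrow> 'w \<Rightarrow> nat \<Rightarrow> real) \<Rightarrow> 'w \<Rightarrow> real" where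
  "tau_hat m r gh \<omega> = zhat_norm m r gh \<omega> / zhat_prod m r gh (\<lambda>i. design m i r) \<omega>"

definition W_stat ::
    "'w stream_data \<Rightarrow> nat \<Rightarrow> (nat \<Rightarrow> 'w \<Rightarrow> nat \<Rightarrow> real) \<Rightarrow> 'w \<Rightarrow> real" where
  "W_stat m r gh \<omega> = zhat_prod m r gh (noise m) \<omega> / zhat_norm m r gh \<omega>"

definition cond_B1 :: "real \<Rightarrow> (nat \<Rightarrow> 'w stream_data) \<Rightarrow> bool" where
  "cond_B1 K m \<longleftrightarrow>
     (\<forall>n. \<forall>i<total_size (m n). \<forall>k<covariates (m n). AE \<omega> in law (m n). \<bar>design (m n) i k \<omega>\<bar> \<le> K)"

text \<open>
  The constants implicit in the \<open>O\<close>-bounds are explicit parameters, because the constants in the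
  tuning parameters and in the lower bound on the first batch size are chosen depending on them.
\<close>

definition cond_B2 :: "real \<Rightarrow> real \<Rightarrow> (nat \<Rightarrow> 'w stream_data) \<Rightarrow> bool" where
  "cond_B2 L D m \<longleftrightarrow>
     (\<forall>n. 0 < min_eigenvalue (Sigma_mat (m n))) \<and>
     (\<forall>\<^sub>F n in sequentially. 1 / min_eigenvalue (Sigma_mat (m n)) \<le> L) \<and>
     (\<forall>\<^sub>F n in sequentially. (MAX j\<in>{..<covariates (m n)}. Sigma_mat (m n) $$ (j, j)) \<le> D)"

definition cond_B3 :: "real \<Rightarrow> real \<Rightarrow> real \<Rightarrow> (nat \<Rightarrow> 'w stream_data) \<Rightarrow> bool" where
  "cond_B3 K B Q m \<longleftrightarrow>
     (\<forall>\<^sub>F n in sequentially. \<forall>r<covariates (m n). \<forall>i<total_size (m n).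
        AE \<omega> in law (m n). \<bar>lin_pred_without (m n) r (gamma_node (m n) r) i \<omega>\<bar> \<le> B * K) \<and>
     (\<forall>\<^sub>F n in sequentially.
        (MAX r\<in>{..<covariates (m n)}.
           \<integral>\<omega>. (node_resid (m n) r (gamma_node (m n) r) 0 \<omega>) ^ 4 \<partial>law (m n)) \<le> Q * K ^ 4)"

definition vanishes_in_prob :: "(nat \<Rightarrow> 'w measure) \<Rightarrow> (nat \<Rightarrow> 'w \<Rightarrow> real) \<Rightarrow> bool" where
  "vanishes_in_prob M Y \<longleftrightarrow>
     (\<forall>n. Y n \<in> borel_measurable (M n)) \<and>
     (\<forall>\<delta>>0. (\<lambda>n. measure (M n) {\<omega>\<in>space (M n). \<bar>Y n \<omega>\<bar> > \<delta>}) \<longlonglongrightarrow> 0)"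

end

theory Submission
  imports Defs "Jordan_Normal_Form.Spectral_Radius"
begin

text \<open>
  Let \<open>N\<close> be the total sample size, \<open>v = bh - beta0\<close> the error of the online lasso, \<open>e\<close> the stacked
  nodewise residual vector and \<open>U k\<close> its inner product with the \<open>k\<close>-th column of the design.  If
  \<open>U r \<noteq> 0\<close>, the remainder of the expansion is \<open>- (\<Sum>k \<noteq> r. U k * v k) / \<parallel>e\<parallel>\<close> (lemma
  \<open>debias_error_eq\<close>).  It is small because, with probability close to one, the \<open>\<bar>U k\<bar>\<close> with \<open>k \<noteq> r\<close> are at
  most of order \<open>sqrt (N * ln p)\<close>, the norm \<open>\<parallel>e\<parallel>\<close> is at least of order \<open>sqrt N\<close>, and the \<open>\<ell>\<^sub>1\<close>-norm of
  \<open>v\<close> is at most of order \<open>s\<^sub>0 * sqrt (ln p / N)\<close>: the product is of order \<open>s\<^sub>0 * ln p / sqrt N\<close>.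

  The bound on \<open>U k\<close> comes from exchangeability.  Batch \<open>j\<close> uses the lasso fit to the first \<open>N\<^sub>j\<close> rows.
  The residuals of that fit are unique, and they are a measurable function of the design that
  commutes with permutations of these rows (\<open>lasso_resid\<close>).  As the rows are i.i.d., a batch is
  like a random subset of the first \<open>N\<^sub>j\<close> rows, so its part of \<open>U k\<close> is its share of the inner product
  over all \<open>N\<^sub>j\<close> rows, which for \<open>k \<noteq> r\<close> is at most \<open>N\<^sub>j * lam j\<close> by the Karush-Kuhn-Tucker
  conditions, plus a deviation.  Read from the last row to the first, the deviations form a
  martingale difference sequence (\<open>batch_sum_decomposition\<close>, \<open>innov_max\<close>).

  By the Cauchy-Schwarz inequality, \<open>\<parallel>e\<parallel>\<close> is bounded below as soon as \<open>U r\<close> is.  The same decomposition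
  applies to \<open>U r\<close>, and the shares are bounded below by duality for the lasso, with a scaled
  population residual of covariate \<open>r\<close> as the dual vector (\<open>lasso_dual_bound\<close>,
  \<open>response_score_lower_bound\<close>).

  The bound on \<open>v\<close> is the oracle inequality for the lasso (\<open>lasso_l1_error\<close>).  It needs the penalty to
  dominate the score of the noise.  The errors have only two moments, so this holds with
  probability close to one only if \<open>p\<close> is large (\<open>noise_max\<close>); if \<open>p\<close> is bounded, the
  inequality is applied with the set of all covariates in place of the support.

  All maxima over covariates are controlled by the smoothness of the soft maximum
  (\<open>max_martingale_sum_bound\<close>).  The resulting bound \<open>debias_error_tail\<close> for a single model yields the
  limit along the sequence.
\<close>

section \<open>Maximal inequalities from the soft maximum\<close>

text \<open>
  The soft maximum of the absolute values of the coordinates \<open>x k\<close>, \<open>k \<in> I\<close>, at inverse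
  temperature \<open>\<theta>\<close>, and its gradient.  Both signs of every coordinate enter, so that
  \<open>soft_max\<close> dominates \<open>\<bar>x k\<bar>\<close>; the gradient has \<open>\<ell>\<^sub>1\<close>-norm at most one.
\<close>
definition soft_weight :: "real \<Rightarrow> 'i set \<Rightarrow> ('i \<Rightarrow> real) \<Rightarrow> 'i \<Rightarrow> real" where
  "soft_weight \<theta> I x k = (exp (\<theta> * x k) - exp (- (\<theta> * x k)))
     / (\<Sum>l\<in>I. exp (\<theta> * x l) + exp (- (\<theta> * x l)))"

definition soft_max :: "real \<Rightarrow> 'i set \<Rightarrow> ('i \<Rightarrow> real) \<Rightarrow> real" where
  "soft_max \<theta> I x = ln (\<Sum>l\<in>I. exp (\<theta> * x l) + exp (- (\<theta> * x l))) / \<theta>"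

lemma exp_le_quadratic:
  fixes s :: real
  assumes "\<bar>s\<bar> \<le> 1"
  shows "exp s \<le> 1 + s + s\<^sup>2"
proof (cases "0 \<le> s")
  case True
  then show ?thesis using assms exp_bound[of s] by simp
next
  case False
  define t where "t = - s"
  have t: "0 < t" "t \<le> 1" using False assms by (auto simp: t_def)
  have "1 \<le> (1 - t + t\<^sup>2) * (1 + t)"
    using t by (simp add: algebra_simps power2_eq_square)
  also have "\<dots> \<le> (1 - t + t\<^sup>2) * exp t"
    using t exp_ge_add_one_self[of t] zero_le_power2[of t] by (intro mult_left_mono) linarith+
  finally have "exp (- t) \<le> 1 - t + t\<^sup>2"
    by (simp add: exp_minus field_simps)
  then show ?thesis by (simp add: t_def)
qed

lemma soft_sum_pos:
  assumes "finite I" "I \<noteq> {}"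
  shows "0 < (\<Sum>l\<in>I. exp (\<theta> * x l) + exp (- (\<theta> * x l)) :: real)"
  using assms by (intro sum_pos) (auto intro: add_pos_pos)

lemma sum_abs_soft_weight_le:
  assumes "finite I" "I \<noteq> {}"
  shows "(\<Sum>k\<in>I. \<bar>soft_weight \<theta> I x k\<bar>) \<le> 1"
proof -
  let ?Z = "\<Sum>l\<in>I. exp (\<theta> * x l) + exp (- (\<theta> * x l))"
  have Z: "0 < ?Z" using soft_sum_pos[OF assms] .
  have "(\<Sum>k\<in>I. \<bar>soft_weight \<theta> I x k\<bar>) \<le> (\<Sum>k\<in>I. (exp (\<theta> * x k) + exp (- (\<theta> * x k))) / ?Z)"
  proof (rule sum_mono)
    fix k
    have "\<bar>exp (\<theta> * x k) - exp (- (\<theta> * x k))\<bar> \<le> exp (\<theta> * x k) + exp (- (\<theta> * x k))"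
      by (simp add: abs_le_iff)
    then show "\<bar>soft_weight \<theta> I x k\<bar> \<le> (exp (\<theta> * x k) + exp (- (\<theta> * x k))) / ?Z"
      using Z unfolding soft_weight_def by (simp add: divide_right_mono)
  qed
  also have "\<dots> = 1" using Z by (simp flip: sum_divide_distrib)
  finally show ?thesis .
qed

lemma abs_soft_weight_le:
  assumes "finite I" "k \<in> I"
  shows "\<bar>soft_weight \<theta> I x k\<bar> \<le> 1"
proof -
  have "\<bar>soft_weight \<theta> I x k\<bar> \<le> (\<Sum>k\<in>I. \<bar>soft_weight \<theta> I x k\<bar>)"
    using assms by (intro member_le_sum) auto
  also have "\<dots> \<le> 1" using assms by (intro sum_abs_soft_weight_le) auto
  finally show ?thesis .
qed

lemma abs_soft_weight_sum_le:
  assumes "finite I" "I \<noteq> {}" "\<And>k. k \<in> I \<Longrightarrow> \<bar>d k\<bar> \<le> R"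
  shows "\<bar>\<Sum>k\<in>I. soft_weight \<theta> I x k * d k\<bar> \<le> R"
proof -
  have R: "0 \<le> R" using assms by force
  have "\<bar>\<Sum>k\<in>I. soft_weight \<theta> I x k * d k\<bar> \<le> (\<Sum>k\<in>I. \<bar>soft_weight \<theta> I x k\<bar> * R)"
    by (rule order_trans[OF sum_abs]) (auto simp: abs_mult intro!: sum_mono mult_left_mono assms)
  also have "\<dots> \<le> 1 * R"
    unfolding sum_distrib_right[symmetric]
    using sum_abs_soft_weight_le[OF assms(1,2)] R by (intro mult_right_mono)
  finally show ?thesis by simp
qed

text \<open>
  The increment of the soft maximum is linear in the step up to a remainder that is quadratic
  for small steps and linear for large ones.  The linear growth is what later allows steps with
  only a second moment.
\<close>
lemma soft_max_step:
  assumes I: "finite I" "I \<noteq> {}" and \<theta>: "0 < \<theta>" and d: "\<And>k. k \<in> I \<Longrightarrow> \<bar>d k\<bar> \<le> R"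
  shows "soft_max \<theta> I (\<lambda>k. x k + d k)
    \<le> soft_max \<theta> I x + (\<Sum>k\<in>I. soft_weight \<theta> I x k * d k) + 2 / \<theta> * min ((\<theta> * R)\<^sup>2) (\<theta> * R)"
proof -
  define u where "u = \<theta> * R"
  have R: "0 \<le> R" using I d by force
  have u0: "0 \<le> u" using R \<theta> by (simp add: u_def)
  let ?Z = "\<lambda>x. \<Sum>l\<in>I. exp (\<theta> * x l) + exp (- (\<theta> * x l))"
  have Z: "0 < ?Z x" for x :: "'a \<Rightarrow> real" using soft_sum_pos[OF I] .
  define w where "w = (\<Sum>k\<in>I. soft_weight \<theta> I x k * d k)"
  have wR: "\<bar>\<theta> * w\<bar> \<le> u"
    using abs_soft_weight_sum_le[where \<theta> = \<theta> and x = x, OF I d] \<theta> by (simp add: w_def abs_mult u_def)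
  have ud: "\<bar>\<theta> * d k\<bar> \<le> u" if "k \<in> I" for k
    using d[OF that] \<theta> by (simp add: abs_mult u_def)
  have wZ: "\<theta> * w * ?Z x = (\<Sum>k\<in>I. exp (\<theta> * x k) * (\<theta> * d k) - exp (- (\<theta> * x k)) * (\<theta> * d k))"
  proof -
    have "\<theta> * w * ?Z x = (\<Sum>k\<in>I. \<theta> * (soft_weight \<theta> I x k * ?Z x) * d k)"
    proof -
      have "\<theta> * w * Z = (\<Sum>k\<in>I. \<theta> * (soft_weight \<theta> I x k * Z) * d k)" for Z
        unfolding w_def by (simp add: sum_distrib_left sum_distrib_right mult_ac)
      then show ?thesis .
    qed
    also have "\<dots> = (\<Sum>k\<in>I. \<theta> * (exp (\<theta> * x k) - exp (- (\<theta> * x k))) * d k)"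
      using Z[of x] by (intro sum.cong) (simp_all add: soft_weight_def)
    finally show ?thesis by (simp add: algebra_simps)
  qed
  have Zxd: "?Z (\<lambda>k. x k + d k)
      = (\<Sum>k\<in>I. exp (\<theta> * x k) * exp (\<theta> * d k) + exp (- (\<theta> * x k)) * exp (- (\<theta> * d k)))"
    by (intro sum.cong refl) (simp add: distrib_left flip: exp_add)
  have main: "ln (?Z (\<lambda>k. x k + d k)) \<le> ln (?Z x) + \<theta> * w + 2 * min (u\<^sup>2) u"
  proof (cases "u \<le> 1")
    case True
    have "?Z (\<lambda>k. x k + d k)
      \<le> (\<Sum>k\<in>I. exp (\<theta> * x k) * (1 + \<theta> * d k + u\<^sup>2) + exp (- (\<theta> * x k)) * (1 - \<theta> * d k + u\<^sup>2))"
      unfolding Zxd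
    proof (intro sum_mono add_mono mult_left_mono)
      fix k assume k: "k \<in> I"
      have sq: "(\<theta> * d k)\<^sup>2 \<le> u\<^sup>2" using ud[OF k] u0 by (simp add: abs_le_square_iff[symmetric])
      show "exp (\<theta> * d k) \<le> 1 + \<theta> * d k + u\<^sup>2"
        using exp_le_quadratic[of "\<theta> * d k"] ud[OF k] True sq by simp
      show "exp (- (\<theta> * d k)) \<le> 1 - \<theta> * d k + u\<^sup>2"
        using exp_le_quadratic[of "- (\<theta> * d k)"] ud[OF k] True sq by simp
    qed auto
    also have "\<dots> = ?Z x * (1 + u\<^sup>2) + \<theta> * w * ?Z x"
      unfolding wZ sum_distrib_right sum.distrib[symmetric]
      by (intro sum.cong refl) (simp add: algebra_simps)
    finally have le: "?Z (\<lambda>k. x k + d k) \<le> ?Z x * (1 + (u\<^sup>2 + \<theta> * w))" by (simp add: algebra_simps)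
    have pos: "0 < 1 + (u\<^sup>2 + \<theta> * w)"
      by (rule zero_less_mult_pos[OF less_le_trans[OF Z le] Z])
    have "ln (?Z (\<lambda>k. x k + d k)) \<le> ln (?Z x * (1 + (u\<^sup>2 + \<theta> * w)))"
      using le Z by (intro ln_mono) auto
    also have "\<dots> = ln (?Z x) + ln (1 + (u\<^sup>2 + \<theta> * w))"
      using Z[of x] pos by (simp add: ln_mult_pos)
    also have "\<dots> \<le> ln (?Z x) + (u\<^sup>2 + \<theta> * w)"
      using ln_le_minus_one[OF pos] by simp
    finally have "ln (?Z (\<lambda>k. x k + d k)) \<le> ln (?Z x) + (u\<^sup>2 + \<theta> * w)" .
    moreover have "min (u\<^sup>2) u = u\<^sup>2"
      using True u0 by (simp add: min_def power2_eq_square mult_left_le)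
    ultimately show ?thesis using zero_le_power2[of u] by linarith
  next
    case False
    have "?Z (\<lambda>k. x k + d k) \<le> (\<Sum>k\<in>I. exp (\<theta> * x k) * exp u + exp (- (\<theta> * x k)) * exp u)"
      unfolding Zxd using ud by (intro sum_mono add_mono mult_left_mono) (auto simp: abs_le_iff)
    also have "\<dots> = ?Z x * exp u" unfolding sum_distrib_right by (simp add: algebra_simps)
    finally have "ln (?Z (\<lambda>k. x k + d k)) \<le> ln (?Z x * exp u)" using Z by (intro ln_mono) auto
    also have "\<dots> = ln (?Z x) + u" using Z[of x] by (simp add: ln_mult_pos)
    also have "min (u\<^sup>2) u = u" using False by (simp add: min_def power2_eq_square)
    ultimately show ?thesis using wR by simp
  qed
  have "soft_max \<theta> I (\<lambda>k. x k + d k) \<le> (ln (?Z x) + \<theta> * w + 2 * min (u\<^sup>2) u) / \<theta>"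
    unfolding soft_max_def using main \<theta> by (intro divide_right_mono) auto
  also have "\<dots> = soft_max \<theta> I x + w + 2 / \<theta> * min (u\<^sup>2) u"
    using \<theta> by (simp add: soft_max_def add_divide_distrib)
  finally show ?thesis by (simp add: w_def u_def)
qed

lemma abs_sum_le_soft_max_path:
  fixes d :: "nat \<Rightarrow> 'i \<Rightarrow> real"
  assumes I: "finite I" "k \<in> I" and \<theta>: "0 < \<theta>"
    and d: "\<And>t k. t < n \<Longrightarrow> k \<in> I \<Longrightarrow> \<bar>d t k\<bar> \<le> R t"
  shows "\<bar>\<Sum>t<n. d t k\<bar> \<le> ln (2 * real (card I)) / \<theta>
     + (\<Sum>t<n. \<Sum>l\<in>I. soft_weight \<theta> I (\<lambda>l. \<Sum>s<t. d s l) l * d t l)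
     + (\<Sum>t<n. 2 / \<theta> * min ((\<theta> * R t)\<^sup>2) (\<theta> * R t))"
proof -
  have ne: "I \<noteq> {}" using I by auto
  have up: "soft_max \<theta> I (\<lambda>l. \<Sum>s<m. d s l) \<le> ln (2 * real (card I)) / \<theta>
     + (\<Sum>t<m. \<Sum>l\<in>I. soft_weight \<theta> I (\<lambda>l. \<Sum>s<t. d s l) l * d t l)
     + (\<Sum>t<m. 2 / \<theta> * min ((\<theta> * R t)\<^sup>2) (\<theta> * R t))" if "m \<le> n" for m
    using that
  proof (induction m)
    case 0
    then show ?case by (simp add: soft_max_def mult.commute)
  next
    case (Suc m)
    have "soft_max \<theta> I (\<lambda>l. (\<Sum>s<m. d s l) + d m l) \<le> soft_max \<theta> I (\<lambda>l. \<Sum>s<m. d s l)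
       + (\<Sum>k\<in>I. soft_weight \<theta> I (\<lambda>l. \<Sum>s<m. d s l) k * d m k)
       + 2 / \<theta> * min ((\<theta> * R m)\<^sup>2) (\<theta> * R m)"
      using Suc.prems by (intro soft_max_step I ne \<theta> d) auto
    then show ?case using Suc by simp
  qed
  define s where "s = (\<Sum>t<n. d t k)"
  have "exp (\<theta> * \<bar>s\<bar>) \<le> exp (\<theta> * s) + exp (- (\<theta> * s))"
    by (cases "0 \<le> s") (auto simp: add_increasing add_increasing2)
  also have "\<dots> \<le> (\<Sum>l\<in>I. exp (\<theta> * (\<Sum>t<n. d t l)) + exp (- (\<theta> * (\<Sum>t<n. d t l))))"
    unfolding s_def using I by (intro member_le_sum) (auto intro: add_nonneg_nonneg)
  finally have "ln (exp (\<theta> * \<bar>s\<bar>)) \<le> ln (\<Sum>l\<in>I. exp (\<theta> * (\<Sum>t<n. d t l)) + exp (- (\<theta> * (\<Sum>t<n. d t l))))"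
    by (intro ln_mono) auto
  then have "\<bar>s\<bar> \<le> soft_max \<theta> I (\<lambda>l. \<Sum>t<n. d t l)"
    using \<theta> by (simp add: soft_max_def field_simps)
  with up[of n] show ?thesis by (simp add: s_def)
qed

lemma borel_measurable_soft_weight [measurable (raw)]:
  assumes "\<And>l. l \<in> I \<Longrightarrow> f l \<in> borel_measurable M" "k \<in> I"
  shows "(\<lambda>\<omega>. soft_weight \<theta> I (\<lambda>l. f l \<omega>) k) \<in> borel_measurable M"
proof -
  have [measurable]: "f k \<in> borel_measurable M" using assms by simp
  have [measurable]: "(\<lambda>\<omega>. \<Sum>l\<in>I. exp (\<theta> * f l \<omega>) + exp (- (\<theta> * f l \<omega>))) \<in> borel_measurable M"
    by (intro borel_measurable_sum borel_measurable_add borel_measurable_exp borel_measurable_times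
        borel_measurable_uminus borel_measurable_const measurable_compose[OF _ borel_measurable_exp] assms)
  show ?thesis unfolding soft_weight_def by measurable
qed

text \<open>
  A maximal inequality for sums of martingale differences with values in \<open>\<real>\<^sup>I\<close>, with the factor
  \<open>sqrt (ln (card I))\<close> in place of \<open>sqrt (card I)\<close>.  The martingale property is needed only
  against the gradient of the soft maximum.  The maximum is not mentioned; instead a single
  integrable function dominates all coordinates.
\<close>
lemma (in prob_space) max_martingale_sum_bound:
  fixes D :: "nat \<Rightarrow> 'i \<Rightarrow> 'a \<Rightarrow> real"
  assumes I: "finite I" "I \<noteq> {}" and n: "0 < n"
    and measD: "\<And>t k. t < n \<Longrightarrow> k \<in> I \<Longrightarrow> D t k \<in> borel_measurable M"
    and measR: "\<And>t. t < n \<Longrightarrow> R t \<in> borel_measurable M"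
    and bnd: "\<And>t. t < n \<Longrightarrow> AE \<omega> in M. \<forall>k\<in>I. \<bar>D t k \<omega>\<bar> \<le> R t \<omega>"
    and R2: "\<And>t. t < n \<Longrightarrow> integrable M (\<lambda>\<omega>. (R t \<omega>)\<^sup>2)"
            "\<And>t. t < n \<Longrightarrow> expectation (\<lambda>\<omega>. (R t \<omega>)\<^sup>2) \<le> V"
    and mart: "\<And>\<theta> t k. t < n \<Longrightarrow> k \<in> I \<Longrightarrow> 0 < \<theta> \<Longrightarrow>
       expectation (\<lambda>\<omega>. soft_weight \<theta> I (\<lambda>l. \<Sum>s<t. D s l \<omega>) k * D t k \<omega>) = 0"
  shows "\<exists>G. integrable M G \<and> expectation G \<le> (1 + 2 * V) * sqrt (real n * ln (2 * real (card I)))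
     \<and> (AE \<omega> in M. 0 \<le> G \<omega> \<and> (\<forall>k\<in>I. \<bar>\<Sum>t<n. D t k \<omega>\<bar> \<le> G \<omega>))"
proof -
  define c where "c = ln (2 * real (card I))"
  have card: "1 \<le> card I" using I by (simp add: Suc_le_eq card_gt_0_iff)
  have c: "0 < c" unfolding c_def using card by (intro ln_gt_zero) simp
  \<comment> \<open>this \<open>\<theta>\<close> balances \<open>c / \<theta>\<close> against \<open>\<theta> * n\<close>\<close>
  define \<theta> where "\<theta> = sqrt (c / real n)"
  have \<theta>: "0 < \<theta>" using c n by (simp add: \<theta>_def)
  have [measurable]: "D t k \<in> borel_measurable M" if "t < n" "k \<in> I" for t k using measD that .
  define H where "H t \<omega> = (\<Sum>l\<in>I. soft_weight \<theta> I (\<lambda>l. \<Sum>s<t. D s l \<omega>) l * D t l \<omega>)" for t \<omega>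
  define G where "G \<omega> = c / \<theta> + (\<Sum>t<n. H t \<omega>) + (\<Sum>t<n. 2 * \<theta> * (R t \<omega>)\<^sup>2)" for \<omega>
  have intR: "integrable M (R t)" if "t < n" for t
    using square_integrable_imp_integrable[OF measR[OF that] R2(1)[OF that]] .
  have AEb: "AE \<omega> in M. \<forall>t<n. \<forall>k\<in>I. \<bar>D t k \<omega>\<bar> \<le> R t \<omega>"
    using bnd by (intro AE_all_countable[THEN iffD2] allI) (auto intro: AE_I2)
  have wm: "(\<lambda>\<omega>. soft_weight \<theta> I (\<lambda>l. \<Sum>s<t. D s l \<omega>) l) \<in> borel_measurable M"
    if "t < n" "l \<in> I" for t l
    using that by (intro borel_measurable_soft_weight borel_measurable_sum measD) auto
  have intw: "integrable M (\<lambda>\<omega>. soft_weight \<theta> I (\<lambda>l. \<Sum>s<t. D s l \<omega>) l * D t l \<omega>)"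
    if "t < n" "l \<in> I" for t l
  proof (rule Bochner_Integration.integrable_bound[OF intR[OF that(1)]])
    show "(\<lambda>\<omega>. soft_weight \<theta> I (\<lambda>l. \<Sum>s<t. D s l \<omega>) l * D t l \<omega>) \<in> borel_measurable M"
      using wm[OF that] measD[OF that] by measurable
    show "AE \<omega> in M. norm (soft_weight \<theta> I (\<lambda>l. \<Sum>s<t. D s l \<omega>) l * D t l \<omega>) \<le> norm (R t \<omega>)"
      using bnd[OF that(1)]
    proof eventually_elim
      case (elim \<omega>)
      have "\<bar>soft_weight \<theta> I (\<lambda>l. \<Sum>s<t. D s l \<omega>) l\<bar> * \<bar>D t l \<omega>\<bar> \<le> 1 * R t \<omega>"
        using elim that I by (intro mult_mono abs_soft_weight_le) auto
      then show ?case by (simp add: abs_mult)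
    qed
  qed
  have intH: "integrable M (H t)" "expectation (H t) = 0" if "t < n" for t
    unfolding H_def using that intw mart[OF that _ \<theta>] by auto
  have intG: "integrable M G"
    unfolding G_def using intH R2(1) by (intro Bochner_Integration.integrable_add Bochner_Integration.integrable_sum) auto
  have "expectation G = c / \<theta> + (\<Sum>t<n. 2 * \<theta> * expectation (\<lambda>\<omega>. (R t \<omega>)\<^sup>2))"
  proof -
    have "expectation G = expectation (\<lambda>\<omega>. c / \<theta>) + expectation (\<lambda>\<omega>. \<Sum>t<n. H t \<omega>)
        + expectation (\<lambda>\<omega>. \<Sum>t<n. 2 * \<theta> * (R t \<omega>)\<^sup>2)"
      unfolding G_def using intH R2(1)
      by (subst Bochner_Integration.integral_add | intro Bochner_Integration.integrable_add
          Bochner_Integration.integrable_sum Bochner_Integration.integrable_mult_right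
          integrable_const refl | simp)+
    also have "expectation (\<lambda>\<omega>. \<Sum>t<n. H t \<omega>) = (\<Sum>t<n. expectation (H t))"
      using intH by (intro Bochner_Integration.integral_sum) auto
    also have "\<dots> = 0" using intH by (intro sum.neutral) auto
    also have "expectation (\<lambda>\<omega>. \<Sum>t<n. 2 * \<theta> * (R t \<omega>)\<^sup>2) = (\<Sum>t<n. expectation (\<lambda>\<omega>. 2 * \<theta> * (R t \<omega>)\<^sup>2))"
      using R2(1) by (intro Bochner_Integration.integral_sum) auto
    finally show ?thesis by (simp add: prob_space)
  qed
  also have "\<dots> \<le> c / \<theta> + (\<Sum>t<n. 2 * \<theta> * V)"
    using \<theta> R2(2) by (intro add_left_mono sum_mono mult_left_mono) auto
  also have "\<dots> = c / \<theta> + 2 * V * (real n * \<theta>)" by simp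
  also have "c / \<theta> = sqrt (real n * c)"
  proof -
    have "\<theta> * sqrt (real n * c) = c" using c n by (simp add: \<theta>_def flip: real_sqrt_mult)
    then show ?thesis using \<theta> by (simp add: field_simps)
  qed
  also have "real n * \<theta> = sqrt (real n * c)"
  proof -
    have "real n * \<theta> = sqrt ((real n)\<^sup>2) * \<theta>" by simp
    also have "\<dots> = sqrt ((real n)\<^sup>2 * (c / real n))" unfolding \<theta>_def real_sqrt_mult ..
    also have "(real n)\<^sup>2 * (c / real n) = real n * c" using n by (simp add: power2_eq_square)
    finally show ?thesis .
  qed
  finally have EG: "expectation G \<le> (1 + 2 * V) * sqrt (real n * c)" by (simp add: algebra_simps)
  have "AE \<omega> in M. 0 \<le> G \<omega> \<and> (\<forall>k\<in>I. \<bar>\<Sum>t<n. D t k \<omega>\<bar> \<le> G \<omega>)"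
    using AEb
  proof eventually_elim
    case (elim \<omega>)
    have *: "\<bar>\<Sum>t<n. D t k \<omega>\<bar> \<le> G \<omega>" if k: "k \<in> I" for k
    proof -
      have "\<bar>\<Sum>t<n. D t k \<omega>\<bar> \<le> c / \<theta> + (\<Sum>t<n. H t \<omega>)
          + (\<Sum>t<n. 2 / \<theta> * min ((\<theta> * R t \<omega>)\<^sup>2) (\<theta> * R t \<omega>))"
        unfolding c_def H_def using elim by (intro abs_sum_le_soft_max_path I k \<theta>) auto
      also have "(\<Sum>t<n. 2 / \<theta> * min ((\<theta> * R t \<omega>)\<^sup>2) (\<theta> * R t \<omega>)) \<le> (\<Sum>t<n. 2 * \<theta> * (R t \<omega>)\<^sup>2)"
      proof (rule sum_mono)
        fix t
        have "2 / \<theta> * min ((\<theta> * R t \<omega>)\<^sup>2) (\<theta> * R t \<omega>) \<le> 2 / \<theta> * (\<theta> * R t \<omega>)\<^sup>2"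
          using \<theta> by (intro mult_left_mono) auto
        then show "2 / \<theta> * min ((\<theta> * R t \<omega>)\<^sup>2) (\<theta> * R t \<omega>) \<le> 2 * \<theta> * (R t \<omega>)\<^sup>2"
          using \<theta> by (simp add: power2_eq_square mult_ac)
      qed
      finally show ?thesis by (simp add: G_def)
    qed
    moreover from I obtain k where "k \<in> I" by auto
    ultimately show ?case by (meson abs_ge_zero order_trans)
  qed
  with intG EG show ?thesis unfolding c_def by blast
qed

lemma (in prob_space) indep_past_present:
  fixes n t :: nat
  assumes ind: "indep_vars (\<lambda>_. S) Z {..<n}" and t: "t < n"
    and f: "f \<in> borel_measurable (PiM {..<t} (\<lambda>_. S))" and g: "g \<in> borel_measurable S"
    and fi: "integrable M (\<lambda>\<omega>. f (\<lambda>s\<in>{..<t}. Z s \<omega>) :: real)" and gi: "integrable M (\<lambda>\<omega>. g (Z t \<omega>) :: real)"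
  shows "expectation (\<lambda>\<omega>. f (\<lambda>s\<in>{..<t}. Z s \<omega>) * g (Z t \<omega>))
     = expectation (\<lambda>\<omega>. f (\<lambda>s\<in>{..<t}. Z s \<omega>)) * expectation (\<lambda>\<omega>. g (Z t \<omega>))"
proof -
  have "indep_var (PiM {..<t} (\<lambda>_. S)) (\<lambda>\<omega>. \<lambda>s\<in>{..<t}. Z s \<omega>) (PiM {t} (\<lambda>_. S)) (\<lambda>\<omega>. \<lambda>s\<in>{t}. Z s \<omega>)"
    using t by (intro indep_var_restrict[OF ind]) auto
  from indep_var_compose[OF this f, of "\<lambda>z. g (z t)" borel]
  have "indep_var borel (f \<circ> (\<lambda>\<omega>. \<lambda>s\<in>{..<t}. Z s \<omega>)) borel ((\<lambda>z. g (z t)) \<circ> (\<lambda>\<omega>. \<lambda>s\<in>{t}. Z s \<omega>))"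
    using g by (auto intro: measurable_compose[OF measurable_component_singleton])
  from indep_var_lebesgue_integral[OF this] fi gi
  show ?thesis by (simp add: comp_def)
qed

lemma (in prob_space) max_indep_sum_bound:
  fixes f :: "nat \<Rightarrow> 'i \<Rightarrow> 'b \<Rightarrow> real"
  assumes ind: "indep_vars (\<lambda>_. S) Z {..<n}" and I: "finite I" "I \<noteq> {}" and n: "0 < n"
    and f: "\<And>t k. t < n \<Longrightarrow> k \<in> I \<Longrightarrow> f t k \<in> borel_measurable S"
    and \<rho>: "\<And>t. t < n \<Longrightarrow> \<rho> t \<in> borel_measurable S"
    and bnd: "\<And>t. t < n \<Longrightarrow> AE \<omega> in M. \<forall>k\<in>I. \<bar>f t k (Z t \<omega>)\<bar> \<le> \<rho> t (Z t \<omega>)"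
    and R2: "\<And>t. t < n \<Longrightarrow> integrable M (\<lambda>\<omega>. (\<rho> t (Z t \<omega>))\<^sup>2)"
            "\<And>t. t < n \<Longrightarrow> expectation (\<lambda>\<omega>. (\<rho> t (Z t \<omega>))\<^sup>2) \<le> V"
    and mean: "\<And>t k. t < n \<Longrightarrow> k \<in> I \<Longrightarrow> expectation (\<lambda>\<omega>. f t k (Z t \<omega>)) = 0"
  shows "\<exists>G. integrable M G \<and> expectation G \<le> (1 + 2 * V) * sqrt (real n * ln (2 * real (card I)))
     \<and> (AE \<omega> in M. 0 \<le> G \<omega> \<and> (\<forall>k\<in>I. \<bar>\<Sum>t<n. f t k (Z t \<omega>)\<bar> \<le> G \<omega>))"
proof (rule max_martingale_sum_bound[where R = "\<lambda>t \<omega>. \<rho> t (Z t \<omega>)"])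
  have Z: "Z t \<in> measurable M S" if "t < n" for t using ind that by (auto simp: indep_vars_def2)
  show fm: "(\<lambda>\<omega>. f t k (Z t \<omega>)) \<in> borel_measurable M" if "t < n" "k \<in> I" for t k
    using measurable_compose[OF Z f] that by auto
  show \<rho>m: "(\<lambda>\<omega>. \<rho> t (Z t \<omega>)) \<in> borel_measurable M" if "t < n" for t
    using measurable_compose[OF Z \<rho>] that by auto
  fix \<theta> :: real and t k assume t: "t < n" and k: "k \<in> I" and \<theta>: "0 < \<theta>"
  define F where "F z = soft_weight \<theta> I (\<lambda>l. \<Sum>s<t. f s l (z s)) k" for z
  have comp: "(\<lambda>z. f s l (z s)) \<in> borel_measurable (PiM {..<t} (\<lambda>_. S))" if "s < t" "l \<in> I" for s l
    using that t by (intro measurable_compose[OF measurable_component_singleton[of s] f[of s l]]) auto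
  have Fm: "F \<in> borel_measurable (PiM {..<t} (\<lambda>_. S))"
    unfolding F_def by (intro borel_measurable_soft_weight borel_measurable_sum comp k) auto
  have eq: "soft_weight \<theta> I (\<lambda>l. \<Sum>s<t. f s l (Z s \<omega>)) k = F (\<lambda>s\<in>{..<t}. Z s \<omega>)" for \<omega>
    unfolding F_def by (intro arg_cong2[where f = "soft_weight \<theta> I"] ext) (auto intro!: sum.cong)
  have "integrable M (\<lambda>\<omega>. \<rho> t (Z t \<omega>))"
    by (rule square_integrable_imp_integrable[OF \<rho>m[OF t] R2(1)[OF t]])
  then have gi: "integrable M (\<lambda>\<omega>. f t k (Z t \<omega>))"
    by (rule Bochner_Integration.integrable_bound[OF _ fm[OF t k]])
       (use bnd[OF t] k in \<open>auto elim!: eventually_mono\<close>)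
  have fi: "integrable M (\<lambda>\<omega>. F (\<lambda>s\<in>{..<t}. Z s \<omega>))"
  proof (rule integrable_const_bound[where B = 1])
    show "AE \<omega> in M. norm (F (\<lambda>s\<in>{..<t}. Z s \<omega>)) \<le> 1"
      unfolding F_def using abs_soft_weight_le[OF I(1) k] by simp
    show "(\<lambda>\<omega>. F (\<lambda>s\<in>{..<t}. Z s \<omega>)) \<in> borel_measurable M"
      using t by (intro measurable_compose[OF _ Fm] measurable_restrict Z) auto
  qed
  show "expectation (\<lambda>\<omega>. soft_weight \<theta> I (\<lambda>l. \<Sum>s<t. f s l (Z s \<omega>)) k * f t k (Z t \<omega>)) = 0"
    unfolding eq indep_past_present[OF ind t Fm f[OF t k] fi gi] mean[OF t k] by (rule mult_zero_right)
qed (use assms in auto)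

section \<open>Quadratic forms and the least eigenvalue\<close>

text \<open>
  The quadratic form of the leading \<open>p\<close> by \<open>p\<close> block of a matrix that is given as a function.
\<close>
definition quad_form :: "nat \<Rightarrow> (nat \<Rightarrow> nat \<Rightarrow> real) \<Rightarrow> (nat \<Rightarrow> real) \<Rightarrow> real" where
  "quad_form p A v = (\<Sum>k<p. \<Sum>l<p. v k * A k l * v l)"

lemma mult_mat_vec_fun:
  "mat p p (\<lambda>(k, l). A k l) *\<^sub>v vec p v = vec p (\<lambda>k. \<Sum>l<p. A k l * v l)"
  by (intro eq_vecI) (auto simp: scalar_prod_def lessThan_atLeast0 intro!: sum.cong)

lemma no_kernel_imp_solvable:
  fixes A :: "nat \<Rightarrow> nat \<Rightarrow> real"
  assumes ker: "\<forall>v. (\<forall>k<p. (\<Sum>l<p. A k l * v l) = 0) \<longrightarrow> (\<forall>k<p. v k = 0)"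
  shows "\<exists>B :: nat \<Rightarrow> nat \<Rightarrow> real. \<forall>k<p. \<forall>v. (\<Sum>l<p. A k l * (\<Sum>j<p. B l j * v j)) = v k"
proof -
  define X where "X = mat p p (\<lambda>(k, l). A k l)"
  have X: "X \<in> carrier_mat p p" by (simp add: X_def)
  have "det X \<noteq> 0"
  proof
    assume "det X = 0"
    then obtain w where w: "w \<in> carrier_vec p" "w \<noteq> 0\<^sub>v p" "X *\<^sub>v w = 0\<^sub>v p"
      using det_0_iff_vec_prod_zero_field[OF X] by blast
    define v where "v = vec_index w"
    have wv: "w = vec p v" using w(1) by (auto simp: v_def)
    have zero: "vec p (\<lambda>k. \<Sum>l<p. A k l * v l) = 0\<^sub>v p"
      using w(3) unfolding X_def wv mult_mat_vec_fun .
    have "(\<Sum>l<p. A k l * v l) = 0" if "k < p" for k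
      using that arg_cong[OF zero, of "\<lambda>w. w $ k"] by simp
    then have "\<forall>k<p. v k = 0" using ker by blast
    then have "w = 0\<^sub>v p" unfolding wv by (intro eq_vecI) auto
    with w(2) show False by simp
  qed
  then have "X \<in> Units (ring_mat TYPE(real) p ())" by (rule det_non_zero_imp_unit[OF X])
  then have "\<exists>Y. Y \<in> carrier_mat p p \<and> X * Y = 1\<^sub>m p"
    unfolding Units_def ring_mat_def by auto
  then obtain Y where Y: "Y \<in> carrier_mat p p" "X * Y = 1\<^sub>m p" by blast
  show ?thesis
  proof (intro exI[of _ "\<lambda>k l. Y $$ (k, l)"] allI impI)
    fix k and v :: "nat \<Rightarrow> real" assume k: "k < p"
    have Yv: "Y *\<^sub>v vec p v = vec p (\<lambda>l. \<Sum>j<p. Y $$ (l, j) * v j)"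
      using Y(1) by (intro eq_vecI) (auto simp: scalar_prod_def lessThan_atLeast0 intro!: sum.cong)
    have "X *\<^sub>v (Y *\<^sub>v vec p v) = vec p v"
      using X Y by (simp flip: assoc_mult_mat_vec)
    then have eq: "vec p (\<lambda>k. \<Sum>l<p. A k l * (\<Sum>j<p. Y $$ (l, j) * v j)) = vec p v"
      unfolding Yv X_def mult_mat_vec_fun .
    show "(\<Sum>l<p. A k l * (\<Sum>j<p. Y $$ (l, j) * v j)) = v k"
      using k arg_cong[OF eq, of "\<lambda>w. w $ k"] by simp
  qed
qed

lemma quad_form_add:
  assumes sym: "\<forall>k<p. \<forall>l<p. A k l = A l k"
  shows "quad_form p A (\<lambda>k. v k + s * w k)
    = quad_form p A v + 2 * s * (\<Sum>k<p. w k * (\<Sum>l<p. A k l * v l)) + s\<^sup>2 * quad_form p A w"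
proof -
  have swap: "(\<Sum>k<p. \<Sum>l<p. v k * A k l * w l) = (\<Sum>k<p. \<Sum>l<p. w k * A k l * v l)"
    by (subst sum.swap) (auto intro!: sum.cong simp: sym)
  have "quad_form p A (\<lambda>k. v k + s * w k)
    = quad_form p A v + s * (\<Sum>k<p. \<Sum>l<p. v k * A k l * w l)
      + s * (\<Sum>k<p. \<Sum>l<p. w k * A k l * v l) + s\<^sup>2 * quad_form p A w"
    unfolding quad_form_def sum_distrib_left sum.distrib[symmetric]
    by (intro sum.cong refl) (simp add: algebra_simps power2_eq_square)
  then show ?thesis unfolding swap by (simp add: sum_distrib_left mult_ac)
qed

lemma psd_Cauchy_Schwarz:
  assumes sym: "\<forall>k<p. \<forall>l<p. A k l = A l k" and psd: "\<And>v. 0 \<le> quad_form p A v"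
  shows "(\<Sum>k<p. w k * (\<Sum>l<p. A k l * v l))\<^sup>2 \<le> quad_form p A v * quad_form p A w"
proof -
  define b where "b = (\<Sum>k<p. w k * (\<Sum>l<p. A k l * v l))"
  have q: "0 \<le> quad_form p A v + 2 * s * b + s\<^sup>2 * quad_form p A w" for s
  proof -
    have "quad_form p A (\<lambda>k. v k + s * w k)
      = quad_form p A v + 2 * s * (\<Sum>k<p. w k * (\<Sum>l<p. A k l * v l)) + s\<^sup>2 * quad_form p A w"
      by (rule quad_form_add[OF sym])
    then show ?thesis using psd[of "\<lambda>k. v k + s * w k"] unfolding b_def by argo
  qed
  show ?thesis unfolding b_def[symmetric]
  proof (cases "quad_form p A w = 0")
    case True
    have "b = 0"
    proof (rule ccontr)
      assume "b \<noteq> 0"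
      define s0 where "s0 = - (quad_form p A v + 1) / (2 * b)"
      have "2 * s0 * b = - (quad_form p A v + 1)" using \<open>b \<noteq> 0\<close> by (simp add: s0_def)
      moreover have "0 \<le> quad_form p A v + 2 * s0 * b" using q[of s0] True by simp
      ultimately show False by linarith
    qed
    then show "b\<^sup>2 \<le> quad_form p A v * quad_form p A w" using True by simp
  next
    case False
    then have pos: "0 < quad_form p A w" using psd[of w] by simp
    have "0 \<le> quad_form p A v - b\<^sup>2 / quad_form p A w"
      using q[of "- b / quad_form p A w"] pos
      by (simp add: power2_eq_square field_simps)
    then show "b\<^sup>2 \<le> quad_form p A v * quad_form p A w"
      using pos by (simp add: field_simps)
  qed
qed

lemma quad_form_shift:
  "quad_form p (\<lambda>k l. A k l - (if k = l then t else 0)) v = quad_form p A v - t * (\<Sum>k<p. (v k)\<^sup>2)"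
proof -
  have "quad_form p (\<lambda>k l. A k l - (if k = l then t else 0)) v
     = (\<Sum>k<p. \<Sum>l<p. v k * A k l * v l - (if k = l then t * v k * v k else 0))"
    unfolding quad_form_def by (intro sum.cong refl) (auto simp: algebra_simps)
  also have "\<dots> = quad_form p A v - (\<Sum>k<p. t * v k * v k)"
    by (simp add: sum_subtractf quad_form_def sum.delta')
  finally show ?thesis by (simp add: sum_distrib_left power2_eq_square mult_ac)
qed

text \<open>
  For a positive semidefinite \<open>A\<close> with inverse \<open>B\<close>, the Cauchy-Schwarz inequality for the form of
  \<open>A\<close>, applied to \<open>v\<close> and \<open>B v\<close>, bounds \<open>\<parallel>v\<parallel>\<^sup>4\<close> by \<open>(v\<^sup>T A v) * (v\<^sup>T B v)\<close>.
\<close>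
lemma psd_solvable_imp_coercive:
  assumes sym: "\<forall>k<p. \<forall>l<p. A k l = A l k" and psd: "\<And>v. 0 \<le> quad_form p A v"
    and ker: "\<forall>v. (\<forall>k<p. (\<Sum>l<p. A k l * v l) = 0) \<longrightarrow> (\<forall>k<p. v k = 0)"
  shows "\<exists>e>0. \<forall>v. e * (\<Sum>k<p. (v k)\<^sup>2) \<le> quad_form p A v"
proof -
  obtain B where B: "\<And>k v. k < p \<Longrightarrow> (\<Sum>l<p. A k l * (\<Sum>j<p. B l j * v j)) = v k"
    using no_kernel_imp_solvable[OF ker] by auto
  define b where "b = 1 + (\<Sum>k<p. \<Sum>l<p. \<bar>B k l\<bar>)"
  have b1: "1 \<le> b" unfolding b_def by (simp add: sum_nonneg)
  have "(\<Sum>k<p. (v k)\<^sup>2) \<le> b * quad_form p A v" for v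
  proof -
    define n where "n = (\<Sum>k<p. (v k)\<^sup>2)"
    have n0: "0 \<le> n" unfolding n_def by (simp add: sum_nonneg)
    define w where "w l = (\<Sum>j<p. B l j * v j)" for l
    have Aw: "(\<Sum>l<p. A k l * w l) = v k" if "k < p" for k using B[OF that] by (simp add: w_def)
    have "n\<^sup>2 = (\<Sum>k<p. v k * (\<Sum>l<p. A k l * w l))\<^sup>2"
      unfolding n_def by (auto simp: Aw power2_eq_square intro!: arg_cong2[where f="(*)"] sum.cong)
    also have "\<dots> \<le> quad_form p A w * quad_form p A v" by (rule psd_Cauchy_Schwarz[OF sym psd])
    also have "quad_form p A w = (\<Sum>k<p. w k * (\<Sum>l<p. A k l * w l))"
      by (simp add: quad_form_def sum_distrib_left mult_ac)
    also have "\<dots> = (\<Sum>k<p. w k * v k)"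
      by (intro sum.cong refl) (simp add: Aw)
    also have "\<dots> = (\<Sum>k<p. \<Sum>j<p. B k j * (v j * v k))"
      by (simp add: w_def sum_distrib_right sum_distrib_left mult_ac)
    also have "\<dots> \<le> (\<Sum>k<p. \<Sum>j<p. \<bar>B k j\<bar> * n)"
    proof (intro sum_mono)
      fix k j assume kj: "k \<in> {..<p}" "j \<in> {..<p}"
      have "(v k)\<^sup>2 \<le> n" "(v j)\<^sup>2 \<le> n" unfolding n_def using kj by (auto intro!: member_le_sum)
      moreover have "0 \<le> (\<bar>v j\<bar> - \<bar>v k\<bar>)\<^sup>2" by simp
      ultimately have "\<bar>v j * v k\<bar> \<le> n" by (simp add: power2_diff abs_mult)
      then show "B k j * (v j * v k) \<le> \<bar>B k j\<bar> * n"
        using mult_left_mono[of "\<bar>v j * v k\<bar>" n "\<bar>B k j\<bar>"] abs_ge_self[of "B k j * (v j * v k)"]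
        by (simp add: abs_mult)
    qed
    also have "\<dots> = (b - 1) * n" unfolding b_def by (simp add: sum_distrib_right)
    also have "\<dots> \<le> b * n" using n0 by (simp add: algebra_simps)
    finally have "n\<^sup>2 \<le> b * n * quad_form p A v" using psd by (meson mult_right_mono)
    then have "n \<le> b * quad_form p A v"
    proof (cases "n = 0")
      case True
      then show ?thesis using psd[of v] b1 by simp
    next
      case False
      then have "0 < n" using n0 by simp
      moreover have "n * n \<le> n * (b * quad_form p A v)"
        using \<open>n\<^sup>2 \<le> b * n * quad_form p A v\<close> by (simp add: power2_eq_square mult_ac)
      ultimately show ?thesis by simp
    qed
    then show ?thesis by (simp add: n_def)
  qed
  then have "1 / b * (\<Sum>k<p. (v k)\<^sup>2) \<le> quad_form p A v" for v
    using b1 by (simp add: pos_divide_le_eq mult.commute)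
  then show ?thesis using b1 by (intro exI[of _ "1 / b"]) auto
qed

text \<open>
  Let \<open>s\<close> be the largest number for which \<open>A - s\<close> is still positive semidefinite.  If \<open>s\<close> were
  not an eigenvalue, \<open>A - s\<close> would be coercive and \<open>s\<close> could be enlarged.  Hence the least
  eigenvalue is at most \<open>s\<close>.
\<close>
lemma min_eigenvalue_le_Rayleigh:
  assumes p: "0 < p" and sym: "\<forall>k<p. \<forall>l<p. A k l = A l k"
    and psd: "\<And>v. 0 \<le> quad_form p A v"
  shows "Min {e. eigenvalue (mat p p (\<lambda>(k, l). A k l)) e} * (\<Sum>k<p. (v k)\<^sup>2) \<le> quad_form p A v"
proof -
  define X where "X = mat p p (\<lambda>(k, l). A k l)"
  have X: "X \<in> carrier_mat p p" by (simp add: X_def)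
  have fin: "finite {e. eigenvalue X e}"
    using card_finite_spectrum(1)[OF X] by (simp add: spectrum_def)
  define T where "T = {t. \<forall>v. t * (\<Sum>k<p. (v k)\<^sup>2) \<le> quad_form p A v}"
  have T0: "0 \<in> T" using psd by (simp add: T_def)
  have upper: "t \<le> A 0 0" if "t \<in> T" for t
  proof -
    have "t * (\<Sum>k<p. (if k = 0 then 1 else 0 :: real)\<^sup>2) \<le> quad_form p A (\<lambda>k. if k = 0 then 1 else 0)"
      using that by (simp add: T_def)
    also have "quad_form p A (\<lambda>k. if k = 0 then 1 else 0)
        = (\<Sum>k<p. if k = 0 then (\<Sum>l<p. if l = 0 then A k l else 0) else 0)"
      unfolding quad_form_def
    proof (rule sum.cong[OF refl])
      fix k
      have "(\<Sum>l<p. (if k = 0 then 1 else 0) * A k l * (if l = 0 then 1 else 0))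
        = (\<Sum>l<p. if k = 0 then (if l = 0 then A k l else 0) else 0)"
        by (rule sum.cong) auto
      then show "(\<Sum>l<p. (if k = 0 then 1 else 0) * A k l * (if l = 0 then 1 else 0))
        = (if k = 0 then (\<Sum>l<p. if l = 0 then A k l else 0) else 0)"
        by (cases "k = 0") simp_all
    qed
    also have "\<dots> = A 0 0" using p by simp
    also have "(\<Sum>k<p. (if k = 0 then 1 else 0 :: real)\<^sup>2) = (\<Sum>k<p. if k = 0 then 1 else 0)"
      by (intro sum.cong) auto
    also have "\<dots> = 1" using p by simp
    finally show ?thesis by simp
  qed
  define s where "s = Sup T"
  have bdd: "bdd_above T" using upper by (auto simp: bdd_above_def)
  have sT: "s \<in> T" unfolding T_def
  proof safe
    fix v :: "nat \<Rightarrow> real"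
    define n where "n = (\<Sum>k<p. (v k)\<^sup>2)"
    have n0: "0 \<le> n" unfolding n_def by (simp add: sum_nonneg)
    show "s * (\<Sum>k<p. (v k)\<^sup>2) \<le> quad_form p A v" unfolding n_def[symmetric]
    proof (cases "n = 0")
      case True then show "s * n \<le> quad_form p A v" using psd by simp
    next
      case False
      then have n: "0 < n" using n0 by simp
      have "s \<le> quad_form p A v / n"
        unfolding s_def
      proof (rule cSup_least)
        show "T \<noteq> {}" using T0 by auto
        show "t \<le> quad_form p A v / n" if "t \<in> T" for t
          using that n by (simp add: T_def n_def pos_le_divide_eq)
      qed
      then show "s * n \<le> quad_form p A v" using n by (simp add: field_simps)
    qed
  qed
  have "eigenvalue X s"
  proof (rule ccontr)
    assume not: "\<not> eigenvalue X s"
    define A' where "A' k l = A k l - (if k = l then s else 0)" for k l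
    have A'v: "(\<Sum>l<p. A' k l * v l) = (\<Sum>l<p. A k l * v l) - s * v k" if "k < p" for k v
      using that by (simp add: A'_def left_diff_distrib sum_subtractf if_distrib[of "\<lambda>x. x * _"] cong: if_cong)
    have ker0: "\<forall>k<p. v k = 0" if v: "\<forall>k<p. (\<Sum>l<p. A' k l * v l) = 0" for v
    proof (rule ccontr)
      assume nz: "\<not> (\<forall>k<p. v k = 0)"
      have "X *\<^sub>v vec p v = s \<cdot>\<^sub>v vec p v"
        unfolding X_def mult_mat_vec_fun using v A'v by (intro eq_vecI) auto
      moreover have "vec p v \<noteq> 0\<^sub>v p"
      proof
        assume "vec p v = 0\<^sub>v p"
        then have "v k = 0" if "k < p" for k using that by (metis index_vec index_zero_vec(1))
        with nz show False by blast
      qed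
      ultimately have "eigenvector X (vec p v) s" using X by (simp add: eigenvector_def)
      with not show False by (auto simp: eigenvalue_def)
    qed
    have ker: "\<forall>v. (\<forall>k<p. (\<Sum>l<p. A' k l * v l) = 0) \<longrightarrow> (\<forall>k<p. v k = 0)"
      using ker0 by blast
    have psd': "0 \<le> quad_form p A' v" for v
      using sT unfolding A'_def[abs_def] quad_form_shift T_def by simp
    have sym': "\<forall>k<p. \<forall>l<p. A' k l = A' l k" using sym by (simp add: A'_def)
    obtain e where e: "0 < e" "\<And>v. e * (\<Sum>k<p. (v k)\<^sup>2) \<le> quad_form p A' v"
      using psd_solvable_imp_coercive[OF sym' psd' ker] by auto
    have "s + e \<in> T"
      using e(2) unfolding T_def A'_def[abs_def] quad_form_shift by (simp add: algebra_simps)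
    then have "s + e \<le> s" unfolding s_def using bdd by (intro cSup_upper) auto
    with e(1) show False by simp
  qed
  then have "Min {e. eigenvalue X e} \<le> s" using fin by (intro Min_le) auto
  then have "Min {e. eigenvalue X e} * (\<Sum>k<p. (v k)\<^sup>2) \<le> s * (\<Sum>k<p. (v k)\<^sup>2)"
    by (intro mult_right_mono) (simp_all add: sum_nonneg)
  also have "\<dots> \<le> quad_form p A v" using sT by (simp add: T_def)
  finally show ?thesis by (simp add: X_def)
qed

text \<open>
  The vector \<open>u = A\<^sup>-\<^sup>1 e\<^sub>r\<close>.  Coercivity gives \<open>(u r)\<^sup>2 \<le> L * u r\<close>, and \<open>u r\<close> is the value of the
  quadratic form at \<open>u\<close>.
\<close>
lemma coercive_dual_vector:
  assumes r: "r < p" and sym: "\<forall>k<p. \<forall>l<p. A k l = A l k"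
    and L: "0 < L" and coer: "\<And>v. (\<Sum>k<p. (v k)\<^sup>2) \<le> L * quad_form p A v"
  shows "\<exists>u. (\<forall>k<p. (\<Sum>l<p. A k l * u l) = (if k = r then 1 else 0)) \<and> quad_form p A u \<le> L"
proof -
  have ker0: "\<forall>k<p. v k = 0" if v: "\<forall>k<p. (\<Sum>l<p. A k l * v l) = 0" for v
  proof -
    have "quad_form p A v = (\<Sum>k<p. v k * (\<Sum>l<p. A k l * v l))"
      by (simp add: quad_form_def sum_distrib_left mult_ac)
    also have "\<dots> = 0" using v by simp
    finally have "(\<Sum>k<p. (v k)\<^sup>2) \<le> 0" using coer[of v] by simp
    then have "(\<Sum>k<p. (v k)\<^sup>2) = 0" by (simp add: sum_nonneg order_antisym)
    then show ?thesis by (subst (asm) sum_nonneg_eq_0_iff) auto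
  qed
  then have ker: "\<forall>v. (\<forall>k<p. (\<Sum>l<p. A k l * v l) = 0) \<longrightarrow> (\<forall>k<p. v k = 0)" by blast
  obtain B where B: "\<And>k v. k < p \<Longrightarrow> (\<Sum>l<p. A k l * (\<Sum>j<p. B l j * v j)) = v k"
    using no_kernel_imp_solvable[OF ker] by auto
  define u where "u l = (\<Sum>j<p. B l j * (if j = r then 1 else 0))" for l
  have Au: "(\<Sum>l<p. A k l * u l) = (if k = r then 1 else 0)" if "k < p" for k
    unfolding u_def by (rule B[OF that])
  have "quad_form p A u = (\<Sum>k<p. u k * (\<Sum>l<p. A k l * u l))"
    by (simp add: quad_form_def sum_distrib_left mult_ac)
  also have "\<dots> = (\<Sum>k<p. if k = r then u k else 0)" by (intro sum.cong) (auto simp: Au)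
  also have "\<dots> = u r" using r by simp
  finally have q: "quad_form p A u = u r" .
  have "(u r)\<^sup>2 \<le> (\<Sum>k<p. (u k)\<^sup>2)" using r by (intro member_le_sum) auto
  also have "\<dots> \<le> L * u r" using coer[of u] q by simp
  finally have "u r \<le> L"
    using L by (cases "0 < u r") (auto simp: power2_eq_square)
  with q Au show ?thesis by (intro exI[of _ u]) auto
qed

section \<open>The lasso: residuals, optimality conditions, duality\<close>

text \<open>
  The lasso criterion for the response \<open>y\<close> and the rows \<open>x i\<close>, \<open>i < n\<close>, with predictors indexed
  by the finite set \<open>J\<close>.
\<close>
definition lasso_loss ::
    "nat \<Rightarrow> real \<Rightarrow> nat set \<Rightarrow> (nat \<Rightarrow> real) \<Rightarrow> (nat \<Rightarrow> nat \<Rightarrow> real) \<Rightarrow> (nat \<Rightarrow> real) \<Rightarrow> real" where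
  "lasso_loss n lam J y x \<gamma> =
     1 / (2 * real n) * (\<Sum>i<n. (y i - (\<Sum>k\<in>J. x i k * \<gamma> k))\<^sup>2) + lam * (\<Sum>k\<in>J. \<bar>\<gamma> k\<bar>)"

text \<open>
  The coefficient vector with the rational entries \<open>l\<close>, padded by zeros: a countable family that
  is dense in the coefficient space.
\<close>
definition rat_vector :: "rat list \<Rightarrow> nat \<Rightarrow> real" where
  "rat_vector l k = (if k < length l then of_rat (l ! k) else 0)"

text \<open>
  The minimal value of the criterion, as an infimum over countably many coefficient vectors so
  that it is visibly measurable in the data.
\<close>
definition lasso_value ::
    "nat \<Rightarrow> real \<Rightarrow> nat set \<Rightarrow> (nat \<Rightarrow> real) \<Rightarrow> (nat \<Rightarrow> nat \<Rightarrow> real) \<Rightarrow> real" where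
  "lasso_value n lam J y x = (INF l. lasso_loss n lam J y x (rat_vector l))"

text \<open>
  The \<open>i\<close>-th residual of the lasso fit, expressed through the data alone: it is \<open>n\<close> times the
  derivative of the minimal value with respect to the response \<open>y i\<close>.  In this form it does not
  depend on the choice of a minimizer, and it is measurable and equivariant under permutations
  of the rows.
\<close>
definition lasso_resid ::
    "nat \<Rightarrow> real \<Rightarrow> nat set \<Rightarrow> (nat \<Rightarrow> real) \<Rightarrow> (nat \<Rightarrow> nat \<Rightarrow> real) \<Rightarrow> nat \<Rightarrow> real" where
  "lasso_resid n lam J y x i = lim (\<lambda>h. real n * real (Suc h) *
     (lasso_value n lam J (y(i := y i + 1 / real (Suc h))) x - lasso_value n lam J y x))"

lemma lasso_loss_nonneg: "0 \<le> lam \<Longrightarrow> 0 \<le> lasso_loss n lam J y x \<gamma>"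
  unfolding lasso_loss_def by (intro add_nonneg_nonneg mult_nonneg_nonneg sum_nonneg) auto

lemma bdd_below_lasso_loss: "0 \<le> lam \<Longrightarrow> bdd_below (range (\<lambda>l. lasso_loss n lam J y x (rat_vector l)))"
  using lasso_loss_nonneg by (intro bdd_belowI[of _ 0]) auto

lemma lasso_value_le:
  assumes J: "finite J" and lam: "0 \<le> lam"
  shows "lasso_value n lam J y x \<le> lasso_loss n lam J y x \<gamma>"
proof -
  have "\<exists>q. \<bar>\<gamma> k - of_rat q\<bar> < 1 / real (Suc m)" for k m
  proof -
    obtain q where "\<gamma> k < of_rat q" "of_rat q < \<gamma> k + 1 / real (Suc m)"
      using of_rat_dense[of "\<gamma> k" "\<gamma> k + 1 / real (Suc m)"] by auto
    then show ?thesis by (intro exI[of _ q]) simp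
  qed
  note approx = this
  define q where "q m k = (SOME q. \<bar>\<gamma> k - of_rat q\<bar> < 1 / real (Suc m))" for m k
  have q: "\<bar>\<gamma> k - of_rat (q m k)\<bar> < 1 / real (Suc m)" for m k
    unfolding q_def by (rule someI_ex[OF approx])
  define g where "g m = rat_vector (map (q m) [0..<Suc (Max (insert 0 J))])" for m
  have g: "g m k = of_rat (q m k)" if "k \<in> J" for m k
  proof -
    have "k < Suc (Max (insert 0 J))" using J that by (simp add: less_Suc_eq_le)
    then show ?thesis by (simp add: g_def rat_vector_def del: upt_Suc)
  qed
  have lim: "(\<lambda>m. g m k) \<longlonglongrightarrow> \<gamma> k" if k: "k \<in> J" for k
  proof (rule LIMSEQ_I)
    fix e :: real assume "0 < e"
    then obtain N where N: "1 / real (Suc N) < e" by (metis nat_approx_posE)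
    show "\<exists>no. \<forall>n\<ge>no. norm (g n k - \<gamma> k) < e"
    proof (intro exI allI impI)
      fix m assume "N \<le> m"
      then have "1 / real (Suc m) \<le> 1 / real (Suc N)" by (intro divide_left_mono) auto
      then show "norm (g m k - \<gamma> k) < e" using N q[of k m] g[OF k, of m] by (simp add: abs_minus_commute)
    qed
  qed
  have "(\<lambda>m. lasso_loss n lam J y x (g m)) \<longlonglongrightarrow> lasso_loss n lam J y x \<gamma>"
    unfolding lasso_loss_def by (intro tendsto_intros lim)
  moreover have "lasso_value n lam J y x \<le> lasso_loss n lam J y x (g m)" for m
    unfolding lasso_value_def g_def by (intro cINF_lower bdd_below_lasso_loss lam) auto
  ultimately show ?thesis by (intro LIMSEQ_le_const) auto
qed

context
  fixes n :: nat and lam :: real and J :: "nat set" and y :: "nat \<Rightarrow> real"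
    and x :: "nat \<Rightarrow> nat \<Rightarrow> real" and \<gamma> :: "nat \<Rightarrow> real"
  assumes n: "0 < n" and lam: "0 \<le> lam" and J: "finite J"
    and min: "\<And>\<gamma>'. lasso_loss n lam J y x \<gamma> \<le> lasso_loss n lam J y x \<gamma>'"
begin

abbreviation (input) "res i \<equiv> y i - (\<Sum>k\<in>J. x i k * \<gamma> k)"

lemma lasso_value_eq: "lasso_value n lam J y x = lasso_loss n lam J y x \<gamma>"
  using lasso_value_le[OF J lam] unfolding lasso_value_def
  by (intro antisym) (auto intro!: cINF_greatest min)

lemma lasso_loss_perturb:
  assumes i: "i < n"
  shows "lasso_loss n lam J (y(i := y i + h)) x \<gamma> = lasso_loss n lam J y x \<gamma> + h * res i / n + h\<^sup>2 / (2 * n)"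
proof -
  have alg: "1 / (2 * real n) * (A + (2 * h * c + h\<^sup>2)) + P
     = (1 / (2 * real n) * A + P) + h * c / n + h\<^sup>2 / (2 * n)" for A P c
    using n by (simp add: field_simps)
  have "(\<Sum>l<n. ((y(i := y i + h)) l - (\<Sum>k\<in>J. x l k * \<gamma> k))\<^sup>2)
     = (\<Sum>l<n. (res l)\<^sup>2 + (if l = i then 2 * h * res l + h\<^sup>2 else 0))"
    by (intro sum.cong refl) (auto simp: power2_eq_square algebra_simps)
  also have "\<dots> = (\<Sum>l<n. (res l)\<^sup>2) + (2 * h * res i + h\<^sup>2)"
    using i by (simp add: sum.distrib)
  finally show ?thesis unfolding lasso_loss_def by (simp only: alg)
qed

text \<open>
  Joint convexity of the criterion in the response and the coefficients, at the midpoint of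
  opposite perturbations of one response.
\<close>
lemma lasso_loss_midpoint:
  "2 * lasso_loss n lam J y x (\<lambda>k. (\<gamma>1 k + \<gamma>2 k) / 2)
    \<le> lasso_loss n lam J (y(i := y i + h)) x \<gamma>1 + lasso_loss n lam J (y(i := y i - h)) x \<gamma>2"
proof -
  let ?f = "\<lambda>y \<gamma> l. y l - (\<Sum>k\<in>J. x l k * \<gamma> k)"
  have "2 * (\<Sum>l<n. (?f y (\<lambda>k. (\<gamma>1 k + \<gamma>2 k) / 2) l)\<^sup>2)
     \<le> (\<Sum>l<n. (?f (y(i := y i + h)) \<gamma>1 l)\<^sup>2) + (\<Sum>l<n. (?f (y(i := y i - h)) \<gamma>2 l)\<^sup>2)"
    unfolding sum_distrib_left sum.distrib[symmetric]
  proof (rule sum_mono)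
    fix l
    define a b where "a = ?f (y(i := y i + h)) \<gamma>1 l" and "b = ?f (y(i := y i - h)) \<gamma>2 l"
    have "(\<Sum>k\<in>J. x l k * ((\<gamma>1 k + \<gamma>2 k) / 2)) = ((\<Sum>k\<in>J. x l k * \<gamma>1 k) + (\<Sum>k\<in>J. x l k * \<gamma>2 k)) / 2"
      unfolding sum.distrib[symmetric] sum_divide_distrib by (intro sum.cong refl) (simp add: field_simps)
    then have eq: "?f y (\<lambda>k. (\<gamma>1 k + \<gamma>2 k) / 2) l = (a + b) / 2"
      unfolding a_def b_def by (auto simp: field_simps)
    have "2 * ((a + b) / 2)\<^sup>2 \<le> a\<^sup>2 + b\<^sup>2"
      using zero_le_power2[of "a - b"] by (simp add: power2_eq_square field_simps)
    then have "2 * (?f y (\<lambda>k. (\<gamma>1 k + \<gamma>2 k) / 2) l)\<^sup>2 \<le> a\<^sup>2 + b\<^sup>2" by (simp only: eq)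
    then show "2 * (?f y (\<lambda>k. (\<gamma>1 k + \<gamma>2 k) / 2) l)\<^sup>2
       \<le> (?f (y(i := y i + h)) \<gamma>1 l)\<^sup>2 + (?f (y(i := y i - h)) \<gamma>2 l)\<^sup>2"
      unfolding a_def b_def .
  qed
  then have "1 / (2 * real n) * (2 * (\<Sum>l<n. (?f y (\<lambda>k. (\<gamma>1 k + \<gamma>2 k) / 2) l)\<^sup>2))
     \<le> 1 / (2 * real n) * ((\<Sum>l<n. (?f (y(i := y i + h)) \<gamma>1 l)\<^sup>2) + (\<Sum>l<n. (?f (y(i := y i - h)) \<gamma>2 l)\<^sup>2))"
    by (intro mult_left_mono) auto
  moreover have "2 * (lam * (\<Sum>k\<in>J. \<bar>(\<gamma>1 k + \<gamma>2 k) / 2\<bar>)) \<le> lam * (\<Sum>k\<in>J. \<bar>\<gamma>1 k\<bar>) + lam * (\<Sum>k\<in>J. \<bar>\<gamma>2 k\<bar>)"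
  proof -
    have "2 * (\<Sum>k\<in>J. \<bar>(\<gamma>1 k + \<gamma>2 k) / 2\<bar>) \<le> (\<Sum>k\<in>J. \<bar>\<gamma>1 k\<bar>) + (\<Sum>k\<in>J. \<bar>\<gamma>2 k\<bar>)"
      unfolding sum_distrib_left sum.distrib[symmetric] by (intro sum_mono) (simp add: abs_triangle_ineq)
    then have "lam * (2 * (\<Sum>k\<in>J. \<bar>(\<gamma>1 k + \<gamma>2 k) / 2\<bar>)) \<le> lam * ((\<Sum>k\<in>J. \<bar>\<gamma>1 k\<bar>) + (\<Sum>k\<in>J. \<bar>\<gamma>2 k\<bar>))"
      using lam by (rule mult_left_mono)
    then show ?thesis by (simp add: algebra_simps)
  qed
  ultimately show ?thesis unfolding lasso_loss_def by (simp add: algebra_simps)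
qed

lemma lasso_value_perturb:
  assumes i: "i < n"
  shows "\<bar>lasso_value n lam J (y(i := y i + h)) x - lasso_value n lam J y x - h * res i / n\<bar> \<le> h\<^sup>2 / (2 * n)"
proof -
  have "lasso_value n lam J (y(i := y i + h)) x \<le> lasso_value n lam J y x + h * res i / n + h\<^sup>2 / (2 * n)"
    using lasso_value_le[OF J lam, of n "y(i := y i + h)" x \<gamma>] lasso_loss_perturb[OF i, of h] lasso_value_eq
    by simp
  moreover have "lasso_value n lam J y x + h * res i / n - h\<^sup>2 / (2 * n) \<le> lasso_value n lam J (y(i := y i + h)) x"
    unfolding lasso_value_def[of n lam J "y(i := y i + h)"]
  proof (rule cINF_greatest)
    fix l :: "rat list"
    have "2 * lasso_loss n lam J y x \<gamma> \<le> 2 * lasso_loss n lam J y x (\<lambda>k. (rat_vector l k + \<gamma> k) / 2)"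
      using min by simp
    also have "\<dots> \<le> lasso_loss n lam J (y(i := y i + h)) x (rat_vector l) + lasso_loss n lam J (y(i := y i - h)) x \<gamma>"
      by (rule lasso_loss_midpoint)
    finally show "lasso_value n lam J y x + h * res i / n - h\<^sup>2 / (2 * n)
        \<le> lasso_loss n lam J (y(i := y i + h)) x (rat_vector l)"
      using lasso_loss_perturb[OF i, of "- h"] lasso_value_eq by simp
  qed auto
  ultimately show ?thesis by (simp add: abs_le_iff)
qed

lemma lasso_resid_eq:
  assumes i: "i < n"
  shows "lasso_resid n lam J y x i = res i"
  unfolding lasso_resid_def
proof (rule limI, rule LIMSEQ_I)
  fix e :: real assume "0 < e"
  then obtain N where N: "1 / real (Suc N) < e" by (metis nat_approx_posE)
  show "\<exists>no. \<forall>m\<ge>no. norm (real n * real (Suc m) * (lasso_value n lam J (y(i := y i + 1 / real (Suc m))) x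
       - lasso_value n lam J y x) - res i) < e"
  proof (intro exI allI impI)
    fix m assume m: "N \<le> m"
    define d where "d = lasso_value n lam J (y(i := y i + 1 / real (Suc m))) x - lasso_value n lam J y x"
    define s where "s = real (Suc m)"
    have s: "0 < s" by (simp add: s_def)
    have "\<bar>d - 1 / s * res i / n\<bar> \<le> (1 / s)\<^sup>2 / (2 * n)"
      using lasso_value_perturb[OF i, of "1 / s"] by (simp add: d_def s_def)
    then have "real n * s * \<bar>d - 1 / s * res i / n\<bar> \<le> real n * s * ((1 / s)\<^sup>2 / (2 * n))"
      using s by (intro mult_left_mono) auto
    also have "\<dots> = 1 / s / 2" using n s by (simp add: power2_eq_square field_simps)
    also have "\<dots> < 1 / s" using s by (simp add: field_simps)
    also have "real n * s * \<bar>d - 1 / s * res i / n\<bar> = \<bar>real n * s * (d - 1 / s * res i / n)\<bar>"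
      using s by (simp add: abs_mult)
    also have "real n * s * (d - 1 / s * res i / n) = real n * s * d - res i"
      using n s by (simp add: field_simps)
    finally have "\<bar>real n * s * d - res i\<bar> < 1 / s" .
    also have "1 / s \<le> 1 / real (Suc N)" unfolding s_def using m by (intro divide_left_mono) auto
    finally show "norm (real n * real (Suc m) * (lasso_value n lam J (y(i := y i + 1 / real (Suc m))) x
       - lasso_value n lam J y x) - res i) < e"
      using N by (simp add: d_def s_def)
  qed
qed

lemma lasso_loss_add:
  "lasso_loss n lam J y x (\<lambda>k. \<gamma> k + t * v k) = 1 / (2 * real n) * ((\<Sum>i<n. (res i)\<^sup>2)
     - 2 * t * (\<Sum>i<n. res i * (\<Sum>k\<in>J. x i k * v k)) + t\<^sup>2 * (\<Sum>i<n. (\<Sum>k\<in>J. x i k * v k)\<^sup>2))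
     + lam * (\<Sum>k\<in>J. \<bar>\<gamma> k + t * v k\<bar>)"
proof -
  have "(\<Sum>i<n. (y i - (\<Sum>k\<in>J. x i k * (\<gamma> k + t * v k)))\<^sup>2)
     = (\<Sum>i<n. (res i)\<^sup>2 - 2 * t * (res i * (\<Sum>k\<in>J. x i k * v k)) + t\<^sup>2 * (\<Sum>k\<in>J. x i k * v k)\<^sup>2)"
  proof (intro sum.cong refl)
    fix i
    have "y i - (\<Sum>k\<in>J. x i k * (\<gamma> k + t * v k)) = res i - t * (\<Sum>k\<in>J. x i k * v k)"
      by (simp add: sum_distrib_left distrib_left sum.distrib mult_ac)
    moreover have "(e - t * w)\<^sup>2 = e\<^sup>2 - 2 * t * (e * w) + t\<^sup>2 * w\<^sup>2" for e w
      by (simp add: power2_eq_square algebra_simps)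
    ultimately show "(y i - (\<Sum>k\<in>J. x i k * (\<gamma> k + t * v k)))\<^sup>2
       = (res i)\<^sup>2 - 2 * t * (res i * (\<Sum>k\<in>J. x i k * v k)) + t\<^sup>2 * (\<Sum>k\<in>J. x i k * v k)\<^sup>2"
      by (simp only:)
  qed
  then show ?thesis unfolding lasso_loss_def by (simp add: sum.distrib sum_subtractf sum_distrib_left)
qed

text \<open>
  The first order condition in a direction \<open>v\<close> along which the penalty grows at rate at most \<open>c\<close>.
\<close>
lemma lasso_first_order:
  assumes pen: "\<And>t. 0 < t \<Longrightarrow> t < 1 \<Longrightarrow> (\<Sum>k\<in>J. \<bar>\<gamma> k + t * v k\<bar>) \<le> (\<Sum>k\<in>J. \<bar>\<gamma> k\<bar>) + t * c"
  shows "(\<Sum>i<n. res i * (\<Sum>k\<in>J. x i k * v k)) \<le> real n * lam * c"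
proof (rule field_le_epsilon)
  define a s where "a = (\<Sum>i<n. res i * (\<Sum>k\<in>J. x i k * v k))" and "s = (\<Sum>i<n. (\<Sum>k\<in>J. x i k * v k)\<^sup>2)"
  fix e :: real assume e: "0 < e"
  have s0: "0 \<le> s" unfolding s_def by (intro sum_nonneg) auto
  define t where "t = Min {1 / 2, e / (1 + s)}"
  have t: "0 < t" "t < 1" "t \<le> e / (1 + s)" using e s0 by (auto simp: t_def min_def)
  have "lasso_loss n lam J y x \<gamma> \<le> lasso_loss n lam J y x (\<lambda>k. \<gamma> k + t * v k)" by (rule min)
  also have "\<dots> = 1 / (2 * real n) * ((\<Sum>i<n. (res i)\<^sup>2) - 2 * t * a + t\<^sup>2 * s) + lam * (\<Sum>k\<in>J. \<bar>\<gamma> k + t * v k\<bar>)"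
    unfolding a_def s_def by (rule lasso_loss_add)
  also have "\<dots> \<le> 1 / (2 * real n) * ((\<Sum>i<n. (res i)\<^sup>2) - 2 * t * a + t\<^sup>2 * s) + lam * ((\<Sum>k\<in>J. \<bar>\<gamma> k\<bar>) + t * c)"
    using lam t by (intro add_left_mono mult_left_mono pen) auto
  finally have "0 \<le> 1 / (2 * real n) * (- 2 * t * a + t\<^sup>2 * s) + lam * (t * c)"
    unfolding lasso_loss_def by (simp add: algebra_simps)
  then have "0 \<le> (2 * real n) * (1 / (2 * real n) * (- 2 * t * a + t\<^sup>2 * s) + lam * (t * c))"
    by (intro mult_nonneg_nonneg) auto
  also have "\<dots> = 2 * t * (- a + t * s / 2 + real n * lam * c)"
    using n by (simp add: field_simps power2_eq_square)
  finally have "a \<le> t * s / 2 + real n * lam * c"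
    using t by (simp add: zero_le_mult_iff)
  moreover have "t * s \<le> e"
  proof -
    have "t * s \<le> e / (1 + s) * s" using t s0 by (intro mult_right_mono) auto
    also have "\<dots> \<le> e" using s0 e by (simp add: field_simps)
    finally show ?thesis .
  qed
  moreover have "0 \<le> t * s" using t s0 by simp
  ultimately show "(\<Sum>i<n. res i * (\<Sum>k\<in>J. x i k * v k)) \<le> real n * lam * c + e"
    by (simp add: a_def)
qed

lemma lasso_KKT:
  assumes k: "k \<in> J"
  shows "\<bar>\<Sum>i<n. x i k * res i\<bar> \<le> real n * lam"
proof -
  have *: "s * (\<Sum>i<n. x i k * res i) \<le> real n * lam" if s: "\<bar>s\<bar> = 1" for s :: real
  proof -
    define v where "v l = (if l = k then s else 0)" for l
    have Xv: "(\<Sum>l\<in>J. x i l * v l) = s * x i k" for i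
      using k J by (simp add: v_def if_distrib[of "\<lambda>z. _ * z"] cong: if_cong)
    have "(\<Sum>i<n. res i * (\<Sum>l\<in>J. x i l * v l)) \<le> real n * lam * 1"
    proof (rule lasso_first_order)
      fix t :: real assume t: "0 < t"
      have "(\<Sum>l\<in>J. \<bar>\<gamma> l + t * v l\<bar>) \<le> (\<Sum>l\<in>J. \<bar>\<gamma> l\<bar> + (if l = k then t else 0))"
        using t s by (intro sum_mono) (auto simp: v_def abs_mult intro!: order_trans[OF abs_triangle_ineq])
      also have "\<dots> = (\<Sum>l\<in>J. \<bar>\<gamma> l\<bar>) + t * 1" using k J by (simp add: sum.distrib)
      finally show "(\<Sum>l\<in>J. \<bar>\<gamma> l + t * v l\<bar>) \<le> (\<Sum>l\<in>J. \<bar>\<gamma> l\<bar>) + t * 1" .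
    qed
    also have "(\<Sum>i<n. res i * (\<Sum>l\<in>J. x i l * v l)) = s * (\<Sum>i<n. x i k * res i)"
      unfolding Xv sum_distrib_left by (intro sum.cong refl) (simp only: mult_ac)
    finally show ?thesis by simp
  qed
  from *[of 1] *[of "-1"] show ?thesis by simp
qed

lemma lasso_response_resid_ge:
  "(\<Sum>i<n. (res i)\<^sup>2) + real n * lam * (\<Sum>k\<in>J. \<bar>\<gamma> k\<bar>) \<le> (\<Sum>i<n. y i * res i)"
proof -
  have "(\<Sum>i<n. res i * (\<Sum>k\<in>J. x i k * - \<gamma> k)) \<le> real n * lam * - (\<Sum>k\<in>J. \<bar>\<gamma> k\<bar>)"
  proof (rule lasso_first_order)
    fix t :: real assume t: "0 < t" "t < 1"
    have eq: "(\<Sum>k\<in>J. \<bar>\<gamma> k + t * - \<gamma> k\<bar>) = (\<Sum>k\<in>J. (1 - t) * \<bar>\<gamma> k\<bar>)"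
    proof (intro sum.cong refl)
      fix k
      have "\<gamma> k + t * - \<gamma> k = (1 - t) * \<gamma> k" by (simp add: algebra_simps)
      then show "\<bar>\<gamma> k + t * - \<gamma> k\<bar> = (1 - t) * \<bar>\<gamma> k\<bar>" using t by (simp add: abs_mult)
    qed
    show "(\<Sum>k\<in>J. \<bar>\<gamma> k + t * - \<gamma> k\<bar>) \<le> (\<Sum>k\<in>J. \<bar>\<gamma> k\<bar>) + t * - (\<Sum>k\<in>J. \<bar>\<gamma> k\<bar>)"
      unfolding eq sum_distrib_left[symmetric] by (simp add: left_diff_distrib)
  qed
  then have "real n * lam * (\<Sum>k\<in>J. \<bar>\<gamma> k\<bar>) \<le> (\<Sum>i<n. res i * (\<Sum>k\<in>J. x i k * \<gamma> k))"
    by (simp add: sum_negf)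
  moreover have "(\<Sum>i<n. y i * res i) = (\<Sum>i<n. (res i)\<^sup>2) + (\<Sum>i<n. res i * (\<Sum>k\<in>J. x i k * \<gamma> k))"
    unfolding sum.distrib[symmetric] by (intro sum.cong refl) (simp add: power2_eq_square algebra_simps)
  ultimately show ?thesis by simp
qed

lemma lasso_RSS_le: "(\<Sum>i<n. (res i)\<^sup>2) \<le> (\<Sum>i<n. (y i)\<^sup>2)"
proof -
  have "1 / (2 * real n) * (\<Sum>i<n. (res i)\<^sup>2) \<le> lasso_loss n lam J y x \<gamma>"
    unfolding lasso_loss_def using lam by (simp add: sum_nonneg)
  also have "\<dots> \<le> lasso_loss n lam J y x (\<lambda>_. 0)" by (rule min)
  finally show ?thesis using n by (simp add: lasso_loss_def divide_le_cancel)
qed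

text \<open>
  Weak duality: a vector \<open>a z\<close> whose inner products with the predictors are at most \<open>n * lam\<close>
  bounds the inner product of response and residual from below.
\<close>
lemma lasso_dual_bound:
  assumes feas: "\<And>k. k \<in> J \<Longrightarrow> \<bar>a * (\<Sum>i<n. x i k * z i)\<bar> \<le> real n * lam"
  shows "a * (\<Sum>i<n. z i * y i) \<le> a\<^sup>2 * (\<Sum>i<n. (z i)\<^sup>2) / 2 + (\<Sum>i<n. y i * res i)"
proof -
  have "a * (\<Sum>i<n. z i * y i) = (\<Sum>i<n. a * (z i * y i))" by (rule sum_distrib_left)
  also have "\<dots> = (\<Sum>i<n. a * z i * res i + a * z i * (\<Sum>k\<in>J. x i k * \<gamma> k))"
    by (intro sum.cong refl) (simp only: right_diff_distrib mult.assoc diff_add_cancel)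
  also have "\<dots> = (\<Sum>i<n. a * z i * res i) + (\<Sum>i<n. a * z i * (\<Sum>k\<in>J. x i k * \<gamma> k))"
    by (rule sum.distrib)
  also have "(\<Sum>i<n. a * z i * res i) \<le> (\<Sum>i<n. a\<^sup>2 * (z i)\<^sup>2 / 2 + (res i)\<^sup>2 / 2)"
  proof (rule sum_mono)
    fix i
    have "a * u * e \<le> a\<^sup>2 * u\<^sup>2 / 2 + e\<^sup>2 / 2" for u e
      using zero_le_power2[of "a * u - e"] by (simp add: power2_eq_square algebra_simps)
    then show "a * z i * res i \<le> a\<^sup>2 * (z i)\<^sup>2 / 2 + (res i)\<^sup>2 / 2" .
  qed
  also have "\<dots> = a\<^sup>2 * (\<Sum>i<n. (z i)\<^sup>2) / 2 + (\<Sum>i<n. (res i)\<^sup>2) / 2"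
    by (simp add: sum.distrib sum_distrib_left sum_divide_distrib)
  also have "(\<Sum>i<n. a * z i * (\<Sum>k\<in>J. x i k * \<gamma> k)) = (\<Sum>i<n. \<Sum>k\<in>J. a * z i * (x i k * \<gamma> k))"
    unfolding sum_distrib_left ..
  also have "\<dots> = (\<Sum>k\<in>J. \<Sum>i<n. a * z i * (x i k * \<gamma> k))" by (rule sum.swap)
  also have "\<dots> = (\<Sum>k\<in>J. (a * (\<Sum>i<n. x i k * z i)) * \<gamma> k)"
    by (simp add: sum_distrib_left sum_distrib_right mult_ac)
  also have "\<dots> \<le> (\<Sum>k\<in>J. real n * lam * \<bar>\<gamma> k\<bar>)"
  proof (rule sum_mono)
    fix k assume "k \<in> J"
    have "(a * (\<Sum>i<n. x i k * z i)) * \<gamma> k \<le> \<bar>a * (\<Sum>i<n. x i k * z i)\<bar> * \<bar>\<gamma> k\<bar>"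
      by (simp flip: abs_mult)
    also have "\<dots> \<le> real n * lam * \<bar>\<gamma> k\<bar>" using feas[OF \<open>k \<in> J\<close>] by (rule mult_right_mono) simp
    finally show "(a * (\<Sum>i<n. x i k * z i)) * \<gamma> k \<le> real n * lam * \<bar>\<gamma> k\<bar>" .
  qed
  also have "\<dots> = real n * lam * (\<Sum>k\<in>J. \<bar>\<gamma> k\<bar>)" by (simp add: sum_distrib_left)
  finally have "a * (\<Sum>i<n. z i * y i) \<le> a\<^sup>2 * (\<Sum>i<n. (z i)\<^sup>2) / 2 + (\<Sum>i<n. (res i)\<^sup>2) / 2
     + real n * lam * (\<Sum>k\<in>J. \<bar>\<gamma> k\<bar>)" by simp
  moreover have "0 \<le> (\<Sum>i<n. (res i)\<^sup>2)" by (intro sum_nonneg) auto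
  ultimately show ?thesis using lasso_response_resid_ge by simp
qed

end

lemma lasso_value_permute:
  assumes "bij_betw \<tau> {..<n} {..<n}"
  shows "lasso_value n lam J (\<lambda>i. y (\<tau> i)) (\<lambda>i. x (\<tau> i)) = lasso_value n lam J y x"
proof -
  have "lasso_loss n lam J (\<lambda>i. y (\<tau> i)) (\<lambda>i. x (\<tau> i)) \<gamma> = lasso_loss n lam J y x \<gamma>" for \<gamma>
    unfolding lasso_loss_def
    by (subst sum.reindex_bij_betw[OF assms, of "\<lambda>i. (y i - (\<Sum>k\<in>J. x i k * \<gamma> k))\<^sup>2"]) simp
  then show ?thesis by (simp add: lasso_value_def)
qed

lemma lasso_resid_permute:
  assumes "bij_betw \<tau> {..<n} {..<n}" "inj \<tau>"
  shows "lasso_resid n lam J (\<lambda>i. y (\<tau> i)) (\<lambda>i. x (\<tau> i)) i = lasso_resid n lam J y x (\<tau> i)"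
proof -
  have upd: "(\<lambda>i. y (\<tau> i))(i := y (\<tau> i) + h) = (\<lambda>l. (y(\<tau> i := y (\<tau> i) + h)) (\<tau> l))" for h
    using assms(2) by (auto simp: fun_eq_iff inj_eq)
  show ?thesis unfolding lasso_resid_def upd lasso_value_permute[OF assms(1)] ..
qed

lemma borel_measurable_lasso_resid:
  assumes lam: "0 \<le> lam" and y: "\<And>i. i < n \<Longrightarrow> (\<lambda>\<omega>. y \<omega> i) \<in> borel_measurable M"
    and x: "\<And>i k. i < n \<Longrightarrow> k \<in> J \<Longrightarrow> (\<lambda>\<omega>. x \<omega> i k) \<in> borel_measurable M" and i: "i < n"
  shows "(\<lambda>\<omega>. lasso_resid n lam J (y \<omega>) (x \<omega>) i) \<in> borel_measurable M"
proof -
  have V: "(\<lambda>\<omega>. lasso_value n lam J (y' \<omega>) (x \<omega>)) \<in> borel_measurable M"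
    if y': "\<And>i. i < n \<Longrightarrow> (\<lambda>\<omega>. y' \<omega> i) \<in> borel_measurable M" for y'
    unfolding lasso_value_def
  proof (rule borel_measurable_cINF)
    fix l :: "rat list"
    show "(\<lambda>\<omega>. lasso_loss n lam J (y' \<omega>) (x \<omega>) (rat_vector l)) \<in> borel_measurable M"
      unfolding lasso_loss_def
      by (intro borel_measurable_add borel_measurable_times borel_measurable_const borel_measurable_sum
          borel_measurable_power borel_measurable_diff) (auto intro: y' x)
  qed (auto intro: bdd_below_lasso_loss lam)
  have upd: "(\<lambda>\<omega>. ((y \<omega>)(i := y \<omega> i + c)) l) \<in> borel_measurable M" if "l < n" for c l
    using that i by (cases "l = i") (auto intro!: borel_measurable_add y)
  show ?thesis unfolding lasso_resid_def
    by (intro borel_measurable_lim_metric borel_measurable_times borel_measurable_diff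
        borel_measurable_const V upd y)
qed

text \<open>
  A block sum is its share of the total sum plus the sum of the deviations of each \<open>g t\<close> from the
  mean of \<open>g 0, \<dots>, g t\<close>, with weights \<open>a / t\<close> in \<open>[0, 1]\<close>.  If the \<open>g t\<close> are exchangeable, these
  deviations are centred given everything that is symmetric in the first \<open>Suc t\<close> terms.  For
  \<open>a = 0\<close> all weights vanish, including \<open>0 / 0 = 0\<close> at \<open>t = 0\<close>.
\<close>

lemma batch_sum_decomposition:
  fixes g :: "nat \<Rightarrow> real"
  assumes "a \<le> b"
  shows "(\<Sum>t\<in>{a..<b}. g t) = real (b - a) / real b * (\<Sum>t<b. g t)
     + (\<Sum>t\<in>{a..<b}. real a / real t * (g t - (\<Sum>l\<le>t. g l) / real (Suc t)))"
proof -
  define S where "S m = (\<Sum>t<m. g t)" for m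
  have SS: "(\<Sum>l\<le>t. g l) = S (Suc t)" for t by (simp add: S_def lessThan_Suc_atMost)
  have *: "(\<Sum>t\<in>{a..<b}. real a / real t * (g t - S (Suc t) / real (Suc t))) = real a / real b * S b - S a"
    using assms
  proof (induction b rule: dec_induct)
    case base
    then show ?case by (cases "a = 0") (auto simp: S_def)
  next
    case (step b)
    show ?case
    proof (cases "a = 0")
      case True
      then show ?thesis by (simp add: S_def)
    next
      case False
      then have b: "0 < b" using step by simp
      have "(\<Sum>t\<in>{a..<Suc b}. real a / real t * (g t - S (Suc t) / real (Suc t)))
        = real a / real b * S b - S a + real a / real b * (g b - S (Suc b) / real (Suc b))"
        using step by simp
      also have "S b = S (Suc b) - g b" by (simp add: S_def)
      also have "real a / real b * (S (Suc b) - g b) - S a + real a / real b * (g b - S (Suc b) / real (Suc b))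
         = real a * S (Suc b) * (1 / real b * (1 - 1 / real (Suc b))) - S a"
        by (simp add: algebra_simps)
      also have "1 / real b * (1 - 1 / real (Suc b)) = 1 / real (Suc b)" using b by (simp add: field_simps)
      finally show ?thesis by simp
    qed
  qed
  have "(\<Sum>t\<in>{a..<b}. g t) = S b - S a"
    using sum.atLeastLessThan_concat[of 0 a b g] assms by (simp add: S_def lessThan_atLeast0)
  also have "\<dots> = real (b - a) / real b * S b + (real a / real b * S b - S a)"
    using assms by (cases "b = 0") (auto simp: S_def of_nat_diff field_simps)
  finally show ?thesis unfolding SS *[symmetric] by (simp add: S_def)
qed

section \<open>The regression stream and exchangeability of its rows\<close>

lemma sum_batches:
  "(\<Sum>j = 1..b. \<Sum>t\<in>batch_rows m j. f t) = (\<Sum>t<cum_size m b. f t :: real)"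
proof (induction b)
  case 0
  then show ?case by (simp add: cum_size_def)
next
  case (Suc b)
  have "cum_size m b \<le> cum_size m (Suc b)" by (simp add: cum_size_def)
  then have "(\<Sum>t<cum_size m b. f t) + (\<Sum>t\<in>batch_rows m (Suc b). f t) = (\<Sum>t<cum_size m (Suc b). f t)"
    unfolding batch_rows_def using sum.atLeastLessThan_concat[of 0 "cum_size m b" "cum_size m (Suc b)" f]
    by (simp add: lessThan_atLeast0)
  then show ?case using Suc by simp
qed

lemma cum_size_mono: "i \<le> j \<Longrightarrow> cum_size m i \<le> cum_size m j"
  unfolding cum_size_def by (intro sum_mono2) auto

lemma cum_size_Suc: "cum_size m (Suc j) = cum_size m j + batch_size m (Suc j)"
  by (simp add: cum_size_def)

lemma cum_size_0: "cum_size m 0 = 0"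
  by (simp add: cum_size_def)

text \<open>
  One model of the sequence, with almost surely bounded covariates.
\<close>
locale regression_stream = prob_space "law m"
  for m :: "'w stream_data" +
  fixes \<sigma> K :: real
  assumes model: "linear_stream_model \<sigma> m" and K_pos: "0 < K"
    and bounded: "\<And>i k. i < total_size m \<Longrightarrow> k < covariates m \<Longrightarrow> AE \<omega> in law m. \<bar>design m i k \<omega>\<bar> \<le> K"
begin

abbreviation "M \<equiv> law m"
abbreviation "N \<equiv> total_size m"
abbreviation "p \<equiv> covariates m"
abbreviation "Row \<equiv> PiM {..<p} (\<lambda>_. borel :: real measure)"
text \<open>
  The \<open>i\<close>-th row of the design and the stacked design, as random elements of product spaces.
\<close>

definition "xrow i \<omega> = (\<lambda>k\<in>{..<p}. design m i k \<omega>)"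
definition "xrows \<omega> = (\<lambda>i\<in>{..<N}. xrow i \<omega>)"

lemma batches: "2 \<le> batches m" "j \<in> {1..batches m} \<Longrightarrow> 1 \<le> batch_size m j"
  using model unfolding linear_stream_model_def Let_def by blast+

lemma indep_rows: "indep_vars (\<lambda>_. Row) xrow {..<N}"
  using model unfolding linear_stream_model_def Let_def xrow_def[abs_def] by blast

lemma distr_row: "i < N \<Longrightarrow> distr M Row (xrow i) = distr M Row (xrow 0)"
  using model unfolding linear_stream_model_def Let_def xrow_def[abs_def] by blast

lemma indep_noise: "indep_vars (\<lambda>_. borel) (noise m) {..<N}"
  using model unfolding linear_stream_model_def Let_def by blast

lemma noise_moments:
  assumes "i < N"
  shows "integrable M (\<lambda>\<omega>. (noise m i \<omega>)\<^sup>2)" "expectation (noise m i) = 0"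
    "expectation (\<lambda>\<omega>. (noise m i \<omega>)\<^sup>2) = \<sigma>\<^sup>2"
proof -
  have *: "integrable M (\<lambda>\<omega>. (noise m i \<omega>)\<^sup>2) \<and> expectation (noise m i) = 0 \<and> variance (noise m i) = \<sigma>\<^sup>2"
    using model assms unfolding linear_stream_model_def Let_def by blast
  then show "integrable M (\<lambda>\<omega>. (noise m i \<omega>)\<^sup>2)" "expectation (noise m i) = 0" by auto
  with * show "expectation (\<lambda>\<omega>. (noise m i \<omega>)\<^sup>2) = \<sigma>\<^sup>2" by simp
qed

lemma distr_rows_noise:
  "distr M (PiM {..<N} (\<lambda>_. Row) \<Otimes>\<^sub>M PiM {..<N} (\<lambda>_. borel)) (\<lambda>\<omega>. (xrows \<omega>, \<lambda>i\<in>{..<N}. noise m i \<omega>))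
   = distr M (PiM {..<N} (\<lambda>_. Row)) xrows
       \<Otimes>\<^sub>M distr M (PiM {..<N} (\<lambda>_. borel)) (\<lambda>\<omega>. \<lambda>i\<in>{..<N}. noise m i \<omega>)"
  using model unfolding linear_stream_model_def Let_def xrow_def[abs_def] xrows_def[abs_def]
  by (elim conjE)

lemma measurable_xrow: "i < N \<Longrightarrow> xrow i \<in> measurable M Row"
  using indep_rows by (auto simp: indep_vars_def2)

lemma measurable_noise [measurable]: "i < N \<Longrightarrow> noise m i \<in> borel_measurable M"
  using indep_noise by (auto simp: indep_vars_def2)

lemma measurable_xrows [measurable]: "xrows \<in> measurable M (PiM {..<N} (\<lambda>_. Row))"
  unfolding xrows_def by (intro measurable_restrict measurable_xrow) auto

lemma measurable_entry:
  assumes "i < N" "k < p"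
  shows "(\<lambda>\<rho>. \<rho> i k) \<in> borel_measurable (PiM {..<N} (\<lambda>_. Row))"
proof -
  have 1: "(\<lambda>\<rho>. \<rho> i) \<in> measurable (PiM {..<N} (\<lambda>_. Row)) Row"
    by (rule measurable_component_singleton) (use assms in simp)
  have 2: "(\<lambda>v. v k) \<in> borel_measurable Row"
    by (rule measurable_component_singleton) (use assms in simp)
  show ?thesis using measurable_compose[OF 1 2] .
qed

lemma xrows_entry: "i < N \<Longrightarrow> k < p \<Longrightarrow> xrows \<omega> i k = design m i k \<omega>"
  by (simp add: xrows_def xrow_def)

lemma measurable_design [measurable]:
  assumes "i < N" "k < p" shows "design m i k \<in> borel_measurable M"
proof -
  have "(\<lambda>\<omega>. xrows \<omega> i k) \<in> borel_measurable M"
    by (rule measurable_compose[OF measurable_xrows measurable_entry[OF assms]])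
  then show ?thesis using assms by (simp add: xrows_entry)
qed

lemma AE_bounded: "AE \<omega> in M. \<forall>i<N. \<forall>k<p. \<bar>design m i k \<omega>\<bar> \<le> K"
proof -
  have "AE \<omega> in M. \<forall>i\<in>{..<N}. \<forall>k\<in>{..<p}. \<bar>design m i k \<omega>\<bar> \<le> K"
    using bounded by (intro AE_finite_allI) auto
  then show ?thesis by eventually_elim simp
qed

lemma N_ge_2: "2 \<le> N"
proof -
  have "(\<Sum>j\<in>{1..batches m}. 1) \<le> N"
    unfolding total_size_def cum_size_def using batches(2) by (intro sum_mono) auto
  then show ?thesis using batches(1) by simp
qed

lemma cum_size_pos: "j \<in> {1..batches m} \<Longrightarrow> 0 < cum_size m j"
proof -
  assume j: "j \<in> {1..batches m}"
  have "1 \<le> batch_size m 1" using batches by auto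
  also have "batch_size m 1 = cum_size m 1" by (simp add: cum_size_def)
  also have "\<dots> \<le> cum_size m j" using j by (intro cum_size_mono) auto
  finally show ?thesis by simp
qed

lemma cum_size_le_N: "j \<le> batches m \<Longrightarrow> cum_size m j \<le> N"
  unfolding total_size_def by (rule cum_size_mono)

lemma distr_rows: "distr M (PiM {..<N} (\<lambda>_. Row)) xrows = PiM {..<N} (\<lambda>_. distr M Row (xrow 0))"
proof -
  have ne: "{..<N} \<noteq> {}" using N_ge_2 by (simp add: lessThan_empty_iff)
  have "indep_vars (\<lambda>_. Row) xrow {..<N} \<longleftrightarrow> distr M (PiM {..<N} (\<lambda>_. Row)) (\<lambda>\<omega>. \<lambda>i\<in>{..<N}. xrow i \<omega>)
      = PiM {..<N} (\<lambda>i. distr M Row (xrow i))"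
    by (rule indep_vars_iff_distr_eq_PiM'[OF ne]) (rule measurable_xrow, simp)
  then have "distr M (PiM {..<N} (\<lambda>_. Row)) (\<lambda>\<omega>. \<lambda>i\<in>{..<N}. xrow i \<omega>) = PiM {..<N} (\<lambda>i. distr M Row (xrow i))"
    using indep_rows by blast
  also have "\<dots> = PiM {..<N} (\<lambda>_. distr M Row (xrow 0))"
    by (intro PiM_cong refl distr_row) simp
  finally show ?thesis by (simp add: xrows_def[abs_def])
qed

lemma exchange_rows:
  fixes \<phi> :: "(nat \<Rightarrow> nat \<Rightarrow> real) \<Rightarrow> real"
  assumes \<phi>: "\<phi> \<in> borel_measurable (PiM {..<N} (\<lambda>_. Row))" and ab: "a < N" "b < N"
  shows "expectation (\<lambda>\<omega>. \<phi> (\<lambda>i. xrows \<omega> (Transposition.transpose a b i))) = expectation (\<lambda>\<omega>. \<phi> (xrows \<omega>))"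
proof -
  let ?\<tau> = "Transposition.transpose a b"
  let ?D = "distr M Row (xrow 0)"
  let ?P = "PiM {..<N} (\<lambda>_. ?D)"
  interpret D: prob_space ?D using N_ge_2 by (intro prob_space_distr measurable_xrow) auto
  have \<tau>: "?\<tau> i < N" if "i < N" for i using that ab by (simp add: Transposition.transpose_def)
  have swap: "distr ?P ?P (\<lambda>\<rho>. \<lambda>i\<in>{..<N}. \<rho> (?\<tau> i)) = ?P"
  proof (rule distr_PiM_reindex)
    show "inj_on ?\<tau> {..<N}" by (intro inj_onI) (rule Transposition.transpose_eq_imp_eq)
  qed (use \<tau> D.prob_space_axioms in auto)
  have sets: "sets ?P = sets (PiM {..<N} (\<lambda>_. Row))" by (intro sets_PiM_cong) auto
  have \<phi>P: "\<phi> \<in> borel_measurable ?P" using \<phi> by (simp add: measurable_cong_sets[OF sets refl])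
  have sm: "(\<lambda>\<rho>. \<lambda>i\<in>{..<N}. \<rho> (?\<tau> i)) \<in> measurable ?P ?P"
    using \<tau> by (intro measurable_restrict measurable_component_singleton) auto
  have ext: "(\<lambda>i. xrows \<omega> (?\<tau> i)) = (\<lambda>i\<in>{..<N}. xrows \<omega> (?\<tau> i))" for \<omega>
  proof
    fix i
    show "xrows \<omega> (?\<tau> i) = (\<lambda>i\<in>{..<N}. xrows \<omega> (?\<tau> i)) i"
      using ab by (cases "i < N") (auto simp: xrows_def Transposition.transpose_def)
  qed
  have sm': "(\<lambda>\<rho>. \<lambda>i\<in>{..<N}. \<rho> (?\<tau> i)) \<in> measurable (PiM {..<N} (\<lambda>_. Row)) (PiM {..<N} (\<lambda>_. Row))"
    using \<tau> by (intro measurable_restrict measurable_component_singleton) auto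
  have "expectation (\<lambda>\<omega>. \<phi> (\<lambda>i. xrows \<omega> (?\<tau> i))) = expectation (\<lambda>\<omega>. \<phi> (\<lambda>i\<in>{..<N}. xrows \<omega> (?\<tau> i)))"
    by (rule Bochner_Integration.integral_cong[OF refl]) (rule arg_cong[OF ext])
  also have "\<dots> = integral\<^sup>L (distr M (PiM {..<N} (\<lambda>_. Row)) xrows) (\<lambda>\<rho>. \<phi> (\<lambda>i\<in>{..<N}. \<rho> (?\<tau> i)))"
    by (rule integral_distr[OF measurable_xrows measurable_compose[OF sm' \<phi>], symmetric])
  also have "\<dots> = integral\<^sup>L (distr ?P ?P (\<lambda>\<rho>. \<lambda>i\<in>{..<N}. \<rho> (?\<tau> i))) \<phi>"
    unfolding distr_rows by (simp add: integral_distr[OF sm \<phi>P])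
  also have "\<dots> = integral\<^sup>L (distr M (PiM {..<N} (\<lambda>_. Row)) xrows) \<phi>"
    unfolding swap distr_rows ..
  also have "\<dots> = expectation (\<lambda>\<omega>. \<phi> (xrows \<omega>))"
    by (rule integral_distr[OF measurable_xrows \<phi>])
  finally show ?thesis .
qed

text \<open>
  The batch that contains row \<open>t\<close>.
\<close>
definition "batch_of t = (LEAST j. t < cum_size m j)"

lemma batch_of_eq:
  assumes "t \<in> batch_rows m j" "1 \<le> j"
  shows "batch_of t = j"
  unfolding batch_of_def
proof (rule Least_equality)
  show "t < cum_size m j" using assms by (simp add: batch_rows_def)
  fix i assume i: "t < cum_size m i"
  show "j \<le> i"
  proof (rule ccontr)
    assume "\<not> j \<le> i"
    then have "cum_size m i \<le> cum_size m (j - 1)" by (intro cum_size_mono) auto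
    with i assms show False by (simp add: batch_rows_def)
  qed
qed

lemma batch_of_bounds:
  assumes "t < N"
  shows "batch_of t \<in> {1..batches m}" "t < cum_size m (batch_of t)" "cum_size m (batch_of t - 1) \<le> t"
proof -
  show *: "t < cum_size m (batch_of t)"
    unfolding batch_of_def by (rule LeastI[of _ "batches m"]) (use assms in \<open>simp add: total_size_def\<close>)
  have "batch_of t \<noteq> 0"
  proof
    assume "batch_of t = 0"
    with * show False by (simp add: cum_size_0)
  qed
  moreover have "batch_of t \<le> batches m"
    unfolding batch_of_def by (rule Least_le) (use assms in \<open>simp add: total_size_def\<close>)
  ultimately show "batch_of t \<in> {1..batches m}" by auto
  show "cum_size m (batch_of t - 1) \<le> t"
  proof (rule ccontr)
    assume "\<not> cum_size m (batch_of t - 1) \<le> t"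
    then have "batch_of t \<le> batch_of t - 1" unfolding batch_of_def by (intro Least_le) simp
    with \<open>batch_of t \<noteq> 0\<close> show False by simp
  qed
qed

lemma sum_batches_flat:
  "(\<Sum>j = 1..batches m. \<Sum>t\<in>batch_rows m j. f j t) = (\<Sum>t<N. f (batch_of t) t :: real)"
proof -
  have "(\<Sum>j = 1..batches m. \<Sum>t\<in>batch_rows m j. f j t)
    = (\<Sum>j = 1..batches m. \<Sum>t\<in>batch_rows m j. f (batch_of t) t)"
    by (intro sum.cong refl) (simp add: batch_of_eq)
  then show ?thesis by (simp only: sum_batches total_size_def)
qed

end

section \<open>Nodewise residuals and the reverse martingale\<close>

text \<open>
  In addition, a fixed covariate \<open>r\<close> with the nodewise lasso estimators of all batches.
\<close>
locale node_stream = regression_stream m \<sigma> K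
  for m :: "'w stream_data" and \<sigma> K +
  fixes r :: nat and lam :: "nat \<Rightarrow> real" and gh :: "nat \<Rightarrow> 'w \<Rightarrow> nat \<Rightarrow> real"
  assumes r: "r < covariates m" and lam_nonneg: "\<And>j. j \<in> {1..batches m} \<Longrightarrow> 0 \<le> lam j"
    and node_lasso: "is_node_lasso m r lam gh"
begin

abbreviation "others \<equiv> {..<covariates m} - {r}"

text \<open>
  The residuals of the nodewise lasso fitted to the first \<open>cum_size m j\<close> rows, as a function of
  the stacked design \<open>\<rho>\<close>.
\<close>
definition "nres j \<rho> i = lasso_resid (cum_size m j) (lam j) others (\<lambda>i. \<rho> i r) \<rho> i"

lemma node_obj_eq_lasso_loss:
  assumes j: "j \<in> {1..batches m}"
  shows "node_obj m r j (lam j) \<omega> \<gamma> = lasso_loss (cum_size m j) (lam j) others (\<lambda>i. xrows \<omega> i r) (xrows \<omega>) \<gamma>"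
proof -
  have "i < N" if "i < cum_size m j" for i using that cum_size_le_N[of j] j by auto
  then have "(\<Sum>t<cum_size m j. (node_resid m r \<gamma> t \<omega>)\<^sup>2)
    = (\<Sum>t<cum_size m j. (xrows \<omega> t r - (\<Sum>k\<in>others. xrows \<omega> t k * \<gamma> k))\<^sup>2)"
    using r by (intro sum.cong refl) (simp add: node_resid_def lin_pred_without_def xrows_entry)
  then show ?thesis unfolding node_obj_def lasso_loss_def sum_batches by simp
qed

lemma node_minimizer:
  assumes "j \<in> {1..batches m}" "\<omega> \<in> space M"
  shows "lasso_loss (cum_size m j) (lam j) others (\<lambda>i. xrows \<omega> i r) (xrows \<omega>) (gh j \<omega>)
    \<le> lasso_loss (cum_size m j) (lam j) others (\<lambda>i. xrows \<omega> i r) (xrows \<omega>) \<gamma>"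
proof -
  have "is_arg_min (node_obj m r j (lam j) \<omega>) (\<lambda>_. True) (gh j \<omega>)"
    using node_lasso assms by (simp add: is_node_lasso_def)
  then have "node_obj m r j (lam j) \<omega> (gh j \<omega>) \<le> node_obj m r j (lam j) \<omega> \<gamma>"
    by (simp add: is_arg_min_linorder)
  then show ?thesis unfolding node_obj_eq_lasso_loss[OF assms(1)] .
qed

lemma nres_eq:
  assumes j: "j \<in> {1..batches m}" and \<omega>: "\<omega> \<in> space M" and i: "i < cum_size m j"
  shows "nres j (xrows \<omega>) i = xrows \<omega> i r - (\<Sum>k\<in>others. xrows \<omega> i k * gh j \<omega> k)"
  unfolding nres_def
  by (rule lasso_resid_eq[OF cum_size_pos[OF j] lam_nonneg[OF j] _ node_minimizer[OF j \<omega>] i]) simp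

lemma nres_eq_node_resid:
  assumes j: "j \<in> {1..batches m}" and \<omega>: "\<omega> \<in> space M" and i: "i < cum_size m j"
  shows "nres j (xrows \<omega>) i = node_resid m r (gh j \<omega>) i \<omega>"
proof -
  have "i < N" using i cum_size_le_N[of j] j by auto
  then show ?thesis unfolding nres_eq[OF assms] node_resid_def lin_pred_without_def
    using r by (simp add: xrows_entry)
qed

lemma nres_KKT:
  assumes j: "j \<in> {1..batches m}" and \<omega>: "\<omega> \<in> space M" and k: "k \<in> others"
  shows "\<bar>\<Sum>i<cum_size m j. xrows \<omega> i k * nres j (xrows \<omega>) i\<bar> \<le> cum_size m j * lam j"
proof -
  have "(\<Sum>i<cum_size m j. xrows \<omega> i k * nres j (xrows \<omega>) i)
    = (\<Sum>i<cum_size m j. xrows \<omega> i k * (xrows \<omega> i r - (\<Sum>k\<in>others. xrows \<omega> i k * gh j \<omega> k)))"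
    using nres_eq[OF j \<omega>] by (intro sum.cong refl) simp
  then show ?thesis
    using lasso_KKT[OF cum_size_pos[OF j] lam_nonneg[OF j] _ node_minimizer[OF j \<omega>] k] by simp
qed

lemma nres_RSS:
  assumes j: "j \<in> {1..batches m}" and \<omega>: "\<omega> \<in> space M"
  shows "(\<Sum>i<cum_size m j. (nres j (xrows \<omega>) i)\<^sup>2) \<le> (\<Sum>i<cum_size m j. (xrows \<omega> i r)\<^sup>2)"
proof -
  have "(\<Sum>i<cum_size m j. (nres j (xrows \<omega>) i)\<^sup>2)
    = (\<Sum>i<cum_size m j. (xrows \<omega> i r - (\<Sum>k\<in>others. xrows \<omega> i k * gh j \<omega> k))\<^sup>2)"
    using nres_eq[OF j \<omega>] by (intro sum.cong refl) simp
  then show ?thesis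
    using lasso_RSS_le[OF cum_size_pos[OF j] lam_nonneg[OF j] _ node_minimizer[OF j \<omega>]] by simp
qed

lemma nres_dual:
  assumes j: "j \<in> {1..batches m}" and \<omega>: "\<omega> \<in> space M"
    and feas: "\<And>k. k \<in> others \<Longrightarrow> \<bar>a * (\<Sum>i<cum_size m j. xrows \<omega> i k * z i)\<bar> \<le> cum_size m j * lam j"
  shows "a * (\<Sum>i<cum_size m j. z i * xrows \<omega> i r)
    \<le> a\<^sup>2 * (\<Sum>i<cum_size m j. (z i)\<^sup>2) / 2 + (\<Sum>i<cum_size m j. xrows \<omega> i r * nres j (xrows \<omega>) i)"
proof -
  have "(\<Sum>i<cum_size m j. xrows \<omega> i r * nres j (xrows \<omega>) i)
    = (\<Sum>i<cum_size m j. xrows \<omega> i r * (xrows \<omega> i r - (\<Sum>k\<in>others. xrows \<omega> i k * gh j \<omega> k)))"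
    using nres_eq[OF j \<omega>] by (intro sum.cong refl) simp
  then show ?thesis
    using lasso_dual_bound[OF cum_size_pos[OF j] lam_nonneg[OF j] _ node_minimizer[OF j \<omega>] feas] by simp
qed

lemma measurable_nres:
  assumes j: "j \<in> {1..batches m}" and i: "i < cum_size m j"
  shows "(\<lambda>\<rho>. nres j \<rho> i) \<in> borel_measurable (PiM {..<N} (\<lambda>_. Row))"
proof -
  have "l < N" if "l < cum_size m j" for l using that cum_size_le_N[of j] j by auto
  then show ?thesis
    unfolding nres_def using r i
    by (intro borel_measurable_lasso_resid lam_nonneg[OF j] measurable_entry) auto
qed

lemma nres_transpose:
  assumes j: "j \<in> {1..batches m}" and "a < cum_size m j" "b < cum_size m j"
  shows "nres j (\<lambda>i. \<rho> (Transposition.transpose a b i)) i = nres j \<rho> (Transposition.transpose a b i)"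
proof -
  have "bij_betw (Transposition.transpose a b) {..<cum_size m j} {..<cum_size m j}"
    using assms(2,3) by (intro bij_betw_byWitness[of _ "Transposition.transpose a b"])
      (auto simp: Transposition.transpose_def)
  moreover have "inj (Transposition.transpose a b)"
    by (intro injI) (rule Transposition.transpose_eq_imp_eq)
  ultimately show ?thesis unfolding nres_def by (rule lasso_resid_permute)
qed

lemma sum_xr_sq_le:
  "AE \<omega> in M. \<forall>n\<le>N. (\<Sum>i<n. (xrows \<omega> i r)\<^sup>2) \<le> n * K\<^sup>2"
  using AE_bounded
proof eventually_elim
  case (elim \<omega>)
  show ?case
  proof (intro allI impI)
    fix n assume n: "n \<le> N"
    have "(\<Sum>i<n. (xrows \<omega> i r)\<^sup>2) \<le> (\<Sum>i<n. K\<^sup>2)"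
    proof (rule sum_mono)
      fix i assume "i \<in> {..<n}"
      then have "\<bar>xrows \<omega> i r\<bar> \<le> \<bar>K\<bar>" using elim n r K_pos by (simp add: xrows_entry)
      then show "(xrows \<omega> i r)\<^sup>2 \<le> K\<^sup>2" by (rule abs_le_square_iff[THEN iffD1])
    qed
    then show "(\<Sum>i<n. (xrows \<omega> i r)\<^sup>2) \<le> n * K\<^sup>2" by simp
  qed
qed

text \<open>
  By exchangeability all residuals of one fit have the same second moment, and the residual sum
  of squares is at most that of the zero coefficient vector.
\<close>
lemma nres_square:
  assumes j: "j \<in> {1..batches m}" and i: "i < cum_size m j"
  shows "integrable M (\<lambda>\<omega>. (nres j (xrows \<omega>) i)\<^sup>2)"
    and "expectation (\<lambda>\<omega>. (nres j (xrows \<omega>) i)\<^sup>2) \<le> K\<^sup>2"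
proof -
  let ?n = "cum_size m j"
  have n: "0 < ?n" "?n \<le> N" using cum_size_pos[OF j] cum_size_le_N[of j] j by auto
  have meas: "(\<lambda>\<omega>. nres j (xrows \<omega>) l) \<in> borel_measurable M" if "l < ?n" for l
    by (rule measurable_compose[OF measurable_xrows measurable_nres[OF j that]])
  have int: "integrable M (\<lambda>\<omega>. (nres j (xrows \<omega>) l)\<^sup>2)" if l: "l < ?n" for l
  proof (rule integrable_const_bound[where B = "?n * K\<^sup>2"])
    show "(\<lambda>\<omega>. (nres j (xrows \<omega>) l)\<^sup>2) \<in> borel_measurable M"
      by (intro borel_measurable_power meas l)
    show "AE \<omega> in M. norm ((nres j (xrows \<omega>) l)\<^sup>2) \<le> ?n * K\<^sup>2"
      using sum_xr_sq_le AE_space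
    proof eventually_elim
      case (elim \<omega>)
      have "(nres j (xrows \<omega>) l)\<^sup>2 \<le> (\<Sum>i<?n. (nres j (xrows \<omega>) i)\<^sup>2)"
        using l by (intro member_le_sum) auto
      also have "\<dots> \<le> (\<Sum>i<?n. (xrows \<omega> i r)\<^sup>2)" using nres_RSS[OF j] elim by simp
      also have "\<dots> \<le> ?n * K\<^sup>2" using elim n by simp
      finally show ?case by simp
    qed
  qed
  show "integrable M (\<lambda>\<omega>. (nres j (xrows \<omega>) i)\<^sup>2)" by (rule int[OF i])
  define a where "a = expectation (\<lambda>\<omega>. (nres j (xrows \<omega>) i)\<^sup>2)"
  have eq: "expectation (\<lambda>\<omega>. (nres j (xrows \<omega>) l)\<^sup>2) = a" if l: "l < ?n" for l
  proof -
    have "expectation (\<lambda>\<omega>. (nres j (\<lambda>t. xrows \<omega> (Transposition.transpose l i t)) i)\<^sup>2) = a"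
      unfolding a_def
      by (rule exchange_rows) (use measurable_nres[OF j i] l i n in auto)
    then show ?thesis by (simp add: nres_transpose[OF j l i])
  qed
  have "?n * a = (\<Sum>l<?n. expectation (\<lambda>\<omega>. (nres j (xrows \<omega>) l)\<^sup>2))" using eq by simp
  also have "\<dots> = expectation (\<lambda>\<omega>. \<Sum>l<?n. (nres j (xrows \<omega>) l)\<^sup>2)"
    using int by (subst Bochner_Integration.integral_sum) auto
  also have "\<dots> \<le> expectation (\<lambda>\<omega>. ?n * K\<^sup>2)"
  proof (rule integral_mono_AE)
    show "integrable M (\<lambda>\<omega>. \<Sum>l<?n. (nres j (xrows \<omega>) l)\<^sup>2)"
      using int by (intro Bochner_Integration.integrable_sum) auto
    show "AE \<omega> in M. (\<Sum>l<?n. (nres j (xrows \<omega>) l)\<^sup>2) \<le> ?n * K\<^sup>2"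
      using sum_xr_sq_le AE_space
    proof eventually_elim
      case (elim \<omega>)
      then show ?case using nres_RSS[OF j, of \<omega>] n by (meson order_trans)
    qed
  qed simp
  also have "\<dots> = ?n * K\<^sup>2" by (simp add: prob_space)
  finally show "expectation (\<lambda>\<omega>. (nres j (xrows \<omega>) i)\<^sup>2) \<le> K\<^sup>2" using n by (simp add: a_def)
qed

text \<open>
  The contribution of row \<open>l\<close> to the inner product of column \<open>k\<close> with the residuals of the fit
  that is used for row \<open>t\<close>, and the innovation of row \<open>t\<close>: the weighted deviation of its own
  contribution from the mean over the rows up to \<open>t\<close>.
\<close>
definition "score \<rho> t k l = \<rho> l k * nres (batch_of t) \<rho> l"

definition "innov \<rho> t k = real (cum_size m (batch_of t - 1)) / real t
   * (score \<rho> t k t - (\<Sum>l\<le>t. score \<rho> t k l) / real (Suc t))"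

lemma batch_sum_score:
  assumes j: "j \<in> {1..batches m}"
  shows "(\<Sum>t\<in>batch_rows m j. \<rho> t k * nres j \<rho> t)
    = real (batch_size m j) / real (cum_size m j) * (\<Sum>t<cum_size m j. \<rho> t k * nres j \<rho> t)
      + (\<Sum>t\<in>batch_rows m j. innov \<rho> t k)"
proof -
  have le: "cum_size m (j - 1) \<le> cum_size m j" by (rule cum_size_mono) simp
  have bs: "cum_size m j - cum_size m (j - 1) = batch_size m j"
    using cum_size_Suc[of m "j - 1"] j by simp
  have "(\<Sum>t\<in>batch_rows m j. innov \<rho> t k) = (\<Sum>t\<in>{cum_size m (j - 1)..<cum_size m j}. real (cum_size m (j - 1)) / real t
      * (\<rho> t k * nres j \<rho> t - (\<Sum>l\<le>t. \<rho> l k * nres j \<rho> l) / real (Suc t)))"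
    unfolding batch_rows_def
  proof (rule sum.cong[OF refl])
    fix t assume "t \<in> {cum_size m (j - 1)..<cum_size m j}"
    then have "batch_of t = j" using j by (intro batch_of_eq) (auto simp: batch_rows_def)
    then show "innov \<rho> t k = real (cum_size m (j - 1)) / real t
      * (\<rho> t k * nres j \<rho> t - (\<Sum>l\<le>t. \<rho> l k * nres j \<rho> l) / real (Suc t))"
      by (simp add: innov_def score_def)
  qed
  then show ?thesis
    unfolding batch_rows_def using batch_sum_decomposition[OF le, of "\<lambda>t. \<rho> t k * nres j \<rho> t"]
    unfolding bs by simp
qed

lemma total_score:
  "(\<Sum>j = 1..batches m. \<Sum>t\<in>batch_rows m j. \<rho> t k * nres j \<rho> t)
    = (\<Sum>j = 1..batches m. real (batch_size m j) / real (cum_size m j) * (\<Sum>t<cum_size m j. \<rho> t k * nres j \<rho> t))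
      + (\<Sum>t<N. innov \<rho> t k)"
proof -
  have "(\<Sum>j = 1..batches m. \<Sum>t\<in>batch_rows m j. \<rho> t k * nres j \<rho> t)
    = (\<Sum>j = 1..batches m. real (batch_size m j) / real (cum_size m j) * (\<Sum>t<cum_size m j. \<rho> t k * nres j \<rho> t)
       + (\<Sum>t\<in>batch_rows m j. innov \<rho> t k))"
    by (intro sum.cong refl batch_sum_score) simp
  also have "\<dots> = (\<Sum>j = 1..batches m. real (batch_size m j) / real (cum_size m j) * (\<Sum>t<cum_size m j. \<rho> t k * nres j \<rho> t))
      + (\<Sum>j = 1..batches m. \<Sum>t\<in>batch_rows m j. innov \<rho> t k)"
    by (rule sum.distrib)
  finally show ?thesis unfolding sum_batches_flat[of "\<lambda>j t. innov \<rho> t k"] .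
qed

lemma measurable_score:
  assumes "t < N" "l \<le> t" "k < p"
  shows "(\<lambda>\<rho>. score \<rho> t k l) \<in> borel_measurable (PiM {..<N} (\<lambda>_. Row))"
  unfolding score_def using assms batch_of_bounds[of t]
  by (intro borel_measurable_times measurable_entry measurable_nres) auto

lemma measurable_innov:
  assumes "t < N" "k < p"
  shows "(\<lambda>\<rho>. innov \<rho> t k) \<in> borel_measurable (PiM {..<N} (\<lambda>_. Row))"
  unfolding innov_def using assms
  by (intro borel_measurable_times borel_measurable_const borel_measurable_diff borel_measurable_divide
      borel_measurable_sum measurable_score) auto

lemma score_transpose:
  assumes "t < N" "a \<le> t" "b \<le> t"
  shows "score (\<lambda>i. \<rho> (Transposition.transpose a b i)) t k l = score \<rho> t k (Transposition.transpose a b l)"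
  unfolding score_def using batch_of_bounds[OF assms(1)] assms
  by (subst nres_transpose) auto

text \<open>
  An innovation is symmetric in the earlier rows, so the sequence of innovations is a martingale
  difference sequence when it is read from the last row to the first.
\<close>
lemma innov_transpose:
  assumes t: "t < N" and ab: "a < t" "b < t"
  shows "innov (\<lambda>i. \<rho> (Transposition.transpose a b i)) t k = innov \<rho> t k"
proof -
  let ?\<tau> = "Transposition.transpose a b"
  have "bij_betw ?\<tau> {..t} {..t}"
    using ab by (intro bij_betw_byWitness[of _ ?\<tau>]) (auto simp: Transposition.transpose_def)
  then have "(\<Sum>l\<le>t. score \<rho> t k (?\<tau> l)) = (\<Sum>l\<le>t. score \<rho> t k l)"
    by (rule sum.reindex_bij_betw)
  moreover have "?\<tau> t = t" using ab by (simp add: Transposition.transpose_def)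
  ultimately show ?thesis
    unfolding innov_def using score_transpose[OF t, of a b] ab by simp
qed

lemma innov_max:
  assumes I: "finite I" "I \<noteq> {}" "I \<subseteq> {..<p}"
  shows "\<exists>G. integrable M G \<and> expectation G \<le> (1 + 2 * (4 * K ^ 4)) * sqrt (real N * ln (2 * real (card I)))
     \<and> (AE \<omega> in M. 0 \<le> G \<omega> \<and> (\<forall>k\<in>I. \<bar>\<Sum>t<N. innov (xrows \<omega>) t k\<bar> \<le> G \<omega>))"
proof -
  \<comment> \<open>the rows are processed in reverse order\<close>
  define D where "D s k \<omega> = innov (xrows \<omega>) (N - Suc s) k" for s k \<omega>
  define e where "e t l \<omega> = nres (batch_of t) (xrows \<omega>) l" for t l \<omega>
  define R where "R s \<omega> = K * \<bar>e (N - Suc s) (N - Suc s) \<omega>\<bar>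
     + K * ((\<Sum>l\<le>N - Suc s. \<bar>e (N - Suc s) l \<omega>\<bar>) / real (Suc (N - Suc s)))" for s \<omega>
  have em: "e t l \<in> borel_measurable M" and e2: "integrable M (\<lambda>\<omega>. (e t l \<omega>)\<^sup>2)"
      "expectation (\<lambda>\<omega>. (e t l \<omega>)\<^sup>2) \<le> K\<^sup>2" and ei: "integrable M (e t l)" if "t < N" "l \<le> t" for t l
  proof -
    have *: "batch_of t \<in> {1..batches m}" "l < cum_size m (batch_of t)"
      using batch_of_bounds[OF that(1)] that by auto
    show m: "e t l \<in> borel_measurable M"
      unfolding e_def by (rule measurable_compose[OF measurable_xrows measurable_nres[OF *]])
    show i: "integrable M (\<lambda>\<omega>. (e t l \<omega>)\<^sup>2)" and "expectation (\<lambda>\<omega>. (e t l \<omega>)\<^sup>2) \<le> K\<^sup>2"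
      unfolding e_def using nres_square[OF *] by auto
    show "integrable M (e t l)" by (rule square_integrable_imp_integrable[OF m i])
  qed
  have Dm: "D s k \<in> borel_measurable M" if "s < N" "k \<in> I" for s k
    unfolding D_def using that I(3)
    by (intro measurable_compose[OF measurable_xrows measurable_innov]) auto
  have Rm: "R s \<in> borel_measurable M" if "s < N" for s
    unfolding R_def using that
    by (intro borel_measurable_add borel_measurable_times borel_measurable_const borel_measurable_divide
        borel_measurable_sum borel_measurable_abs em) auto
  have bnd: "AE \<omega> in M. \<forall>k\<in>I. \<bar>D s k \<omega>\<bar> \<le> R s \<omega>" if s: "s < N" for s
    using AE_bounded
  proof eventually_elim
    case (elim \<omega>)
    define t where "t = N - Suc s"
    have t: "t < N" using s by (simp add: t_def)
    have sc: "\<bar>score (xrows \<omega>) t k l\<bar> \<le> K * \<bar>e t l \<omega>\<bar>" if "l \<le> t" "k \<in> I" for k l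
      unfolding score_def e_def abs_mult using that I(3) elim t
      by (intro mult_right_mono) (auto simp: xrows_entry)
    have c: "0 \<le> real (cum_size m (batch_of t - 1)) / real t" "real (cum_size m (batch_of t - 1)) / real t \<le> 1"
      using batch_of_bounds[OF t] by (auto simp: divide_le_eq)
    show ?case
    proof
      fix k assume k: "k \<in> I"
      have "\<bar>score (xrows \<omega>) t k t - (\<Sum>l\<le>t. score (xrows \<omega>) t k l) / real (Suc t)\<bar>
         \<le> \<bar>score (xrows \<omega>) t k t\<bar> + \<bar>\<Sum>l\<le>t. score (xrows \<omega>) t k l\<bar> / real (Suc t)"
        by (rule order_trans[OF abs_triangle_ineq4]) (simp add: abs_divide)
      also have "\<dots> \<le> K * \<bar>e t t \<omega>\<bar> + (\<Sum>l\<le>t. K * \<bar>e t l \<omega>\<bar>) / real (Suc t)"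
        using sc k by (intro add_mono divide_right_mono order_trans[OF sum_abs] sum_mono) auto
      also have "\<dots> = R s \<omega>" by (simp add: R_def t_def sum_distrib_left)
      finally have *: "\<bar>score (xrows \<omega>) t k t - (\<Sum>l\<le>t. score (xrows \<omega>) t k l) / real (Suc t)\<bar> \<le> R s \<omega>" .
      have "\<bar>D s k \<omega>\<bar> \<le> 1 * R s \<omega>"
        unfolding D_def t_def[symmetric] innov_def abs_mult using c * by (intro mult_mono) auto
      then show "\<bar>D s k \<omega>\<bar> \<le> R s \<omega>" by simp
    qed
  qed
  have R2: "integrable M (\<lambda>\<omega>. (R s \<omega>)\<^sup>2) \<and> expectation (\<lambda>\<omega>. (R s \<omega>)\<^sup>2) \<le> 4 * K ^ 4" if s: "s < N" for s
  proof -
    define t where "t = N - Suc s"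
    have t: "t < N" using s by (simp add: t_def)
    define B where "B \<omega> = 2 * K\<^sup>2 * (e t t \<omega>)\<^sup>2 + 2 * K\<^sup>2 / real (Suc t) * (\<Sum>l\<le>t. (e t l \<omega>)\<^sup>2)" for \<omega>
    have RB: "(R s \<omega>)\<^sup>2 \<le> B \<omega>" for \<omega>
    proof -
      define a where "a = \<bar>e t t \<omega>\<bar>"
      define b where "b = (\<Sum>l\<le>t. \<bar>e t l \<omega>\<bar>) / real (Suc t)"
      have "b\<^sup>2 = (\<Sum>l\<le>t. \<bar>e t l \<omega>\<bar>)\<^sup>2 / (real (Suc t))\<^sup>2" by (simp add: b_def power_divide)
      also have "\<dots> \<le> ((\<Sum>l\<le>t. \<bar>e t l \<omega>\<bar>\<^sup>2) * real (card {..t})) / (real (Suc t))\<^sup>2"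
        by (intro divide_right_mono sum_squared_le_sum_of_squares) auto
      also have "\<dots> = (\<Sum>l\<le>t. (e t l \<omega>)\<^sup>2) / real (Suc t)" by (simp add: power2_eq_square)
      finally have b2: "b\<^sup>2 \<le> (\<Sum>l\<le>t. (e t l \<omega>)\<^sup>2) / real (Suc t)" .
      have "(R s \<omega>)\<^sup>2 = K\<^sup>2 * (a + b)\<^sup>2"
        unfolding R_def t_def[symmetric] a_def b_def by (simp only: power_mult_distrib[symmetric] distrib_left)
      also have "(a + b)\<^sup>2 \<le> 2 * a\<^sup>2 + 2 * b\<^sup>2"
        using zero_le_power2[of "a - b"] by (simp add: power2_eq_square algebra_simps)
      also have "\<dots> \<le> 2 * a\<^sup>2 + 2 * ((\<Sum>l\<le>t. (e t l \<omega>)\<^sup>2) / real (Suc t))" using b2 by simp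
      finally have "(R s \<omega>)\<^sup>2 \<le> K\<^sup>2 * (2 * a\<^sup>2 + 2 * ((\<Sum>l\<le>t. (e t l \<omega>)\<^sup>2) / real (Suc t)))"
        by (simp add: mult_left_mono)
      also have "\<dots> = B \<omega>" by (simp add: B_def a_def algebra_simps)
      finally show ?thesis .
    qed
    have iB: "integrable M B"
      unfolding B_def using t by (intro Bochner_Integration.integrable_add Bochner_Integration.integrable_mult_right
          Bochner_Integration.integrable_sum e2) auto
    have iR: "integrable M (\<lambda>\<omega>. (R s \<omega>)\<^sup>2)"
    proof (rule Bochner_Integration.integrable_bound[OF iB])
      show "(\<lambda>\<omega>. (R s \<omega>)\<^sup>2) \<in> borel_measurable M" by (intro borel_measurable_power Rm s)
      have "norm ((R s \<omega>)\<^sup>2) \<le> norm (B \<omega>)" for \<omega>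
        using RB[of \<omega>] zero_le_power2[of "R s \<omega>"] by simp
      then show "AE \<omega> in M. norm ((R s \<omega>)\<^sup>2) \<le> norm (B \<omega>)" by simp
    qed
    have "expectation (\<lambda>\<omega>. (R s \<omega>)\<^sup>2) \<le> expectation B"
      using iR iB RB by (intro integral_mono)
    also have "expectation B = 2 * K\<^sup>2 * expectation (\<lambda>\<omega>. (e t t \<omega>)\<^sup>2)
        + 2 * K\<^sup>2 / real (Suc t) * (\<Sum>l\<le>t. expectation (\<lambda>\<omega>. (e t l \<omega>)\<^sup>2))"
    proof -
      have s1: "integrable M (\<lambda>\<omega>. \<Sum>l\<le>t. (e t l \<omega>)\<^sup>2)"
        using t by (intro Bochner_Integration.integrable_sum e2) auto
      have s2: "expectation (\<lambda>\<omega>. \<Sum>l\<le>t. (e t l \<omega>)\<^sup>2) = (\<Sum>l\<le>t. expectation (\<lambda>\<omega>. (e t l \<omega>)\<^sup>2))"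
        using t by (intro Bochner_Integration.integral_sum e2) auto
      have "expectation B = expectation (\<lambda>\<omega>. 2 * K\<^sup>2 * (e t t \<omega>)\<^sup>2)
          + expectation (\<lambda>\<omega>. 2 * K\<^sup>2 / real (Suc t) * (\<Sum>l\<le>t. (e t l \<omega>)\<^sup>2))"
        unfolding B_def by (rule Bochner_Integration.integral_add)
          (use t e2(1) s1 in \<open>auto intro!: Bochner_Integration.integrable_mult_right\<close>)
      then show ?thesis using s2 by simp
    qed
    also have "\<dots> \<le> 2 * K\<^sup>2 * K\<^sup>2 + 2 * K\<^sup>2 / real (Suc t) * (\<Sum>l\<le>t. K\<^sup>2)"
      using t by (intro add_mono mult_left_mono sum_mono e2) auto
    also have "\<dots> = 4 * K ^ 4" by (simp add: power2_eq_square power4_eq_xxxx)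
    finally show ?thesis using iR by blast
  qed
  \<comment> \<open>the weight \<open>W\<close> is a function of later innovations, hence symmetric in the rows up to \<open>t\<close>;
    exchanging rows \<open>l\<close> and \<open>t\<close> shows that all scores have the same mean against \<open>W\<close>\<close>
  have mart: "expectation (\<lambda>\<omega>. soft_weight \<theta> I (\<lambda>l. \<Sum>s'<s. D s' l \<omega>) k * D s k \<omega>) = 0"
    if s: "s < N" and k: "k \<in> I" and \<theta>: "0 < \<theta>" for \<theta> :: real and s k
  proof -
    define t where "t = N - Suc s"
    have t: "t < N" using s by (simp add: t_def)
    define W where "W \<rho> = soft_weight \<theta> I (\<lambda>l. \<Sum>s'<s. innov \<rho> (N - Suc s') l) k" for \<rho>
    have Wm: "W \<in> borel_measurable (PiM {..<N} (\<lambda>_. Row))"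
      unfolding W_def using s k I
      by (intro borel_measurable_soft_weight borel_measurable_sum measurable_innov) auto
    have WmM: "(\<lambda>\<omega>. W (xrows \<omega>)) \<in> borel_measurable M"
      by (rule measurable_compose[OF measurable_xrows Wm])
    have kp: "k < p" using k I by auto
    have Wsym: "W (\<lambda>i. \<rho> (Transposition.transpose a t i)) = W \<rho>" if "a \<le> t" for a \<rho>
      unfolding W_def using s that
      by (intro arg_cong2[where f = "\<lambda>x. soft_weight \<theta> I x"] refl ext sum.cong innov_transpose)
         (auto simp: t_def)
    have iWg: "integrable M (\<lambda>\<omega>. W (xrows \<omega>) * score (xrows \<omega>) t k l)" if l: "l \<le> t" for l
    proof (rule Bochner_Integration.integrable_bound)
      show "integrable M (\<lambda>\<omega>. K * e t l \<omega>)" using ei[OF t l] by simp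
      show "(\<lambda>\<omega>. W (xrows \<omega>) * score (xrows \<omega>) t k l) \<in> borel_measurable M"
        using WmM by (intro borel_measurable_times measurable_compose[OF measurable_xrows measurable_score] t l kp)
      show "AE \<omega> in M. norm (W (xrows \<omega>) * score (xrows \<omega>) t k l) \<le> norm (K * e t l \<omega>)"
        using AE_bounded
      proof eventually_elim
        case (elim \<omega>)
        have "\<bar>W (xrows \<omega>)\<bar> \<le> 1" unfolding W_def by (rule abs_soft_weight_le[OF I(1) k])
        moreover have "\<bar>score (xrows \<omega>) t k l\<bar> \<le> K * \<bar>e t l \<omega>\<bar>"
          unfolding score_def e_def abs_mult using elim t l kp
          by (intro mult_right_mono) (auto simp: xrows_entry)
        ultimately have "\<bar>W (xrows \<omega>)\<bar> * \<bar>score (xrows \<omega>) t k l\<bar> \<le> 1 * (K * \<bar>e t l \<omega>\<bar>)"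
          by (intro mult_mono) auto
        then show ?case using K_pos by (simp add: abs_mult)
      qed
    qed
    define A where "A = expectation (\<lambda>\<omega>. W (xrows \<omega>) * score (xrows \<omega>) t k t)"
    have A: "expectation (\<lambda>\<omega>. W (xrows \<omega>) * score (xrows \<omega>) t k l) = A" if l: "l \<le> t" for l
    proof -
      have "expectation (\<lambda>\<omega>. W (\<lambda>i. xrows \<omega> (Transposition.transpose l t i))
          * score (\<lambda>i. xrows \<omega> (Transposition.transpose l t i)) t k l) = expectation (\<lambda>\<omega>. W (xrows \<omega>) * score (xrows \<omega>) t k l)"
        by (rule exchange_rows[where \<phi> = "\<lambda>\<rho>. W \<rho> * score \<rho> t k l"])
           (use l t in \<open>auto intro!: borel_measurable_times Wm measurable_score kp\<close>)
      then show ?thesis by (simp add: A_def Wsym[OF l] score_transpose[OF t l])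
    qed
    define c where "c = real (cum_size m (batch_of t - 1)) / real t"
    have "expectation (\<lambda>\<omega>. W (xrows \<omega>) * innov (xrows \<omega>) t k)
      = expectation (\<lambda>\<omega>. c * (W (xrows \<omega>) * score (xrows \<omega>) t k t)
          - c / real (Suc t) * (\<Sum>l\<le>t. W (xrows \<omega>) * score (xrows \<omega>) t k l))"
      unfolding innov_def c_def[symmetric]
      by (intro Bochner_Integration.integral_cong refl)
         (simp only: sum_distrib_left[symmetric] right_diff_distrib times_divide_eq_left times_divide_eq_right mult_ac)
    also have "\<dots> = c * A - c / real (Suc t) * (\<Sum>l\<le>t. A)"
    proof -
      have s1: "integrable M (\<lambda>\<omega>. \<Sum>l\<le>t. W (xrows \<omega>) * score (xrows \<omega>) t k l)"
        using iWg by (intro Bochner_Integration.integrable_sum) auto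
      have s2: "expectation (\<lambda>\<omega>. \<Sum>l\<le>t. W (xrows \<omega>) * score (xrows \<omega>) t k l) = (\<Sum>l\<le>t. A)"
        using iWg A by (subst Bochner_Integration.integral_sum) auto
      show ?thesis
        using s1 s2 iWg[of t] A[of t] by (subst Bochner_Integration.integral_diff) auto
    qed
    also have "\<dots> = 0" by simp
    finally show ?thesis by (simp add: W_def D_def t_def)
  qed
  have N0: "0 < N" using N_ge_2 by simp
  obtain G where G: "integrable M G" "expectation G \<le> (1 + 2 * (4 * K ^ 4)) * sqrt (real N * ln (2 * real (card I)))"
     "AE \<omega> in M. 0 \<le> G \<omega> \<and> (\<forall>k\<in>I. \<bar>\<Sum>s<N. D s k \<omega>\<bar> \<le> G \<omega>)"
    using max_martingale_sum_bound[of I N D R "4 * K ^ 4", OF I(1,2) N0 Dm Rm bnd] R2 mart by blast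
  have rev: "(\<Sum>s<N. D s k \<omega>) = (\<Sum>t<N. innov (xrows \<omega>) t k)" for k \<omega>
    unfolding D_def by (rule sum.nat_diff_reindex)
  show ?thesis using G unfolding rev by blast
qed

end

section \<open>The oracle inequality and second moments of the design\<close>

text \<open>
  The oracle inequality on the event that the score of the noise is at most \<open>lam0\<close> and the
  empirical second moments are within \<open>\<tau>\<close> of \<open>g\<close>.  The cone condition follows either from
  \<open>lam0 \<le> lam / 2\<close> or, trivially, when \<open>S\<close> consists of all covariates; in the second case the noise
  may dominate the penalty.
\<close>
lemma lasso_l1_error:
  fixes X g :: "nat \<Rightarrow> nat \<Rightarrow> real" and S :: "nat set" and \<beta> \<beta>0 \<epsilon> :: "nat \<Rightarrow> real"
    and lam lam0 L \<tau> :: real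
  assumes n: "0 < n" and lam: "0 < lam" and L: "0 < L" and S: "S \<subseteq> {..<p}"
    and min: "lasso_loss n lam {..<p} (\<lambda>i. (\<Sum>k<p. X i k * \<beta>0 k) + \<epsilon> i) X \<beta>
      \<le> lasso_loss n lam {..<p} (\<lambda>i. (\<Sum>k<p. X i k * \<beta>0 k) + \<epsilon> i) X \<beta>0"
    and supp: "\<And>k. k < p \<Longrightarrow> k \<notin> S \<Longrightarrow> \<beta>0 k = 0"
    and score: "\<And>k. k < p \<Longrightarrow> \<bar>\<Sum>i<n. X i k * \<epsilon> i\<bar> \<le> n * lam0"
    and gram: "\<And>k l. k < p \<Longrightarrow> l < p \<Longrightarrow> \<bar>(\<Sum>i<n. X i k * X i l) - n * g k l\<bar> \<le> n * \<tau>"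
    and coer: "\<And>v. (\<Sum>k<p. (v k)\<^sup>2) \<le> L * quad_form p g v"
    and small: "32 * L * card S * \<tau> \<le> 1" and \<tau>: "0 \<le> \<tau>"
    and cone: "lam0 \<le> lam / 2 \<or> S = {..<p}"
    and lam0: "0 \<le> lam0"
  shows "(\<Sum>k<p. \<bar>\<beta> k - \<beta>0 k\<bar>) \<le> 16 * L * card S * (lam0 + lam)"
proof -
  define v where "v k = \<beta> k - \<beta>0 k" for k
  define A where "A = (\<Sum>k\<in>S. \<bar>v k\<bar>)"
  define Bc where "Bc = (\<Sum>k\<in>{..<p} - S. \<bar>v k\<bar>)"
  define q where "q = (\<Sum>i<n. (\<Sum>k<p. X i k * v k)\<^sup>2) / n"
  have finS: "finite S" using S finite_subset by blast
  have A0: "0 \<le> A" and B0: "0 \<le> Bc" unfolding A_def Bc_def by (auto intro: sum_nonneg)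
  have splitS: "(\<Sum>k<p. f k) = (\<Sum>k\<in>S. f k) + (\<Sum>k\<in>{..<p} - S. f k)" for f :: "nat \<Rightarrow> real"
    using S by (subst sum.subset_diff[of S]) auto
  have l1: "(\<Sum>k<p. \<bar>v k\<bar>) = A + Bc" unfolding A_def Bc_def using splitS[of "\<lambda>k. \<bar>v k\<bar>"] by simp
  have pen: "(\<Sum>k<p. \<bar>\<beta>0 k\<bar>) - (\<Sum>k<p. \<bar>\<beta> k\<bar>) \<le> A - Bc"
  proof -
    have "(\<Sum>k\<in>{..<p} - S. \<bar>\<beta>0 k\<bar>) = 0" using supp by (intro sum.neutral) auto
    moreover have "Bc = (\<Sum>k\<in>{..<p} - S. \<bar>\<beta> k\<bar>)" unfolding Bc_def v_def using supp by (intro sum.cong) auto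
    moreover have "(\<Sum>k\<in>S. \<bar>\<beta>0 k\<bar>) \<le> (\<Sum>k\<in>S. \<bar>\<beta> k\<bar> + \<bar>v k\<bar>)" by (intro sum_mono) (simp add: v_def)
    ultimately show ?thesis using splitS[of "\<lambda>k. \<bar>\<beta>0 k\<bar>"] splitS[of "\<lambda>k. \<bar>\<beta> k\<bar>"] by (simp add: A_def sum.distrib)
  qed
  have inner: "(\<Sum>i<n. \<epsilon> i * (\<Sum>k<p. X i k * v k)) \<le> n * lam0 * (A + Bc)"
  proof -
    have "(\<Sum>i<n. \<epsilon> i * (\<Sum>k<p. X i k * v k)) = (\<Sum>i<n. \<Sum>k<p. X i k * \<epsilon> i * v k)"
      unfolding sum_distrib_left by (simp add: mult_ac)
    also have "\<dots> = (\<Sum>k<p. \<Sum>i<n. X i k * \<epsilon> i * v k)" by (rule sum.swap)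
    also have "\<dots> = (\<Sum>k<p. (\<Sum>i<n. X i k * \<epsilon> i) * v k)" by (simp add: sum_distrib_right)
    also have "\<dots> \<le> (\<Sum>k<p. (n * lam0) * \<bar>v k\<bar>)"
    proof (rule sum_mono)
      fix k assume "k \<in> {..<p}"
      then have "\<bar>\<Sum>i<n. X i k * \<epsilon> i\<bar> * \<bar>v k\<bar> \<le> (n * lam0) * \<bar>v k\<bar>"
        using score by (intro mult_right_mono) auto
      moreover have "(\<Sum>i<n. X i k * \<epsilon> i) * v k \<le> \<bar>\<Sum>i<n. X i k * \<epsilon> i\<bar> * \<bar>v k\<bar>"
        unfolding abs_mult[symmetric] by (rule abs_ge_self)
      ultimately show "(\<Sum>i<n. X i k * \<epsilon> i) * v k \<le> (n * lam0) * \<bar>v k\<bar>" by linarith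
    qed
    also have "\<dots> = n * lam0 * (A + Bc)" by (simp only: sum_distrib_left[symmetric] l1)
    finally show ?thesis .
  qed
  have basic: "q / 2 \<le> (lam0 + lam) * A + (lam0 - lam) * Bc"
  proof -
    define a b c where "a = (\<Sum>i<n. (\<epsilon> i)\<^sup>2)" and "b = (\<Sum>i<n. \<epsilon> i * (\<Sum>k<p. X i k * v k))"
      and "c = (\<Sum>i<n. (\<Sum>k<p. X i k * v k)\<^sup>2)"
    have r1: "(\<Sum>k<p. X i k * \<beta>0 k) + \<epsilon> i - (\<Sum>k<p. X i k * \<beta> k) = \<epsilon> i - (\<Sum>k<p. X i k * v k)" for i
      by (simp add: v_def right_diff_distrib sum_subtractf)
    have s1: "(\<Sum>i<n. (\<epsilon> i - (\<Sum>k<p. X i k * v k))\<^sup>2) = a - 2 * b + c"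
      unfolding a_def b_def c_def
      by (simp add: power2_diff sum.distrib sum_subtractf sum_distrib_left mult.assoc)
    have "1 / (2 * real n) * (a - 2 * b + c) + lam * (\<Sum>k<p. \<bar>\<beta> k\<bar>) \<le> 1 / (2 * real n) * a + lam * (\<Sum>k<p. \<bar>\<beta>0 k\<bar>)"
      using min unfolding lasso_loss_def r1 s1 by (simp add: a_def)
    then have "1 / (2 * real n) * c \<le> 1 / real n * b + lam * ((\<Sum>k<p. \<bar>\<beta>0 k\<bar>) - (\<Sum>k<p. \<bar>\<beta> k\<bar>))"
    proof -
      assume h: "1 / (2 * real n) * (a - 2 * b + c) + lam * (\<Sum>k<p. \<bar>\<beta> k\<bar>)
        \<le> 1 / (2 * real n) * a + lam * (\<Sum>k<p. \<bar>\<beta>0 k\<bar>)"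
      have "1 / (2 * real n) * (a - 2 * b + c) = 1 / (2 * real n) * a - 1 / real n * b + 1 / (2 * real n) * c"
        by (simp add: add_divide_distrib diff_divide_distrib)
      then show ?thesis using h by (simp only: right_diff_distrib)
    qed
    also have "\<dots> \<le> 1 / real n * (n * lam0 * (A + Bc)) + lam * (A - Bc)"
      using inner pen lam unfolding b_def by (intro add_mono mult_left_mono) auto
    also have "\<dots> = (lam0 + lam) * A + (lam0 - lam) * Bc" using n by (simp add: field_simps)
    finally show ?thesis by (simp add: q_def c_def mult.commute)
  qed
  have q0: "0 \<le> q" unfolding q_def by (simp add: sum_nonneg)
  have cone': "Bc \<le> 3 * A \<and> (lam0 - lam) * Bc \<le> 0"
    using cone
  proof
    assume h: "lam0 \<le> lam / 2"
    have "(lam0 + lam) * A \<le> 3 / 2 * lam * A" using h A0 by (intro mult_right_mono) auto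
    moreover have "(lam0 - lam) * Bc \<le> - (lam / 2) * Bc" using h B0 by (intro mult_right_mono) auto
    ultimately have "0 \<le> lam / 2 * (3 * A - Bc)" using basic q0 by (simp add: algebra_simps)
    then have "0 \<le> 3 * A - Bc" using lam by (simp add: zero_le_mult_iff)
    moreover have "(lam0 - lam) * Bc \<le> 0" using h lam B0 by (intro mult_nonpos_nonneg) auto
    ultimately show ?thesis by simp
  next
    assume "S = {..<p}"
    then have "Bc = 0" by (simp add: Bc_def)
    then show ?thesis using A0 by simp
  qed
  have "q \<le> 2 * ((lam0 + lam) * A)" using basic conjunct2[OF cone'] by linarith
  then have q_le: "q \<le> 2 * (lam0 + lam) * A" by (simp only: mult.assoc)
  define n2 where "n2 = (\<Sum>k<p. (v k)\<^sup>2)"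
  have n20: "0 \<le> n2" unfolding n2_def by (simp add: sum_nonneg)
  have A2: "A\<^sup>2 \<le> card S * n2"
  proof -
    have "A\<^sup>2 \<le> (\<Sum>k\<in>S. \<bar>v k\<bar>\<^sup>2) * card S" unfolding A_def by (rule sum_squared_le_sum_of_squares)
    also have "(\<Sum>k\<in>S. \<bar>v k\<bar>\<^sup>2) \<le> n2" unfolding n2_def using S by (auto intro!: sum_mono2)
    finally show ?thesis by (simp add: mult.commute mult_right_mono)
  qed
  have qf: "quad_form p g v \<le> q + \<tau> * (A + Bc)\<^sup>2"
  proof -
    have e1: "n * q = (\<Sum>k<p. \<Sum>l<p. v k * (\<Sum>i<n. X i k * X i l) * v l)"
    proof -
      have "n * q = (\<Sum>i<n. (\<Sum>k<p. X i k * v k) * (\<Sum>l<p. X i l * v l))"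
        using n by (simp add: q_def power2_eq_square)
      also have "\<dots> = (\<Sum>i<n. \<Sum>k<p. \<Sum>l<p. v k * (X i k * X i l) * v l)"
        by (simp add: sum_product mult_ac)
      also have "\<dots> = (\<Sum>k<p. \<Sum>i<n. \<Sum>l<p. v k * (X i k * X i l) * v l)" by (rule sum.swap)
      also have "\<dots> = (\<Sum>k<p. \<Sum>l<p. \<Sum>i<n. v k * (X i k * X i l) * v l)"
        by (intro sum.cong refl sum.swap)
      finally show ?thesis by (simp add: sum_distrib_left sum_distrib_right)
    qed
    have "n * quad_form p g v - n * q = (\<Sum>k<p. \<Sum>l<p. v k * (n * g k l - (\<Sum>i<n. X i k * X i l)) * v l)"
    proof -
      have "n * quad_form p g v = (\<Sum>k<p. \<Sum>l<p. v k * (n * g k l) * v l)"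
        by (simp add: quad_form_def sum_distrib_left mult_ac)
      then show ?thesis
        unfolding e1 by (simp add: sum_subtractf[symmetric] right_diff_distrib left_diff_distrib)
    qed
    also have "\<dots> \<le> (\<Sum>k<p. \<Sum>l<p. (n * \<tau>) * (\<bar>v k\<bar> * \<bar>v l\<bar>))"
    proof (intro sum_mono)
      fix k l assume kl: "k \<in> {..<p}" "l \<in> {..<p}"
      have "v k * (n * g k l - (\<Sum>i<n. X i k * X i l)) * v l
        \<le> \<bar>v k * (n * g k l - (\<Sum>i<n. X i k * X i l)) * v l\<bar>" by (rule abs_ge_self)
      also have "\<dots> = \<bar>(\<Sum>i<n. X i k * X i l) - n * g k l\<bar> * (\<bar>v k\<bar> * \<bar>v l\<bar>)"
        by (simp add: abs_mult abs_minus_commute)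
      also have "\<dots> \<le> (n * \<tau>) * (\<bar>v k\<bar> * \<bar>v l\<bar>)" using gram kl by (intro mult_right_mono) auto
      finally show "v k * (n * g k l - (\<Sum>i<n. X i k * X i l)) * v l \<le> (n * \<tau>) * (\<bar>v k\<bar> * \<bar>v l\<bar>)" .
    qed
    also have "\<dots> = n * (\<tau> * (A + Bc)\<^sup>2)"
      unfolding l1[symmetric] power2_eq_square sum_product by (simp add: sum_distrib_left mult_ac)
    finally have "n * (quad_form p g v) \<le> n * (q + \<tau> * (A + Bc)\<^sup>2)" by (simp add: algebra_simps)
    then show ?thesis using n by simp
  qed
  have "(A + Bc)\<^sup>2 \<le> (4 * A)\<^sup>2" using cone' A0 B0 by (intro power_mono) auto
  then have "(A + Bc)\<^sup>2 \<le> 16 * (card S * n2)" using A2 by (simp add: power_mult_distrib)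
  then have "\<tau> * (A + Bc)\<^sup>2 \<le> \<tau> * (16 * (card S * n2))" using \<tau> by (rule mult_left_mono)
  then have "quad_form p g v \<le> q + \<tau> * (16 * (card S * n2))" using qf by simp
  then have "L * quad_form p g v \<le> L * (q + \<tau> * (16 * (card S * n2)))" using L by (intro mult_left_mono) auto
  moreover have "n2 \<le> L * quad_form p g v" unfolding n2_def by (rule coer)
  moreover have "L * (q + \<tau> * (16 * (card S * n2))) = L * q + (32 * L * card S * \<tau>) * (n2 / 2)" by (simp add: algebra_simps)
  moreover have "(32 * L * card S * \<tau>) * (n2 / 2) \<le> 1 * (n2 / 2)" using small n20 by (intro mult_right_mono) auto
  ultimately have "n2 \<le> 2 * L * q" by simp
  also have "\<dots> \<le> 2 * L * (2 * (lam0 + lam) * A)" using q_le L by (intro mult_left_mono) auto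
  finally have "card S * n2 \<le> card S * (2 * L * (2 * (lam0 + lam) * A))" by (intro mult_left_mono) auto
  with A2 have "A * A \<le> (4 * L * card S * (lam0 + lam)) * A" by (simp add: power2_eq_square algebra_simps)
  then have "A \<le> 4 * L * card S * (lam0 + lam)"
    using A0 L lam0 lam by (cases "A = 0") (auto simp: mult_le_cancel_right)
  then show ?thesis using cone' l1 unfolding v_def by simp
qed

context regression_stream
begin

text \<open>
  The second moments of a row, without centring.
\<close>

definition "gram k l = expectation (\<lambda>\<omega>. design m 0 k \<omega> * design m 0 l \<omega>)"

lemma N_pos: "0 < N" using N_ge_2 by simp

lemma expectation_xrow:
  assumes "i < N" "f \<in> borel_measurable Row"
  shows "expectation (\<lambda>\<omega>. f (xrow i \<omega>)) = expectation (\<lambda>\<omega>. f (xrow 0 \<omega>) :: real)"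
  using integral_distr[OF measurable_xrow[OF assms(1)] assms(2)]
    integral_distr[OF measurable_xrow[OF N_pos] assms(2)] distr_row[OF assms(1)] by simp

lemma measurable_coord: "k < p \<Longrightarrow> (\<lambda>v. v k) \<in> borel_measurable Row"
  by (rule measurable_component_singleton) simp

lemma xrow_entry: "k < p \<Longrightarrow> xrow i \<omega> k = design m i k \<omega>"
  by (simp add: xrow_def)

lemma AE_bounded_row:
  assumes "i < N"
  shows "AE \<omega> in M. \<forall>k<p. \<bar>design m i k \<omega>\<bar> \<le> K"
  using AE_bounded by eventually_elim (use assms in auto)

lemma integrable_design_product:
  assumes "i < N" "k < p" "l < p"
  shows "integrable M (\<lambda>\<omega>. design m i k \<omega> * design m i l \<omega>)"
proof (rule integrable_const_bound[where B = "K * K"])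
  show "AE \<omega> in M. norm (design m i k \<omega> * design m i l \<omega>) \<le> K * K"
    using AE_bounded_row[OF assms(1)]
    by eventually_elim (use assms K_pos in \<open>auto simp: abs_mult intro!: mult_mono\<close>)
qed (use assms in measurable)

lemma integrable_design:
  assumes "i < N" "k < p"
  shows "integrable M (design m i k)"
proof (rule integrable_const_bound[where B = K])
  show "AE \<omega> in M. norm (design m i k \<omega>) \<le> K"
    using AE_bounded_row[OF assms(1)] by eventually_elim (use assms in auto)
qed (use assms in measurable)

lemma gram_row:
  assumes "i < N" "k < p" "l < p"
  shows "expectation (\<lambda>\<omega>. design m i k \<omega> * design m i l \<omega>) = gram k l"
  using expectation_xrow[OF assms(1), of "\<lambda>v. v k * v l"] assms(2,3) measurable_coord
  unfolding gram_def by (simp add: xrow_entry)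

lemma quad_form_expectation:
  assumes int: "\<And>k l. k < q \<Longrightarrow> l < q \<Longrightarrow> integrable M (\<lambda>\<omega>. f k \<omega> * f l \<omega> :: real)"
  shows "quad_form q (\<lambda>k l. expectation (\<lambda>\<omega>. f k \<omega> * f l \<omega>)) v = expectation (\<lambda>\<omega>. (\<Sum>k<q. f k \<omega> * v k)\<^sup>2)"
proof -
  have "expectation (\<lambda>\<omega>. (\<Sum>k<q. f k \<omega> * v k)\<^sup>2) = expectation (\<lambda>\<omega>. \<Sum>k<q. \<Sum>l<q. v k * v l * (f k \<omega> * f l \<omega>))"
    by (simp add: power2_eq_square sum_product mult_ac)
  also have "\<dots> = (\<Sum>k<q. expectation (\<lambda>\<omega>. \<Sum>l<q. v k * v l * (f k \<omega> * f l \<omega>)))"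
    using int by (intro Bochner_Integration.integral_sum Bochner_Integration.integrable_sum
        Bochner_Integration.integrable_mult_right) auto
  also have "\<dots> = (\<Sum>k<q. \<Sum>l<q. expectation (\<lambda>\<omega>. v k * v l * (f k \<omega> * f l \<omega>)))"
    using int by (intro sum.cong refl Bochner_Integration.integral_sum
        Bochner_Integration.integrable_mult_right) auto
  also have "\<dots> = quad_form q (\<lambda>k l. expectation (\<lambda>\<omega>. f k \<omega> * f l \<omega>)) v"
    unfolding quad_form_def by (intro sum.cong refl) simp
  finally show ?thesis by simp
qed

text \<open>
  The second moment matrix exceeds the covariance matrix by the outer product of the mean with
  itself.
\<close>
lemma gram_coercive:
  assumes p: "0 < p" and pos: "0 < min_eigenvalue (Sigma_mat m)" and L: "1 / min_eigenvalue (Sigma_mat m) \<le> L"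
  shows "0 < L" "(\<Sum>k<p. (v k)\<^sup>2) \<le> L * quad_form p gram v"
proof -
  define \<mu> where "\<mu> k = expectation (design m 0 k)" for k
  define f where "f k \<omega> = design m 0 k \<omega> - \<mu> k" for k \<omega>
  define cov where "cov k l = expectation (\<lambda>\<omega>. f k \<omega> * f l \<omega>)" for k l
  have Sig: "Sigma_mat m = mat p p (\<lambda>(k, l). cov k l)"
    unfolding Sigma_mat_def cov_def f_def \<mu>_def by (simp add: fun_eq_iff case_prod_beta)
  have ff: "f k \<omega> * f l \<omega> = design m 0 k \<omega> * design m 0 l \<omega> - \<mu> l * design m 0 k \<omega> - \<mu> k * design m 0 l \<omega> + \<mu> k * \<mu> l"
    for k l \<omega> by (simp add: f_def algebra_simps)
  have int: "integrable M (\<lambda>\<omega>. f k \<omega> * f l \<omega>)" if "k < p" "l < p" for k l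
    unfolding ff using that N_pos
    by (intro Bochner_Integration.integrable_add Bochner_Integration.integrable_diff
        Bochner_Integration.integrable_mult_right integrable_design integrable_design_product integrable_const) auto
  have cov: "cov k l = gram k l - \<mu> k * \<mu> l" if "k < p" "l < p" for k l
    using that N_pos integrable_design[of 0] integrable_design_product[of 0 k l]
    unfolding cov_def ff gram_def by (simp add: prob_space \<mu>_def)
  have qc: "quad_form p cov v = expectation (\<lambda>\<omega>. (\<Sum>k<p. f k \<omega> * v k)\<^sup>2)" for v
    unfolding cov_def by (rule quad_form_expectation[OF int])
  have psd: "0 \<le> quad_form p cov v" for v unfolding qc by (intro Bochner_Integration.integral_nonneg) simp
  have sym: "\<forall>k<p. \<forall>l<p. cov k l = cov l k" by (simp add: cov_def mult.commute)
  define e where "e = min_eigenvalue (Sigma_mat m)"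
  have e: "0 < e" "1 / e \<le> L" using pos L by (auto simp: e_def)
  show L0: "0 < L" using e by (meson less_le_trans zero_less_divide_1_iff)
  have "e * (\<Sum>k<p. (v k)\<^sup>2) \<le> quad_form p cov v"
    using min_eigenvalue_le_Rayleigh[OF p sym psd] unfolding e_def min_eigenvalue_def Sig .
  also have "quad_form p cov v = quad_form p gram v - (\<Sum>k<p. \<mu> k * v k)\<^sup>2"
  proof -
    have "quad_form p cov v = (\<Sum>k<p. \<Sum>l<p. v k * gram k l * v l - (\<mu> k * v k) * (\<mu> l * v l))"
      unfolding quad_form_def by (intro sum.cong refl) (simp add: cov algebra_simps)
    then show ?thesis by (simp add: quad_form_def sum_subtractf power2_eq_square sum_product)
  qed
  also have "\<dots> \<le> quad_form p gram v" by simp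
  finally have h: "e * (\<Sum>k<p. (v k)\<^sup>2) \<le> quad_form p gram v" .
  have "(\<Sum>k<p. (v k)\<^sup>2) = 1 / e * (e * (\<Sum>k<p. (v k)\<^sup>2))" using e by simp
  also have "\<dots> \<le> 1 / e * quad_form p gram v" using h e by (intro mult_left_mono) auto
  also have "\<dots> \<le> L * quad_form p gram v"
  proof (rule mult_right_mono[OF e(2)])
    have "0 \<le> e * (\<Sum>k<p. (v k)\<^sup>2)" using e by (simp add: sum_nonneg)
    then show "0 \<le> quad_form p gram v" using h by simp
  qed
  finally show "(\<Sum>k<p. (v k)\<^sup>2) \<le> L * quad_form p gram v" .
qed

lemma gram_max:
  assumes p: "0 < p"
  shows "\<exists>G. integrable M G \<and> expectation G \<le> (1 + 2 * (4 * K ^ 4)) * sqrt (real N * ln (2 * (real p)\<^sup>2))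
     \<and> (AE \<omega> in M. 0 \<le> G \<omega> \<and> (\<forall>k<p. \<forall>l<p.
         \<bar>(\<Sum>i<N. design m i k \<omega> * design m i l \<omega>) - N * gram k l\<bar> \<le> G \<omega>))"
proof -
  let ?I = "{..<p} \<times> {..<p}"
  have I: "finite ?I" "?I \<noteq> {}" using p by auto
  have gK: "\<bar>gram k l\<bar> \<le> K\<^sup>2" if "k < p" "l < p" for k l
  proof -
    have "\<bar>gram k l\<bar> \<le> expectation (\<lambda>\<omega>. \<bar>design m 0 k \<omega> * design m 0 l \<omega>\<bar>)"
      unfolding gram_def by (rule integral_abs_bound)
    also have "\<dots> \<le> expectation (\<lambda>\<omega>. K\<^sup>2)"
    proof (rule integral_mono_AE)
      show "AE \<omega> in M. \<bar>design m 0 k \<omega> * design m 0 l \<omega>\<bar> \<le> K\<^sup>2"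
        using AE_bounded_row[OF N_pos] by eventually_elim
          (use that K_pos in \<open>auto simp: abs_mult power2_eq_square intro!: mult_mono\<close>)
    qed (use integrable_design_product[OF N_pos that] in auto)
    finally show ?thesis by (simp add: prob_space)
  qed
  have "\<exists>G. integrable M G \<and> expectation G \<le> (1 + 2 * (4 * K ^ 4)) * sqrt (real N * ln (2 * real (card ?I)))
     \<and> (AE \<omega> in M. 0 \<le> G \<omega> \<and> (\<forall>kl\<in>?I. \<bar>\<Sum>i<N. xrow i \<omega> (fst kl) * xrow i \<omega> (snd kl) - gram (fst kl) (snd kl)\<bar> \<le> G \<omega>))"
  proof (rule max_indep_sum_bound[OF indep_rows I N_pos, where f = "\<lambda>i kl v. v (fst kl) * v (snd kl) - gram (fst kl) (snd kl)"
        and \<rho> = "\<lambda>i v. 2 * K\<^sup>2"])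
    show "(\<lambda>v. v (fst kl) * v (snd kl) - gram (fst kl) (snd kl)) \<in> borel_measurable Row" if "kl \<in> ?I" for kl
      using that by (intro borel_measurable_diff borel_measurable_times borel_measurable_const measurable_coord) auto
    show "AE \<omega> in M. \<forall>kl\<in>?I. \<bar>xrow i \<omega> (fst kl) * xrow i \<omega> (snd kl) - gram (fst kl) (snd kl)\<bar> \<le> 2 * K\<^sup>2"
      if "i < N" for i
      using AE_bounded_row[OF that]
    proof eventually_elim
      case (elim \<omega>)
      show ?case
      proof
        fix kl assume kl: "kl \<in> ?I"
        have "\<bar>design m i (fst kl) \<omega> * design m i (snd kl) \<omega>\<bar> \<le> K\<^sup>2"
          using elim kl K_pos by (auto simp: abs_mult power2_eq_square intro!: mult_mono)
        moreover have "\<bar>gram (fst kl) (snd kl)\<bar> \<le> K\<^sup>2" using gK kl by auto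
        ultimately show "\<bar>xrow i \<omega> (fst kl) * xrow i \<omega> (snd kl) - gram (fst kl) (snd kl)\<bar> \<le> 2 * K\<^sup>2"
          using kl by (auto simp: xrow_entry)
      qed
    qed
    show "expectation (\<lambda>\<omega>. xrow i \<omega> (fst kl) * xrow i \<omega> (snd kl) - gram (fst kl) (snd kl)) = 0"
      if "i < N" "kl \<in> ?I" for i kl
      using that integrable_design_product[of i "fst kl" "snd kl"] gram_row[of i "fst kl" "snd kl"]
      by (auto simp: xrow_entry prob_space)
  qed (auto simp: prob_space power_mult_distrib power2_eq_square power4_eq_xxxx)
  moreover have "card ?I = p\<^sup>2" by (simp add: power2_eq_square)
  ultimately obtain G where G: "integrable M G" "expectation G \<le> (1 + 2 * (4 * K ^ 4)) * sqrt (real N * ln (2 * (real p)\<^sup>2))"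
     "AE \<omega> in M. 0 \<le> G \<omega> \<and> (\<forall>kl\<in>?I. \<bar>\<Sum>i<N. xrow i \<omega> (fst kl) * xrow i \<omega> (snd kl) - gram (fst kl) (snd kl)\<bar> \<le> G \<omega>)"
    by auto
  show ?thesis
  proof (intro exI conjI)
    show "AE \<omega> in M. 0 \<le> G \<omega> \<and> (\<forall>k<p. \<forall>l<p. \<bar>(\<Sum>i<N. design m i k \<omega> * design m i l \<omega>) - N * gram k l\<bar> \<le> G \<omega>)"
      using G(3)
    proof eventually_elim
      case (elim \<omega>)
      have "\<bar>(\<Sum>i<N. design m i k \<omega> * design m i l \<omega>) - N * gram k l\<bar> \<le> G \<omega>" if "k < p" "l < p" for k l
      proof -
        have "(\<Sum>i<N. xrow i \<omega> k * xrow i \<omega> l - gram k l) = (\<Sum>i<N. design m i k \<omega> * design m i l \<omega>) - N * gram k l"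
          using that by (simp add: xrow_entry sum_subtractf)
        moreover have "\<bar>\<Sum>i<N. xrow i \<omega> k * xrow i \<omega> l - gram k l\<bar> \<le> G \<omega>"
          using elim that by force
        ultimately show ?thesis by simp
      qed
      then show ?case using elim by blast
    qed
  qed (use G in auto)
qed

end

section \<open>A lower bound by duality\<close>

lemma ln_double_le:
  assumes "2 \<le> (p::nat)"
  shows "ln (2 * real p) \<le> 2 * ln (real p)" "0 < ln (real p)"
proof -
  have "ln (2 * real p) = ln 2 + ln (real p)" using assms by (simp add: ln_mult_pos)
  also have "ln 2 \<le> ln (real p)" using assms by (intro ln_mono) auto
  finally show "ln (2 * real p) \<le> 2 * ln (real p)" by simp
  show "0 < ln (real p)" using assms by simp
qed

lemma ln_2_le_1: "ln 2 \<le> (1::real)"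
  using ln_le_minus_one[of "2::real"] by simp

lemma sum_batch_over_sqrt:
  "(\<Sum>j = 1..b. real (batch_size m j) / sqrt (real (cum_size m j))) \<le> 2 * sqrt (real (cum_size m b))"
proof (induction b)
  case 0
  then show ?case by (simp add: cum_size_0)
next
  case (Suc b)
  define u v where "u = sqrt (real (cum_size m b))" and "v = sqrt (real (cum_size m (Suc b)))"
  have uv: "0 \<le> u" "u \<le> v"
    unfolding u_def v_def using cum_size_mono[of b "Suc b" m] by auto
  have "real (batch_size m (Suc b)) = v\<^sup>2 - u\<^sup>2"
    unfolding u_def v_def by (simp add: cum_size_Suc)
  then have "real (batch_size m (Suc b)) / v \<le> 2 * v - 2 * u"
  proof (cases "v = 0")
    case True
    then show ?thesis using uv by simp
  next
    case False
    then have v: "0 < v" using uv by simp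
    have "v\<^sup>2 - u\<^sup>2 \<le> (2 * v - 2 * u) * v"
      using zero_le_power2[of "v - u"] by (simp add: power2_eq_square algebra_simps)
    then show ?thesis using v \<open>real (batch_size m (Suc b)) = v\<^sup>2 - u\<^sup>2\<close> by (simp add: pos_divide_le_eq)
  qed
  then show ?case using Suc by (simp add: u_def v_def)
qed

lemma sum_batch_size: "(\<Sum>j = 1..batches m. real (batch_size m j)) = real (total_size m)"
  by (simp add: total_size_def cum_size_def)

context regression_stream
begin

text \<open>
  The linear combination of the covariates of a row \<open>v\<close> with coefficients \<open>u\<close>.  It is used for the
  vector \<open>u\<close> with \<open>gram u = e\<^sub>r\<close>: then it is a multiple of the population residual of covariate \<open>r\<close>,
  that is, its product with every other covariate has mean zero.
\<close>

definition "dual_pred u v = (\<Sum>k<p. v k * (u k :: real))"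

lemma measurable_dual_pred: "dual_pred u \<in> borel_measurable Row"
  unfolding dual_pred_def by (intro borel_measurable_sum borel_measurable_times measurable_coord borel_measurable_const) auto

lemma dual_pred_bounded:
  assumes "i < N"
  shows "AE \<omega> in M. \<bar>dual_pred u (xrow i \<omega>)\<bar> \<le> K * (\<Sum>k<p. \<bar>u k\<bar>)"
  using AE_bounded_row[OF assms]
proof eventually_elim
  case (elim \<omega>)
  have "\<bar>dual_pred u (xrow i \<omega>)\<bar> \<le> (\<Sum>k<p. \<bar>xrow i \<omega> k * u k\<bar>)"
    unfolding dual_pred_def by (rule sum_abs)
  also have "\<dots> \<le> (\<Sum>k<p. K * \<bar>u k\<bar>)"
    using elim by (intro sum_mono) (auto simp: abs_mult xrow_entry intro!: mult_right_mono)
  finally show ?case by (simp add: sum_distrib_left)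
qed

lemma dual_pred_moments:
  assumes i: "i < N" and k: "k < p"
  shows "integrable M (\<lambda>\<omega>. design m i k \<omega> * dual_pred u (xrow i \<omega>))"
    "expectation (\<lambda>\<omega>. design m i k \<omega> * dual_pred u (xrow i \<omega>)) = (\<Sum>l<p. gram k l * u l)"
    "integrable M (\<lambda>\<omega>. (dual_pred u (xrow i \<omega>))\<^sup>2)"
    "expectation (\<lambda>\<omega>. (dual_pred u (xrow i \<omega>))\<^sup>2) = quad_form p gram u"
proof -
  have eq: "design m i k \<omega> * dual_pred u (xrow i \<omega>) = (\<Sum>l<p. u l * (design m i k \<omega> * design m i l \<omega>))" for \<omega>
    by (simp add: dual_pred_def xrow_entry sum_distrib_left mult_ac)
  show "integrable M (\<lambda>\<omega>. design m i k \<omega> * dual_pred u (xrow i \<omega>))"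
    unfolding eq using i k by (intro Bochner_Integration.integrable_sum Bochner_Integration.integrable_mult_right
        integrable_design_product) auto
  have "expectation (\<lambda>\<omega>. design m i k \<omega> * dual_pred u (xrow i \<omega>))
      = (\<Sum>l<p. expectation (\<lambda>\<omega>. u l * (design m i k \<omega> * design m i l \<omega>)))"
    unfolding eq using i k by (intro Bochner_Integration.integral_sum Bochner_Integration.integrable_mult_right
        integrable_design_product) auto
  also have "\<dots> = (\<Sum>l<p. gram k l * u l)"
    using i k by (intro sum.cong refl) (simp add: gram_row)
  finally show "expectation (\<lambda>\<omega>. design m i k \<omega> * dual_pred u (xrow i \<omega>)) = (\<Sum>l<p. gram k l * u l)" .
  show "integrable M (\<lambda>\<omega>. (dual_pred u (xrow i \<omega>))\<^sup>2)"
  proof (rule integrable_const_bound[where B = "(K * (\<Sum>k<p. \<bar>u k\<bar>))\<^sup>2"])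
    show "AE \<omega> in M. norm ((dual_pred u (xrow i \<omega>))\<^sup>2) \<le> (K * (\<Sum>k<p. \<bar>u k\<bar>))\<^sup>2"
      using dual_pred_bounded[OF i, of u] by eventually_elim (simp add: abs_le_square_iff[symmetric])
    show "(\<lambda>\<omega>. (dual_pred u (xrow i \<omega>))\<^sup>2) \<in> borel_measurable M"
      by (intro borel_measurable_power measurable_compose[OF measurable_xrow[OF i] measurable_dual_pred])
  qed
  have "expectation (\<lambda>\<omega>. (dual_pred u (xrow i \<omega>))\<^sup>2) = expectation (\<lambda>\<omega>. (\<Sum>k<p. design m i k \<omega> * u k)\<^sup>2)"
    by (simp add: dual_pred_def xrow_entry)
  also have "\<dots> = quad_form p (\<lambda>k l. expectation (\<lambda>\<omega>. design m i k \<omega> * design m i l \<omega>)) u"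
    using i by (intro quad_form_expectation[symmetric] integrable_design_product) auto
  also have "\<dots> = quad_form p gram u" unfolding quad_form_def using i by (intro sum.cong refl) (simp add: gram_row)
  finally show "expectation (\<lambda>\<omega>. (dual_pred u (xrow i \<omega>))\<^sup>2) = quad_form p gram u" .
qed

lemma dual_pred_sums:
  assumes n: "0 < n" "n \<le> N" and r: "r < p" and p: "2 \<le> p"
    and u: "\<And>k. k < p \<Longrightarrow> (\<Sum>l<p. gram k l * u l) = (if k = r then 1 else 0)" "quad_form p gram u \<le> L"
  shows "\<exists>G. integrable M G \<and> expectation G \<le> (1 + 2 * (K\<^sup>2 * L)) * sqrt (real n * (2 * ln (real p)))
     \<and> (AE \<omega> in M. 0 \<le> G \<omega> \<and> (\<forall>k\<in>{..<p} - {r}. \<bar>\<Sum>i<n. design m i k \<omega> * dual_pred u (xrow i \<omega>)\<bar> \<le> G \<omega>))"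
    "\<exists>G. integrable M G \<and> expectation G \<le> (1 + 2 * (K\<^sup>2 * L)) * sqrt (real n)
     \<and> (AE \<omega> in M. 0 \<le> G \<omega> \<and> \<bar>(\<Sum>i<n. design m i r \<omega> * dual_pred u (xrow i \<omega>)) - n\<bar> \<le> G \<omega>)"
proof -
  let ?z = "\<lambda>i \<omega>. dual_pred u (xrow i \<omega>)"
  have ind: "indep_vars (\<lambda>_. Row) xrow {..<n}" using indep_vars_subset[OF indep_rows] n by simp
  have iN: "i < N" if "i < n" for i using that n by simp
  have "0 \<le> quad_form p gram u"
    using dual_pred_moments(4)[OF N_pos r, of u] by (metis Bochner_Integration.integral_nonneg zero_le_power2)
  then have L0: "0 \<le> L" using u(2) by simp
  have E2: "expectation (\<lambda>\<omega>. (K * \<bar>?z i \<omega>\<bar>)\<^sup>2) \<le> K\<^sup>2 * L" if "i < n" for i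
    using dual_pred_moments(4)[OF iN[OF that] r, of u] u(2) by (simp add: power_mult_distrib mult_left_mono)
  have mono: "(1 + 2 * (K\<^sup>2 * L)) * sqrt a \<le> (1 + 2 * (K\<^sup>2 * L)) * sqrt b" if "a \<le> b" for a b
    using that L0 by (intro mult_left_mono) auto
  let ?I = "{..<p} - {r}"
  have I: "finite ?I" "?I \<noteq> {}"
  proof -
    have "(if r = 0 then 1 else 0) \<in> ?I" using p by auto
    then show "?I \<noteq> {}" by blast
  qed simp
  have "\<exists>G. integrable M G \<and> expectation G \<le> (1 + 2 * (K\<^sup>2 * L)) * sqrt (real n * ln (2 * real (card ?I)))
     \<and> (AE \<omega> in M. 0 \<le> G \<omega> \<and> (\<forall>k\<in>?I. \<bar>\<Sum>i<n. xrow i \<omega> k * ?z i \<omega>\<bar> \<le> G \<omega>))"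
  proof (rule max_indep_sum_bound[OF ind I n(1), where f = "\<lambda>i k v. v k * dual_pred u v" and \<rho> = "\<lambda>i v. K * \<bar>dual_pred u v\<bar>"])
    show "(\<lambda>v. v k * dual_pred u v) \<in> borel_measurable Row" if "k \<in> ?I" for k
      using that by (intro borel_measurable_times measurable_coord measurable_dual_pred) auto
    show "(\<lambda>v. K * \<bar>dual_pred u v\<bar>) \<in> borel_measurable Row"
      by (intro borel_measurable_times borel_measurable_const borel_measurable_abs measurable_dual_pred)
    show "AE \<omega> in M. \<forall>k\<in>?I. \<bar>xrow i \<omega> k * ?z i \<omega>\<bar> \<le> K * \<bar>?z i \<omega>\<bar>" if "i < n" for i
      using AE_bounded_row[OF iN[OF that]]
      by eventually_elim (auto simp: abs_mult xrow_entry intro!: mult_right_mono)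
    show "integrable M (\<lambda>\<omega>. (K * \<bar>?z i \<omega>\<bar>)\<^sup>2)" if "i < n" for i
      using dual_pred_moments(3)[OF iN[OF that] r, of u] by (simp add: power_mult_distrib)
    show "expectation (\<lambda>\<omega>. xrow i \<omega> k * ?z i \<omega>) = 0" if "i < n" "k \<in> ?I" for i k
      using dual_pred_moments(2)[OF iN[OF that(1)], of k u] u(1)[of k] that by (simp add: xrow_entry)
  qed (use E2 in auto)
  then obtain G where G: "integrable M G" "expectation G \<le> (1 + 2 * (K\<^sup>2 * L)) * sqrt (real n * ln (2 * real (card ?I)))"
     "AE \<omega> in M. 0 \<le> G \<omega> \<and> (\<forall>k\<in>?I. \<bar>\<Sum>i<n. xrow i \<omega> k * ?z i \<omega>\<bar> \<le> G \<omega>)" by blast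
  have "ln (2 * real (card ?I)) \<le> ln (2 * real p)"
    using I p r by (intro ln_mono) (auto simp: card_Diff_singleton)
  also have "\<dots> \<le> 2 * ln (real p)" by (rule ln_double_le[OF p])
  finally have "expectation G \<le> (1 + 2 * (K\<^sup>2 * L)) * sqrt (real n * (2 * ln (real p)))"
    using G(2) mono[of "real n * ln (2 * real (card ?I))" "real n * (2 * ln (real p))"]
    by (meson mult_left_mono of_nat_0_le_iff order_trans)
  moreover have "AE \<omega> in M. 0 \<le> G \<omega> \<and> (\<forall>k\<in>?I. \<bar>\<Sum>i<n. design m i k \<omega> * ?z i \<omega>\<bar> \<le> G \<omega>)"
    using G(3) by eventually_elim (auto simp: xrow_entry)
  ultimately show "\<exists>G. integrable M G \<and> expectation G \<le> (1 + 2 * (K\<^sup>2 * L)) * sqrt (real n * (2 * ln (real p)))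
     \<and> (AE \<omega> in M. 0 \<le> G \<omega> \<and> (\<forall>k\<in>?I. \<bar>\<Sum>i<n. design m i k \<omega> * ?z i \<omega>\<bar> \<le> G \<omega>))"
    using G(1) by blast
  define f where "f v = v r * dual_pred u v - 1" for v
  have fm: "f \<in> borel_measurable Row"
    unfolding f_def using r by (intro borel_measurable_diff borel_measurable_times measurable_coord measurable_dual_pred borel_measurable_const)
  have f2: "integrable M (\<lambda>\<omega>. (f (xrow i \<omega>))\<^sup>2) \<and> expectation (\<lambda>\<omega>. (f (xrow i \<omega>))\<^sup>2) \<le> K\<^sup>2 * L
      \<and> expectation (\<lambda>\<omega>. f (xrow i \<omega>)) = 0" if i: "i < n" for i
  proof -
    let ?h = "\<lambda>\<omega>. design m i r \<omega> * ?z i \<omega>"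
    have hi: "integrable M ?h" and hE: "expectation ?h = 1"
      using dual_pred_moments(1,2)[OF iN[OF i] r, of u] u(1)[OF r] by auto
    have le: "AE \<omega> in M. (?h \<omega>)\<^sup>2 \<le> (K * \<bar>?z i \<omega>\<bar>)\<^sup>2"
      using AE_bounded_row[OF iN[OF i]]
      by eventually_elim (use r K_pos in \<open>auto simp: abs_le_square_iff[symmetric] abs_mult intro!: mult_right_mono\<close>)
    have h2: "integrable M (\<lambda>\<omega>. (?h \<omega>)\<^sup>2)"
    proof (rule Bochner_Integration.integrable_bound)
      show "integrable M (\<lambda>\<omega>. (K * \<bar>?z i \<omega>\<bar>)\<^sup>2)"
        using dual_pred_moments(3)[OF iN[OF i] r, of u] by (simp add: power_mult_distrib)
      show "(\<lambda>\<omega>. (?h \<omega>)\<^sup>2) \<in> borel_measurable M" using hi by (intro borel_measurable_power) auto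
      show "AE \<omega> in M. norm ((?h \<omega>)\<^sup>2) \<le> norm ((K * \<bar>?z i \<omega>\<bar>)\<^sup>2)" using le by eventually_elim simp
    qed
    have "expectation (\<lambda>\<omega>. (?h \<omega>)\<^sup>2) \<le> expectation (\<lambda>\<omega>. (K * \<bar>?z i \<omega>\<bar>)\<^sup>2)"
      using le h2 dual_pred_moments(3)[OF iN[OF i] r, of u]
      by (intro integral_mono_AE) (auto simp: power_mult_distrib)
    then have h2E: "expectation (\<lambda>\<omega>. (?h \<omega>)\<^sup>2) \<le> K\<^sup>2 * L" using E2[OF i] by simp
    have fx: "f (xrow i \<omega>) = ?h \<omega> - 1" for \<omega> using r by (simp add: f_def xrow_entry)
    have fx2: "(f (xrow i \<omega>))\<^sup>2 = (?h \<omega>)\<^sup>2 - 2 * ?h \<omega> + 1" for \<omega>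
      unfolding fx by (simp add: power2_diff)
    have "integrable M (\<lambda>\<omega>. (f (xrow i \<omega>))\<^sup>2)"
      unfolding fx2 using h2 hi by (intro Bochner_Integration.integrable_add Bochner_Integration.integrable_diff
          Bochner_Integration.integrable_mult_right integrable_const) auto
    moreover have "expectation (\<lambda>\<omega>. (f (xrow i \<omega>))\<^sup>2) \<le> K\<^sup>2 * L"
      unfolding fx2 using h2 hi hE h2E by (simp add: prob_space)
    moreover have "expectation (\<lambda>\<omega>. f (xrow i \<omega>)) = 0"
      unfolding fx using hi hE by (simp add: prob_space)
    ultimately show ?thesis by blast
  qed
  have "\<exists>G. integrable M G \<and> expectation G \<le> (1 + 2 * (K\<^sup>2 * L)) * sqrt (real n * ln (2 * real (card {()})))
     \<and> (AE \<omega> in M. 0 \<le> G \<omega> \<and> (\<forall>k\<in>{()}. \<bar>\<Sum>i<n. f (xrow i \<omega>)\<bar> \<le> G \<omega>))"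
  proof (rule max_indep_sum_bound[OF ind _ _ n(1), where f = "\<lambda>i k v. f v" and \<rho> = "\<lambda>i v. \<bar>f v\<bar>"])
    show "(\<lambda>v. \<bar>f v\<bar>) \<in> borel_measurable Row" using fm by (rule borel_measurable_abs)
  qed (use f2 fm in auto)
  then obtain G where G: "integrable M G" "expectation G \<le> (1 + 2 * (K\<^sup>2 * L)) * sqrt (real n * ln 2)"
     "AE \<omega> in M. 0 \<le> G \<omega> \<and> \<bar>\<Sum>i<n. f (xrow i \<omega>)\<bar> \<le> G \<omega>" by auto
  have "expectation G \<le> (1 + 2 * (K\<^sup>2 * L)) * sqrt (real n)"
    using G(2) mono[of "real n * ln 2" "real n"] ln_2_le_1 by (simp add: mult_left_le)
  moreover have "AE \<omega> in M. 0 \<le> G \<omega> \<and> \<bar>(\<Sum>i<n. design m i r \<omega> * ?z i \<omega>) - n\<bar> \<le> G \<omega>"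
    using G(3) by eventually_elim (use r in \<open>simp add: f_def xrow_entry sum_subtractf\<close>)
  ultimately show "\<exists>G. integrable M G \<and> expectation G \<le> (1 + 2 * (K\<^sup>2 * L)) * sqrt (real n)
     \<and> (AE \<omega> in M. 0 \<le> G \<omega> \<and> \<bar>(\<Sum>i<n. design m i r \<omega> * ?z i \<omega>) - n\<bar> \<le> G \<omega>)"
    using G(1) by blast
qed

end

context node_stream
begin

text \<open>
  The shares of the batches in the inner product of covariate \<open>r\<close> with the residuals add up to at
  least a multiple of \<open>N\<close>, up to \<open>Gb\<close>.  For each batch, weak duality is applied to \<open>z / q\<close>, where \<open>z\<close>
  is a scaled population residual and \<open>q\<close> makes it feasible.  As \<open>q\<close> has bounded expectation and the
  reciprocal is convex, the weighted mean of \<open>1 / q\<close> over the batches is bounded below with high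
  probability.
\<close>
lemma response_score_lower_bound:
  assumes p: "2 \<le> p" and L: "0 < L" and coer: "\<And>v. (\<Sum>k<p. (v k)\<^sup>2) \<le> L * quad_form p gram v"
    and C: "1 \<le> C" and lam: "\<And>j. j \<in> {1..batches m} \<Longrightarrow> lam j = C * sqrt (ln (real p) / real (cum_size m j))"
  shows "\<exists>Ga Gb. integrable M Ga \<and> integrable M Gb \<and> expectation Ga \<le> 1 + 2 * (1 + 2 * (K\<^sup>2 * L)) + L
     \<and> expectation Gb \<le> 2 * (1 + 2 * (K\<^sup>2 * L)) * sqrt (real N)
     \<and> (AE \<omega> in M. 0 \<le> Ga \<omega> \<and> 0 \<le> Gb \<omega> \<and> (\<forall>T>0. Ga \<omega> \<le> T \<longrightarrow>
          real N / (2 * T) - Gb \<omega> \<le> (\<Sum>j = 1..batches m. real (batch_size m j) / real (cum_size m j)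
            * (\<Sum>t<cum_size m j. xrows \<omega> t r * nres j (xrows \<omega>) t))))"
proof -
  have sym: "\<forall>k<p. \<forall>l<p. gram k l = gram l k" by (simp add: gram_def mult.commute)
  obtain u where u: "\<And>k. k < p \<Longrightarrow> (\<Sum>l<p. gram k l * u l) = (if k = r then 1 else 0)" "quad_form p gram u \<le> L"
    using coercive_dual_vector[OF r sym L coer] by blast
  define z where "z i \<omega> = dual_pred u (xrow i \<omega>)" for i \<omega>
  define c where "c = 1 + 2 * (K\<^sup>2 * L)"
  have c: "1 \<le> c" unfolding c_def using L by simp
  let ?J = "{1..batches m}"
  let ?n = "cum_size m"
  have nN: "0 < ?n j" "?n j \<le> N" if "j \<in> ?J" for j using cum_size_pos[OF that] cum_size_le_N[of j] that by auto
  have ex1: "\<forall>j\<in>?J. \<exists>G. integrable M G \<and> expectation G \<le> c * sqrt (real (?n j) * (2 * ln (real p)))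
     \<and> (AE \<omega> in M. 0 \<le> G \<omega> \<and> (\<forall>k\<in>others. \<bar>\<Sum>i<?n j. design m i k \<omega> * z i \<omega>\<bar> \<le> G \<omega>))"
    unfolding z_def c_def using dual_pred_sums(1)[OF nN r p u] by blast
  obtain G where G0: "\<forall>j\<in>?J. integrable M (G j) \<and> expectation (G j) \<le> c * sqrt (real (?n j) * (2 * ln (real p)))
     \<and> (AE \<omega> in M. 0 \<le> G j \<omega> \<and> (\<forall>k\<in>others. \<bar>\<Sum>i<?n j. design m i k \<omega> * z i \<omega>\<bar> \<le> G j \<omega>))"
    using bchoice[OF ex1] by blast
  have G: "\<And>j. j \<in> ?J \<Longrightarrow> integrable M (G j)"
     "\<And>j. j \<in> ?J \<Longrightarrow> expectation (G j) \<le> c * sqrt (real (?n j) * (2 * ln (real p)))"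
     "\<And>j. j \<in> ?J \<Longrightarrow> AE \<omega> in M. 0 \<le> G j \<omega> \<and> (\<forall>k\<in>others. \<bar>\<Sum>i<?n j. design m i k \<omega> * z i \<omega>\<bar> \<le> G j \<omega>)"
    using G0 by blast+
  have ex2: "\<forall>j\<in>?J. \<exists>G. integrable M G \<and> expectation G \<le> c * sqrt (real (?n j))
     \<and> (AE \<omega> in M. 0 \<le> G \<omega> \<and> \<bar>(\<Sum>i<?n j. design m i r \<omega> * z i \<omega>) - ?n j\<bar> \<le> G \<omega>)"
    unfolding z_def c_def using dual_pred_sums(2)[OF nN r p u] by blast
  obtain H where H0: "\<forall>j\<in>?J. integrable M (H j) \<and> expectation (H j) \<le> c * sqrt (real (?n j))
     \<and> (AE \<omega> in M. 0 \<le> H j \<omega> \<and> \<bar>(\<Sum>i<?n j. design m i r \<omega> * z i \<omega>) - ?n j\<bar> \<le> H j \<omega>)"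
    using bchoice[OF ex2] by blast
  have H: "\<And>j. j \<in> ?J \<Longrightarrow> integrable M (H j)"
     "\<And>j. j \<in> ?J \<Longrightarrow> expectation (H j) \<le> c * sqrt (real (?n j))"
     "\<And>j. j \<in> ?J \<Longrightarrow> AE \<omega> in M. 0 \<le> H j \<omega> \<and> \<bar>(\<Sum>i<?n j. design m i r \<omega> * z i \<omega>) - ?n j\<bar> \<le> H j \<omega>"
    using H0 by blast+
  have lnp: "0 < ln (real p)" by (rule ln_double_le(2)[OF p])
  have lam_pos: "0 < ?n j * lam j" if j: "j \<in> ?J" for j using lam[OF j] nN[OF j] lnp C by simp
  define q where "q j \<omega> = 1 + G j \<omega> / (?n j * lam j) + (\<Sum>i<?n j. (z i \<omega>)\<^sup>2) / ?n j" for j \<omega>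
  have z2: "integrable M (\<lambda>\<omega>. (z i \<omega>)\<^sup>2)" "expectation (\<lambda>\<omega>. (z i \<omega>)\<^sup>2) \<le> L" if "i < N" for i
    unfolding z_def using dual_pred_moments(3,4)[OF that r, of u] u(2) by auto
  have q: "integrable M (q j)" "expectation (q j) \<le> 1 + 2 * c + L" if j: "j \<in> ?J" for j
  proof -
    have s: "integrable M (\<lambda>\<omega>. \<Sum>i<?n j. (z i \<omega>)\<^sup>2)"
      using z2 nN[OF j] by (intro Bochner_Integration.integrable_sum) auto
    have sE: "expectation (\<lambda>\<omega>. \<Sum>i<?n j. (z i \<omega>)\<^sup>2) \<le> (\<Sum>i<?n j. L)"
    proof -
      have "expectation (\<lambda>\<omega>. \<Sum>i<?n j. (z i \<omega>)\<^sup>2) = (\<Sum>i<?n j. expectation (\<lambda>\<omega>. (z i \<omega>)\<^sup>2))"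
        using z2 nN[OF j] by (intro Bochner_Integration.integral_sum) auto
      also have "\<dots> \<le> (\<Sum>i<?n j. L)" using z2 nN[OF j] by (intro sum_mono) auto
      finally show ?thesis .
    qed
    show "integrable M (q j)" unfolding q_def using s G(1)[OF j]
      by (intro Bochner_Integration.integrable_add integrable_const integrable_divide) auto
    have "expectation (q j) = 1 + expectation (G j) / (?n j * lam j) + expectation (\<lambda>\<omega>. \<Sum>i<?n j. (z i \<omega>)\<^sup>2) / ?n j"
      unfolding q_def using s G(1)[OF j] by (simp add: prob_space)
    also have "expectation (\<lambda>\<omega>. \<Sum>i<?n j. (z i \<omega>)\<^sup>2) / ?n j \<le> (\<Sum>i<?n j. L) / ?n j"
      by (rule divide_right_mono[OF sE]) simp
    also have "(\<Sum>i<?n j. L) / ?n j = L" using nN[OF j] by simp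
    also have "expectation (G j) / (?n j * lam j) \<le> c * sqrt (real (?n j) * (2 * ln (real p))) / (?n j * lam j)"
      using G(2)[OF j] lam_pos[OF j] by (intro divide_right_mono) auto
    also have "\<dots> \<le> 2 * c"
    proof -
      have "sqrt (real (?n j) * (2 * ln (real p))) = sqrt 2 * sqrt (real (?n j) * ln (real p))"
        by (simp flip: real_sqrt_mult add: mult_ac)
      also have "\<dots> \<le> 2 * sqrt (real (?n j) * ln (real p))"
        using lnp by (intro mult_right_mono) (auto intro: real_le_lsqrt)
      also have "sqrt (real (?n j) * ln (real p)) = ?n j * sqrt (ln (real p) / ?n j)"
      proof -
        have "?n j * sqrt (ln (real p) / ?n j) = sqrt ((real (?n j))\<^sup>2 * (ln (real p) / ?n j))"
          unfolding real_sqrt_mult by simp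
        also have "(real (?n j))\<^sup>2 * (ln (real p) / ?n j) = real (?n j) * ln (real p)"
          using nN[OF j] by (simp add: power2_eq_square)
        finally show ?thesis by simp
      qed
      also have "2 * (?n j * sqrt (ln (real p) / ?n j)) \<le> 2 * (?n j * lam j)"
      proof -
        have "1 * sqrt (ln (real p) / ?n j) \<le> lam j"
          unfolding lam[OF j] using C lnp by (intro mult_right_mono) auto
        then show ?thesis by (simp add: mult_left_mono)
      qed
      finally have "sqrt (real (?n j) * (2 * ln (real p))) \<le> 2 * (?n j * lam j)" .
      then have "c * sqrt (real (?n j) * (2 * ln (real p))) \<le> c * (2 * (?n j * lam j))"
        using c by (intro mult_left_mono) auto
      then show ?thesis using lam_pos[OF j] by (simp add: pos_divide_le_eq mult_ac)
    qed
    finally show "expectation (q j) \<le> 1 + 2 * c + L" by simp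
  qed
  define Ga where "Ga \<omega> = (\<Sum>j\<in>?J. real (batch_size m j) / real N * q j \<omega>)" for \<omega>
  define Gb where "Gb \<omega> = (\<Sum>j\<in>?J. real (batch_size m j) / real (?n j) * H j \<omega>)" for \<omega>
  have iGa: "integrable M Ga" unfolding Ga_def using q by (intro Bochner_Integration.integrable_sum Bochner_Integration.integrable_mult_right) auto
  have iGb: "integrable M Gb" unfolding Gb_def using H by (intro Bochner_Integration.integrable_sum Bochner_Integration.integrable_mult_right) auto
  have "expectation Ga = (\<Sum>j\<in>?J. real (batch_size m j) / real N * expectation (q j))"
    unfolding Ga_def using q by (subst Bochner_Integration.integral_sum) auto
  also have "\<dots> \<le> (\<Sum>j\<in>?J. real (batch_size m j) / real N * (1 + 2 * c + L))"
    using q by (intro sum_mono mult_left_mono) auto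
  also have "\<dots> = 1 + 2 * c + L"
    unfolding sum_distrib_right[symmetric] sum_divide_distrib[symmetric] sum_batch_size using N_pos by simp
  finally have EGa: "expectation Ga \<le> 1 + 2 * c + L" .
  have "expectation Gb = (\<Sum>j\<in>?J. real (batch_size m j) / real (?n j) * expectation (H j))"
    unfolding Gb_def using H by (subst Bochner_Integration.integral_sum) auto
  also have "\<dots> \<le> (\<Sum>j\<in>?J. real (batch_size m j) / real (?n j) * (c * sqrt (real (?n j))))"
    using H by (intro sum_mono mult_left_mono) auto
  also have "\<dots> = (\<Sum>j\<in>?J. c * (real (batch_size m j) / sqrt (real (?n j))))"
  proof (intro sum.cong refl)
    fix j assume "j \<in> ?J"
    then have "0 < real (?n j)" using nN by simp
    then show "real (batch_size m j) / real (?n j) * (c * sqrt (real (?n j))) = c * (real (batch_size m j) / sqrt (real (?n j)))"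
      by (simp add: field_simps flip: real_sqrt_mult)
  qed
  also have "\<dots> = c * (\<Sum>j\<in>?J. real (batch_size m j) / sqrt (real (?n j)))" by (simp add: sum_distrib_left)
  also have "\<dots> \<le> c * (2 * sqrt (real N))"
    using sum_batch_over_sqrt[of m "batches m"] c by (intro mult_left_mono) (auto simp: total_size_def)
  finally have EGb: "expectation Gb \<le> 2 * c * sqrt (real N)" by simp
  have AEG: "AE \<omega> in M. \<forall>j\<in>?J. 0 \<le> G j \<omega> \<and> (\<forall>k\<in>others. \<bar>\<Sum>i<?n j. design m i k \<omega> * z i \<omega>\<bar> \<le> G j \<omega>)"
    using G(3) by (intro AE_finite_allI) auto
  have AEH: "AE \<omega> in M. \<forall>j\<in>?J. 0 \<le> H j \<omega> \<and> \<bar>(\<Sum>i<?n j. design m i r \<omega> * z i \<omega>) - ?n j\<bar> \<le> H j \<omega>"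
    using H(3) by (intro AE_finite_allI) auto
  have main: "AE \<omega> in M. 0 \<le> Ga \<omega> \<and> 0 \<le> Gb \<omega> \<and> (\<forall>T>0. Ga \<omega> \<le> T \<longrightarrow>
          real N / (2 * T) - Gb \<omega> \<le> (\<Sum>j\<in>?J. real (batch_size m j) / real (?n j)
            * (\<Sum>t<?n j. xrows \<omega> t r * nres j (xrows \<omega>) t)))"
    using AEG AEH AE_space
  proof eventually_elim
    case (elim \<omega>)
    have q1: "1 \<le> q j \<omega>" if j: "j \<in> ?J" for j
      unfolding q_def using elim j lam_pos[OF j] by (simp add: sum_nonneg)
    have each: "?n j / (2 * q j \<omega>) - H j \<omega> \<le> (\<Sum>t<?n j. xrows \<omega> t r * nres j (xrows \<omega>) t)" if j: "j \<in> ?J" for j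
    proof -
      define a where "a = 1 / q j \<omega>"
      have a: "0 < a" "a \<le> 1" using q1[OF j] by (auto simp: a_def)
      have iN: "i < N" if "i < ?n j" for i using that nN[OF j] by simp
      have G0: "0 \<le> G j \<omega>" and H0: "0 \<le> H j \<omega>" using elim j by auto
      have aG: "a * G j \<omega> \<le> ?n j * lam j"
      proof -
        have "G j \<omega> / (?n j * lam j) \<le> q j \<omega>" unfolding q_def by (simp add: sum_nonneg)
        then show ?thesis using lam_pos[OF j] q1[OF j] by (simp add: a_def pos_divide_le_eq mult.commute)
      qed
      have aV: "a * (\<Sum>i<?n j. (z i \<omega>)\<^sup>2) \<le> ?n j"
      proof -
        have "(\<Sum>i<?n j. (z i \<omega>)\<^sup>2) / ?n j \<le> q j \<omega>" unfolding q_def using G0 lam_pos[OF j] by simp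
        then show ?thesis using nN[OF j] q1[OF j] by (simp add: a_def pos_divide_le_eq mult.commute)
      qed
      have xz: "(\<Sum>i<?n j. xrows \<omega> i k * z i \<omega>) = (\<Sum>i<?n j. design m i k \<omega> * z i \<omega>)" if "k < p" for k
        using that iN by (intro sum.cong refl) (simp add: xrows_entry)
      have "a * (\<Sum>i<?n j. z i \<omega> * xrows \<omega> i r)
        \<le> a\<^sup>2 * (\<Sum>i<?n j. (z i \<omega>)\<^sup>2) / 2 + (\<Sum>i<?n j. xrows \<omega> i r * nres j (xrows \<omega>) i)"
      proof (rule nres_dual[OF j])
        show "\<omega> \<in> space M" using elim by simp
        fix k assume k: "k \<in> others"
        have "\<bar>a * (\<Sum>i<?n j. xrows \<omega> i k * z i \<omega>)\<bar> = a * \<bar>\<Sum>i<?n j. design m i k \<omega> * z i \<omega>\<bar>"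
          using a k by (simp add: abs_mult xz)
        also have "\<dots> \<le> a * G j \<omega>" using elim j k a by (intro mult_left_mono) auto
        finally show "\<bar>a * (\<Sum>i<?n j. xrows \<omega> i k * z i \<omega>)\<bar> \<le> ?n j * lam j" using aG by simp
      qed
      moreover have "a\<^sup>2 * (\<Sum>i<?n j. (z i \<omega>)\<^sup>2) \<le> a * ?n j"
        using aV a by (simp add: power2_eq_square mult.assoc mult_left_mono)
      moreover have "a * ?n j - H j \<omega> \<le> a * (\<Sum>i<?n j. z i \<omega> * xrows \<omega> i r)"
      proof -
        have "?n j - H j \<omega> \<le> (\<Sum>i<?n j. design m i r \<omega> * z i \<omega>)" using elim j by force
        also have "\<dots> = (\<Sum>i<?n j. z i \<omega> * xrows \<omega> i r)" using xz[OF r] by (simp add: mult.commute)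
        finally have "a * (?n j - H j \<omega>) \<le> a * (\<Sum>i<?n j. z i \<omega> * xrows \<omega> i r)" using a by (intro mult_left_mono) auto
        moreover have "a * H j \<omega> \<le> 1 * H j \<omega>" using a H0 by (intro mult_right_mono) auto
        ultimately show ?thesis by (simp add: algebra_simps)
      qed
      ultimately have "a * ?n j / 2 - H j \<omega> \<le> (\<Sum>i<?n j. xrows \<omega> i r * nres j (xrows \<omega>) i)" by linarith
      then show ?thesis by (simp add: a_def)
    qed
    have "0 \<le> Ga \<omega>" unfolding Ga_def using q1 by (intro sum_nonneg mult_nonneg_nonneg) (auto intro: order_trans[OF zero_le_one])
    moreover have "0 \<le> Gb \<omega>" unfolding Gb_def using elim by (intro sum_nonneg mult_nonneg_nonneg) auto
    moreover have "real N / (2 * T) - Gb \<omega> \<le> (\<Sum>j\<in>?J. real (batch_size m j) / real (?n j)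
            * (\<Sum>t<?n j. xrows \<omega> t r * nres j (xrows \<omega>) t))" if T: "0 < T" "Ga \<omega> \<le> T" for T
    proof -
      \<comment> \<open>the tangent of the reciprocal at \<open>T\<close>\<close>
      have tangent: "1 / q j \<omega> \<ge> 2 / T - q j \<omega> / T\<^sup>2" if j: "j \<in> ?J" for j
      proof -
        have "0 \<le> (T - q j \<omega>)\<^sup>2 / (q j \<omega> * T\<^sup>2)" using q1[OF j] by (intro divide_nonneg_nonneg) auto
        also have "\<dots> = 1 / q j \<omega> - (2 / T - q j \<omega> / T\<^sup>2)"
          using q1[OF j] T by (simp add: power2_eq_square field_simps)
        finally show ?thesis by simp
      qed
      have "real N / T \<le> 2 * real N / T - real N * Ga \<omega> / T\<^sup>2"
      proof -
        have "real N * Ga \<omega> / T\<^sup>2 \<le> real N * T / T\<^sup>2" using T by (intro divide_right_mono mult_left_mono) auto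
        also have "\<dots> = real N / T" using T by (simp add: power2_eq_square)
        finally show ?thesis using T by (simp add: field_simps)
      qed
      also have "\<dots> = (\<Sum>j\<in>?J. real (batch_size m j) * (2 / T - q j \<omega> / T\<^sup>2))"
      proof -
        have "real N * Ga \<omega> = (\<Sum>j\<in>?J. real (batch_size m j) * q j \<omega>)"
          unfolding Ga_def sum_distrib_left using N_pos by (intro sum.cong refl) simp
        moreover have "(\<Sum>j\<in>?J. real (batch_size m j) * (2 / T - q j \<omega> / T\<^sup>2))
          = (\<Sum>j\<in>?J. real (batch_size m j)) * (2 / T) - (\<Sum>j\<in>?J. real (batch_size m j) * q j \<omega>) / T\<^sup>2"
          unfolding sum_distrib_right sum_divide_distrib sum_subtractf[symmetric]
          by (intro sum.cong refl) (simp add: right_diff_distrib)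
        ultimately show ?thesis unfolding sum_batch_size by simp
      qed
      also have "\<dots> \<le> (\<Sum>j\<in>?J. real (batch_size m j) * (1 / q j \<omega>))"
        using tangent by (intro sum_mono mult_left_mono) auto
      finally have s: "real N / T \<le> (\<Sum>j\<in>?J. real (batch_size m j) * (1 / q j \<omega>))" .
      have "real N / (2 * T) - Gb \<omega> \<le> (\<Sum>j\<in>?J. real (batch_size m j) * (1 / q j \<omega>)) / 2 - Gb \<omega>"
        using s T by simp
      also have "\<dots> = (\<Sum>j\<in>?J. real (batch_size m j) / real (?n j) * (?n j / (2 * q j \<omega>) - H j \<omega>))"
        unfolding Gb_def sum_divide_distrib sum_subtractf[symmetric]
      proof (intro sum.cong refl)
        fix j assume "j \<in> ?J"
        then have "0 < real (?n j)" using nN by simp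
        then show "real (batch_size m j) * (1 / q j \<omega>) / 2 - real (batch_size m j) / real (?n j) * H j \<omega>
           = real (batch_size m j) / real (?n j) * (?n j / (2 * q j \<omega>) - H j \<omega>)"
          by (simp add: right_diff_distrib)
      qed
      also have "\<dots> \<le> (\<Sum>j\<in>?J. real (batch_size m j) / real (?n j) * (\<Sum>t<?n j. xrows \<omega> t r * nres j (xrows \<omega>) t))"
        using each by (intro sum_mono mult_left_mono) auto
      finally show ?thesis .
    qed
    ultimately show ?case by blast
  qed
  show ?thesis
    using iGa iGb EGa EGb main unfolding c_def by blast
qed

end

section \<open>The score of the noise\<close>

context regression_stream
begin

text \<open>
  Given the design and the earlier errors, an error has mean zero.
\<close>
lemma noise_orthogonal:
  fixes \<phi> :: "(nat \<Rightarrow> nat \<Rightarrow> real) \<times> (nat \<Rightarrow> real) \<Rightarrow> real"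
  assumes t: "t < N" and \<phi>: "\<phi> \<in> borel_measurable (PiM {..<N} (\<lambda>_. Row) \<Otimes>\<^sub>M PiM {..<t} (\<lambda>_. borel))"
    and bnd: "\<And>\<rho>. \<exists>B. \<forall>e. \<bar>\<phi> (\<rho>, e)\<bar> \<le> B"
    and int: "integrable M (\<lambda>\<omega>. \<phi> (xrows \<omega>, \<lambda>s\<in>{..<t}. noise m s \<omega>) * noise m t \<omega>)"
  shows "expectation (\<lambda>\<omega>. \<phi> (xrows \<omega>, \<lambda>s\<in>{..<t}. noise m s \<omega>) * noise m t \<omega>) = 0"
proof -
  let ?X = "PiM {..<N} (\<lambda>_. Row)"
  let ?E = "PiM {..<N} (\<lambda>_. borel) :: (nat \<Rightarrow> real) measure"
  let ?ev = "\<lambda>\<omega>. \<lambda>i\<in>{..<N}. noise m i \<omega>"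
  let ?P1 = "distr M ?X xrows" and ?P2 = "distr M ?E ?ev"
  have evm: "?ev \<in> measurable M ?E" by (intro measurable_restrict measurable_noise) auto
  interpret P1: prob_space ?P1 by (rule prob_space_distr) (rule measurable_xrows)
  interpret P2: prob_space ?P2 by (rule prob_space_distr) (rule evm)
  interpret P: pair_sigma_finite ?P1 ?P2 ..
  define F where "F x = \<phi> (fst x, \<lambda>s\<in>{..<t}. snd x s) * snd x t" for x :: "(nat \<Rightarrow> nat \<Rightarrow> real) \<times> (nat \<Rightarrow> real)"
  have comp: "(\<lambda>x. snd x s) \<in> borel_measurable (?X \<Otimes>\<^sub>M ?E)" if "s < N" for s
    using that by (intro measurable_compose[OF measurable_snd measurable_component_singleton[of s "{..<N}"]]) auto
  have "(\<lambda>x. (fst x, \<lambda>s\<in>{..<t}. snd x s)) \<in> measurable (?X \<Otimes>\<^sub>M ?E) (?X \<Otimes>\<^sub>M PiM {..<t} (\<lambda>_. borel))"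
    using t by (intro measurable_Pair measurable_fst measurable_restrict comp) auto
  from measurable_compose[OF this \<phi>] have Fm: "F \<in> borel_measurable (?X \<Otimes>\<^sub>M ?E)"
    unfolding F_def by (intro borel_measurable_times comp t)
  have pm: "(\<lambda>\<omega>. (xrows \<omega>, ?ev \<omega>)) \<in> measurable M (?X \<Otimes>\<^sub>M ?E)"
    by (intro measurable_Pair measurable_xrows evm)
  have restr: "(\<lambda>s\<in>{..<t}. ?ev \<omega> s) = (\<lambda>s\<in>{..<t}. noise m s \<omega>)" for \<omega>
    using t by (auto simp: restrict_def)
  have FX: "F (xrows \<omega>, ?ev \<omega>) = \<phi> (xrows \<omega>, \<lambda>s\<in>{..<t}. noise m s \<omega>) * noise m t \<omega>" for \<omega>
    unfolding F_def fst_conv snd_conv restr using t by simp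
  have "integrable (distr M (?X \<Otimes>\<^sub>M ?E) (\<lambda>\<omega>. (xrows \<omega>, ?ev \<omega>))) F"
    by (subst integrable_distr_eq[OF pm Fm]) (simp only: FX int)
  then have Fi: "integrable (?P1 \<Otimes>\<^sub>M ?P2) F" unfolding distr_rows_noise .
  have "expectation (\<lambda>\<omega>. \<phi> (xrows \<omega>, \<lambda>s\<in>{..<t}. noise m s \<omega>) * noise m t \<omega>)
      = integral\<^sup>L (distr M (?X \<Otimes>\<^sub>M ?E) (\<lambda>\<omega>. (xrows \<omega>, ?ev \<omega>))) F"
    unfolding integral_distr[OF pm Fm] FX ..
  also have "\<dots> = integral\<^sup>L (?P1 \<Otimes>\<^sub>M ?P2) F" unfolding distr_rows_noise ..
  also have "\<dots> = (\<integral>\<rho>. (\<integral>e. F (\<rho>, e) \<partial>?P2) \<partial>?P1)" by (rule P.integral_fst'[OF Fi, symmetric])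
  also have "\<dots> = (\<integral>\<rho>. 0 \<partial>?P1)"
  proof (rule Bochner_Integration.integral_cong[OF refl])
    fix \<rho> assume "\<rho> \<in> space ?P1"
    then have \<rho>: "\<rho> \<in> space ?X" by simp
    have F\<rho>: "(\<lambda>e. F (\<rho>, e)) \<in> borel_measurable ?E" using Fm \<rho> by (rule measurable_compose_Pair1[rotated])
    have \<phi>\<rho>: "(\<lambda>e. \<phi> (\<rho>, e)) \<in> borel_measurable (PiM {..<t} (\<lambda>_. borel))"
      using \<phi> \<rho> by (rule measurable_compose_Pair1[rotated])
    obtain B where B: "\<And>e. \<bar>\<phi> (\<rho>, e)\<bar> \<le> B" using bnd[of \<rho>] by blast
    have pastm: "(\<lambda>\<omega>. \<lambda>s\<in>{..<t}. noise m s \<omega>) \<in> measurable M (PiM {..<t} (\<lambda>_. borel))"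
      using t by (intro measurable_restrict measurable_noise) auto
    have "(\<integral>e. F (\<rho>, e) \<partial>?P2) = expectation (\<lambda>\<omega>. F (\<rho>, ?ev \<omega>))" by (rule integral_distr[OF evm F\<rho>])
    also have "\<dots> = expectation (\<lambda>\<omega>. \<phi> (\<rho>, \<lambda>s\<in>{..<t}. noise m s \<omega>) * noise m t \<omega>)"
      unfolding F_def fst_conv snd_conv restr using t by simp
    also have "\<dots> = expectation (\<lambda>\<omega>. \<phi> (\<rho>, \<lambda>s\<in>{..<t}. noise m s \<omega>)) * expectation (\<lambda>\<omega>. noise m t \<omega>)"
    proof (rule indep_past_present[OF indep_noise t \<phi>\<rho>, where g = "\<lambda>x. x"])
      show "integrable M (\<lambda>\<omega>. \<phi> (\<rho>, \<lambda>s\<in>{..<t}. noise m s \<omega>))"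
        by (rule integrable_const_bound[where B = B]) (use B measurable_compose[OF pastm \<phi>\<rho>] in auto)
      show "integrable M (noise m t)"
        by (rule square_integrable_imp_integrable[OF measurable_noise[OF t] noise_moments(1)[OF t]])
    qed simp
    also have "\<dots> = 0" using noise_moments(2)[OF t] by simp
    finally show "(\<integral>e. F (\<rho>, e) \<partial>?P2) = 0" .
  qed
  finally show ?thesis by simp
qed

text \<open>
  The errors have only a second moment.  The constant in front of \<open>sqrt (N * ln p)\<close> is
  deterministic, and the fluctuation \<open>G\<close> is of the smaller order \<open>sqrt N\<close>.  The path-wise soft
  maximum inequality produces a scalar martingale and a sum of remainders of linear growth in the
  errors; each is within \<open>O(sqrt N)\<close> of its mean.
\<close>
lemma noise_max:
  assumes p: "2 \<le> p"
  shows "\<exists>G. integrable M G \<and> expectation G \<le> (2 + 10 * (K\<^sup>2 * \<sigma>\<^sup>2)) * sqrt (real N)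
     \<and> (AE \<omega> in M. 0 \<le> G \<omega> \<and> (\<forall>k<p. \<bar>\<Sum>i<N. design m i k \<omega> * noise m i \<omega>\<bar>
          \<le> (2 + 2 * (K\<^sup>2 * \<sigma>\<^sup>2)) * sqrt (real N * ln (real p)) + G \<omega>))"
proof -
  let ?I = "{..<p}"
  have I: "finite ?I" "?I \<noteq> {}" using p by (auto simp: lessThan_empty_iff)
  have lnp: "0 < ln (real p)" by (rule ln_double_le(2)[OF p])
  define \<theta> where "\<theta> = sqrt (ln (real p) / real N)"
  have \<theta>: "0 < \<theta>" unfolding \<theta>_def using lnp N_pos by simp
  have N\<theta>: "real N * \<theta> = sqrt (real N * ln (real p))"
  proof -
    have "real N * \<theta> = sqrt ((real N)\<^sup>2 * (ln (real p) / real N))" unfolding \<theta>_def real_sqrt_mult by simp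
    also have "(real N)\<^sup>2 * (ln (real p) / real N) = real N * ln (real p)" using N_pos by (simp add: power2_eq_square)
    finally show ?thesis .
  qed
  have ln\<theta>: "ln (real p) / \<theta> = sqrt (real N * ln (real p))"
  proof -
    have "\<theta>\<^sup>2 = ln (real p) / real N" unfolding \<theta>_def using lnp by simp
    then have "ln (real p) / \<theta> = real N * \<theta>" using \<theta> N_pos by (simp add: field_simps power2_eq_square)
    then show ?thesis by (simp add: N\<theta>)
  qed
  define V where "V t \<rho> e = (\<Sum>l<p. soft_weight \<theta> ?I (\<lambda>l. \<Sum>s<t. \<rho> s l * e s) l * \<rho> t l)"
    for t :: nat and \<rho> :: "nat \<Rightarrow> nat \<Rightarrow> real" and e :: "nat \<Rightarrow> real"
  define v where "v t \<omega> = V t (xrows \<omega>) (\<lambda>s. noise m s \<omega>)" for t \<omega>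
  define h where "h x = 2 / \<theta> * min ((\<theta> * (K * \<bar>x\<bar>))\<^sup>2) (\<theta> * (K * \<bar>x\<bar>))" for x :: real
  have Vcong: "V t \<rho> e = V t \<rho> e'" if "\<And>s. s < t \<Longrightarrow> e s = e' s" for t \<rho> e e'
  proof -
    have "(\<lambda>l. \<Sum>s<t. \<rho> s l * e s) = (\<lambda>l. \<Sum>s<t. \<rho> s l * e' s)" using that by (intro ext sum.cong) auto
    then show ?thesis by (simp add: V_def)
  qed
  have Vm: "(\<lambda>x. V s (a x) (b x)) \<in> borel_measurable Q"
    if a: "\<And>i l. i < N \<Longrightarrow> l < p \<Longrightarrow> (\<lambda>x. a x i l) \<in> borel_measurable Q"
      and b: "\<And>i. i < s \<Longrightarrow> (\<lambda>x. b x i) \<in> borel_measurable Q" and s: "s < N" for a b s and Q :: "'q measure"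
    unfolding V_def using s
    by (intro borel_measurable_sum borel_measurable_times borel_measurable_soft_weight a b) auto
  \<comment> \<open>the same on the space of pairs of a design and a vector of errors\<close>
  have Vm2: "(\<lambda>x. V s (a x) (b x)) \<in> borel_measurable Q"
    if a: "\<And>i l. i < N \<Longrightarrow> l < p \<Longrightarrow> (\<lambda>x. a x i l) \<in> borel_measurable Q"
      and b: "\<And>i. i < s \<Longrightarrow> (\<lambda>x. b x i) \<in> borel_measurable Q" and s: "s < N"
    for a b s and Q :: "((nat \<Rightarrow> nat \<Rightarrow> real) \<times> (nat \<Rightarrow> real)) measure"
    unfolding V_def using s
    by (intro borel_measurable_sum borel_measurable_times borel_measurable_soft_weight a b) auto
  have vm: "v t \<in> borel_measurable M" if "t < N" for t
    unfolding v_def using that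
    by (intro Vm measurable_compose[OF measurable_xrows measurable_entry] measurable_noise) auto
  have vK: "AE \<omega> in M. \<forall>t<N. \<bar>v t \<omega>\<bar> \<le> K"
    using AE_bounded
  proof eventually_elim
    case (elim \<omega>)
    show ?case unfolding v_def V_def using elim
      by (intro allI impI abs_soft_weight_sum_le[OF I]) (auto simp: xrows_entry)
  qed
  have inoise: "integrable M (noise m t)" if "t < N" for t
    by (rule square_integrable_imp_integrable[OF measurable_noise noise_moments(1)]) (use that in auto)
  have R2: "integrable M (\<lambda>\<omega>. (K * \<bar>noise m t \<omega>\<bar>)\<^sup>2)" "expectation (\<lambda>\<omega>. (K * \<bar>noise m t \<omega>\<bar>)\<^sup>2) = K\<^sup>2 * \<sigma>\<^sup>2"
    if "t < N" for t
    using noise_moments[OF that] by (auto simp: power_mult_distrib)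
  \<comment> \<open>the linear terms form a scalar martingale, as the weights depend only on the design and on earlier errors\<close>
  have "\<exists>G. integrable M G \<and> expectation G \<le> (1 + 2 * (K\<^sup>2 * \<sigma>\<^sup>2)) * sqrt (real N * ln (2 * real (card {()})))
     \<and> (AE \<omega> in M. 0 \<le> G \<omega> \<and> (\<forall>k\<in>{()}. \<bar>\<Sum>t<N. v t \<omega> * noise m t \<omega>\<bar> \<le> G \<omega>))"
  proof (rule max_martingale_sum_bound[where R = "\<lambda>t \<omega>. K * \<bar>noise m t \<omega>\<bar>"])
    show "(\<lambda>\<omega>. v t \<omega> * noise m t \<omega>) \<in> borel_measurable M" if "t < N" for t
      using that by (intro borel_measurable_times vm measurable_noise)
    show "(\<lambda>\<omega>. K * \<bar>noise m t \<omega>\<bar>) \<in> borel_measurable M" if "t < N" for t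
      using that by (intro borel_measurable_times borel_measurable_const borel_measurable_abs measurable_noise)
    show bd: "AE \<omega> in M. \<forall>k\<in>{()}. \<bar>v t \<omega> * noise m t \<omega>\<bar> \<le> K * \<bar>noise m t \<omega>\<bar>" if "t < N" for t
      using vK by eventually_elim (use that in \<open>auto simp: abs_mult intro!: mult_right_mono\<close>)
    fix \<theta>' :: real and t and k :: unit assume t: "t < N" and \<theta>': "0 < \<theta>'"
    define \<phi> where "\<phi> x = soft_weight \<theta>' {()} (\<lambda>_. \<Sum>s<t. V s (fst x) (snd x) * snd x s) () * V t (fst x) (snd x)"
      for x :: "(nat \<Rightarrow> nat \<Rightarrow> real) \<times> (nat \<Rightarrow> real)"
    let ?Q = "PiM {..<N} (\<lambda>_. Row) \<Otimes>\<^sub>M PiM {..<t} (\<lambda>_. borel) :: ((nat \<Rightarrow> nat \<Rightarrow> real) \<times> (nat \<Rightarrow> real)) measure"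
    have fm: "(\<lambda>x. fst x i l) \<in> borel_measurable ?Q" if "i < N" "l < p" for i l
      using measurable_compose[OF measurable_fst measurable_entry[OF that]] .
    have sm: "(\<lambda>x. snd x s) \<in> borel_measurable ?Q" if "s < t" for s
      using that by (intro measurable_compose[OF measurable_snd measurable_component_singleton[of s "{..<t}"]]) auto
    have \<phi>m: "\<phi> \<in> borel_measurable ?Q"
      unfolding \<phi>_def using t
      by (intro borel_measurable_times borel_measurable_soft_weight borel_measurable_sum Vm2 fm sm) auto
    have \<phi>b: "\<exists>B. \<forall>e. \<bar>\<phi> (\<rho>, e)\<bar> \<le> B" for \<rho>
    proof (intro exI allI)
      fix e
      have "\<bar>\<phi> (\<rho>, e)\<bar> \<le> 1 * (\<Sum>l<p. \<bar>\<rho> t l\<bar>)"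
        unfolding \<phi>_def abs_mult fst_conv snd_conv
      proof (intro mult_mono abs_soft_weight_le)
        show "\<bar>V t \<rho> e\<bar> \<le> (\<Sum>l<p. \<bar>\<rho> t l\<bar>)"
          unfolding V_def by (intro abs_soft_weight_sum_le[OF I] member_le_sum) auto
      qed auto
      then show "\<bar>\<phi> (\<rho>, e)\<bar> \<le> (\<Sum>l<p. \<bar>\<rho> t l\<bar>)" by simp
    qed
    have Vr: "V s (xrows \<omega>) (\<lambda>s\<in>{..<t}. noise m s \<omega>) = v s \<omega>" if "s \<le> t" for s \<omega>
      unfolding v_def using that by (intro Vcong) auto
    have \<phi>v: "\<phi> (xrows \<omega>, \<lambda>s\<in>{..<t}. noise m s \<omega>) * noise m t \<omega>
       = soft_weight \<theta>' {()} (\<lambda>_. \<Sum>s<t. v s \<omega> * noise m s \<omega>) () * (v t \<omega> * noise m t \<omega>)" for \<omega>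
    proof -
      have "(\<Sum>s<t. V s (xrows \<omega>) (\<lambda>s\<in>{..<t}. noise m s \<omega>) * (\<lambda>s\<in>{..<t}. noise m s \<omega>) s)
          = (\<Sum>s<t. v s \<omega> * noise m s \<omega>)"
        by (intro sum.cong refl) (simp add: Vr)
      then show ?thesis unfolding \<phi>_def fst_conv snd_conv by (simp add: Vr)
    qed
    have int: "integrable M (\<lambda>\<omega>. soft_weight \<theta>' {()} (\<lambda>_. \<Sum>s<t. v s \<omega> * noise m s \<omega>) () * (v t \<omega> * noise m t \<omega>))"
    proof (rule Bochner_Integration.integrable_bound)
      show "integrable M (\<lambda>\<omega>. K * noise m t \<omega>)" using inoise[OF t] by simp
      show "(\<lambda>\<omega>. soft_weight \<theta>' {()} (\<lambda>_. \<Sum>s<t. v s \<omega> * noise m s \<omega>) () * (v t \<omega> * noise m t \<omega>)) \<in> borel_measurable M"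
        using t by (intro borel_measurable_times borel_measurable_soft_weight borel_measurable_sum vm measurable_noise) auto
      show "AE \<omega> in M. norm (soft_weight \<theta>' {()} (\<lambda>_. \<Sum>s<t. v s \<omega> * noise m s \<omega>) () * (v t \<omega> * noise m t \<omega>))
          \<le> norm (K * noise m t \<omega>)"
        using bd[OF t]
      proof eventually_elim
        case (elim \<omega>)
        have "\<bar>soft_weight \<theta>' {()} (\<lambda>_. \<Sum>s<t. v s \<omega> * noise m s \<omega>) ()\<bar> * \<bar>v t \<omega> * noise m t \<omega>\<bar> \<le> 1 * (K * \<bar>noise m t \<omega>\<bar>)"
          using elim by (intro mult_mono abs_soft_weight_le) auto
        then show ?case using K_pos by (simp add: abs_mult)
      qed
    qed
    show "expectation (\<lambda>\<omega>. soft_weight \<theta>' {()} (\<lambda>l. \<Sum>s<t. v s \<omega> * noise m s \<omega>) k * (v t \<omega> * noise m t \<omega>)) = 0"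
      using noise_orthogonal[OF t \<phi>m \<phi>b] int unfolding \<phi>v by (cases k) simp
  qed (use R2 N_pos in auto)
  then obtain G1 where G1: "integrable M G1" "expectation G1 \<le> (1 + 2 * (K\<^sup>2 * \<sigma>\<^sup>2)) * sqrt (real N * ln 2)"
     "AE \<omega> in M. 0 \<le> G1 \<omega> \<and> \<bar>\<Sum>t<N. v t \<omega> * noise m t \<omega>\<bar> \<le> G1 \<omega>" by auto
  \<comment> \<open>the remainders are independent, with mean of order \<open>\<theta>\<close> and bounded second moment\<close>
  have hm: "h \<in> borel_measurable borel" unfolding h_def by measurable
  have h0: "0 \<le> h x" for x unfolding h_def using \<theta> K_pos by simp
  have h1: "h x \<le> 2 * (K * \<bar>x\<bar>)" for x
  proof -
    have "h x \<le> 2 / \<theta> * (\<theta> * (K * \<bar>x\<bar>))" unfolding h_def using \<theta> by (intro mult_left_mono) auto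
    then show ?thesis using \<theta> by simp
  qed
  have h2: "h x \<le> 2 * \<theta> * (K * \<bar>x\<bar>)\<^sup>2" for x
  proof -
    have "h x \<le> 2 / \<theta> * (\<theta> * (K * \<bar>x\<bar>))\<^sup>2" unfolding h_def using \<theta> by (intro mult_left_mono) auto
    then show ?thesis using \<theta> by (simp add: power2_eq_square mult_ac)
  qed
  define hb where "hb t = expectation (\<lambda>\<omega>. h (noise m t \<omega>))" for t
  have hi: "integrable M (\<lambda>\<omega>. h (noise m t \<omega>))" and hb: "hb t \<le> 2 * \<theta> * (K\<^sup>2 * \<sigma>\<^sup>2)"
    and h2i: "integrable M (\<lambda>\<omega>. (h (noise m t \<omega>))\<^sup>2)"
    and h2e: "expectation (\<lambda>\<omega>. (h (noise m t \<omega>))\<^sup>2) \<le> 4 * (K\<^sup>2 * \<sigma>\<^sup>2)" if t: "t < N" for t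
  proof -
    have hmM: "(\<lambda>\<omega>. h (noise m t \<omega>)) \<in> borel_measurable M" using measurable_compose[OF measurable_noise[OF t] hm] .
    show h2i: "integrable M (\<lambda>\<omega>. (h (noise m t \<omega>))\<^sup>2)"
    proof (rule Bochner_Integration.integrable_bound)
      show "integrable M (\<lambda>\<omega>. 4 * (K * \<bar>noise m t \<omega>\<bar>)\<^sup>2)" using R2(1)[OF t] by simp
      show "(\<lambda>\<omega>. (h (noise m t \<omega>))\<^sup>2) \<in> borel_measurable M" using hmM by (rule borel_measurable_power)
      have "(h x)\<^sup>2 \<le> (2 * (K * \<bar>x\<bar>))\<^sup>2" for x using h0[of x] h1[of x] by (intro power_mono) auto
      then show "AE \<omega> in M. norm ((h (noise m t \<omega>))\<^sup>2) \<le> norm (4 * (K * \<bar>noise m t \<omega>\<bar>)\<^sup>2)"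
        by (simp add: power_mult_distrib)
    qed
    show hi: "integrable M (\<lambda>\<omega>. h (noise m t \<omega>))" by (rule square_integrable_imp_integrable[OF hmM h2i])
    have "hb t \<le> expectation (\<lambda>\<omega>. 2 * \<theta> * (K * \<bar>noise m t \<omega>\<bar>)\<^sup>2)"
      unfolding hb_def using R2(1)[OF t] hi h2 by (intro integral_mono) auto
    then show "hb t \<le> 2 * \<theta> * (K\<^sup>2 * \<sigma>\<^sup>2)" using R2(2)[OF t] by simp
    have "expectation (\<lambda>\<omega>. (h (noise m t \<omega>))\<^sup>2) \<le> expectation (\<lambda>\<omega>. 4 * (K * \<bar>noise m t \<omega>\<bar>)\<^sup>2)"
    proof (rule integral_mono[OF h2i])
      show "integrable M (\<lambda>\<omega>. 4 * (K * \<bar>noise m t \<omega>\<bar>)\<^sup>2)" using R2(1)[OF t] by simp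
      fix \<omega>
      have "(h (noise m t \<omega>))\<^sup>2 \<le> (2 * (K * \<bar>noise m t \<omega>\<bar>))\<^sup>2" using h0 h1 by (intro power_mono) auto
      then show "(h (noise m t \<omega>))\<^sup>2 \<le> 4 * (K * \<bar>noise m t \<omega>\<bar>)\<^sup>2" by (simp add: power_mult_distrib)
    qed
    then show "expectation (\<lambda>\<omega>. (h (noise m t \<omega>))\<^sup>2) \<le> 4 * (K\<^sup>2 * \<sigma>\<^sup>2)" using R2(2)[OF t] by simp
  qed
  have "\<exists>G. integrable M G \<and> expectation G \<le> (1 + 2 * (4 * (K\<^sup>2 * \<sigma>\<^sup>2))) * sqrt (real N * ln (2 * real (card {()})))
     \<and> (AE \<omega> in M. 0 \<le> G \<omega> \<and> (\<forall>k\<in>{()}. \<bar>\<Sum>t<N. h (noise m t \<omega>) - hb t\<bar> \<le> G \<omega>))"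
  proof (rule max_indep_sum_bound[OF indep_noise _ _ N_pos, where f = "\<lambda>t k x. h x - hb t" and \<rho> = "\<lambda>t x. \<bar>h x - hb t\<bar>"])
    show "(\<lambda>x. h x - hb t) \<in> borel_measurable borel" for t using hm by measurable
    show "(\<lambda>x. \<bar>h x - hb t\<bar>) \<in> borel_measurable borel" for t using hm by measurable
    have sq: "\<bar>h x - hb t\<bar>\<^sup>2 = (h x)\<^sup>2 - 2 * hb t * h x + (hb t)\<^sup>2" for x t by (simp add: power2_diff)
    show "integrable M (\<lambda>\<omega>. \<bar>h (noise m t \<omega>) - hb t\<bar>\<^sup>2)" if "t < N" for t
      unfolding sq using hi[OF that] h2i[OF that]
      by (intro Bochner_Integration.integrable_add Bochner_Integration.integrable_diff
          Bochner_Integration.integrable_mult_right integrable_const)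
    show "expectation (\<lambda>\<omega>. \<bar>h (noise m t \<omega>) - hb t\<bar>\<^sup>2) \<le> 4 * (K\<^sup>2 * \<sigma>\<^sup>2)" if "t < N" for t
    proof -
      have "expectation (\<lambda>\<omega>. \<bar>h (noise m t \<omega>) - hb t\<bar>\<^sup>2)
          = expectation (\<lambda>\<omega>. (h (noise m t \<omega>))\<^sup>2) - 2 * hb t * hb t + (hb t)\<^sup>2"
        unfolding sq using hi[OF that] h2i[OF that] by (simp add: prob_space hb_def)
      also have "\<dots> \<le> expectation (\<lambda>\<omega>. (h (noise m t \<omega>))\<^sup>2)" by (simp add: power2_eq_square)
      finally show ?thesis using h2e[OF that] by simp
    qed
    show "expectation (\<lambda>\<omega>. h (noise m t \<omega>) - hb t) = 0" if "t < N" for t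
      using hi[OF that] by (simp add: prob_space hb_def)
  qed auto
  then obtain G2 where G2: "integrable M G2" "expectation G2 \<le> (1 + 2 * (4 * (K\<^sup>2 * \<sigma>\<^sup>2))) * sqrt (real N * ln 2)"
     "AE \<omega> in M. 0 \<le> G2 \<omega> \<and> \<bar>\<Sum>t<N. h (noise m t \<omega>) - hb t\<bar> \<le> G2 \<omega>" by auto
  define G where "G \<omega> = G1 \<omega> + G2 \<omega>" for \<omega>
  have ks: "0 \<le> K\<^sup>2 * \<sigma>\<^sup>2" by simp
  have "expectation G = expectation G1 + expectation G2" unfolding G_def using G1 G2 by simp
  also have "\<dots> \<le> (2 + 10 * (K\<^sup>2 * \<sigma>\<^sup>2)) * sqrt (real N * ln 2)" using G1(2) G2(2) by (simp add: algebra_simps)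
  also have "\<dots> \<le> (2 + 10 * (K\<^sup>2 * \<sigma>\<^sup>2)) * sqrt (real N)"
    using ks ln_2_le_1 by (intro mult_left_mono) (auto simp: mult_left_le)
  finally have EG: "expectation G \<le> (2 + 10 * (K\<^sup>2 * \<sigma>\<^sup>2)) * sqrt (real N)" .
  have "AE \<omega> in M. 0 \<le> G \<omega> \<and> (\<forall>k<p. \<bar>\<Sum>i<N. design m i k \<omega> * noise m i \<omega>\<bar>
          \<le> (2 + 2 * (K\<^sup>2 * \<sigma>\<^sup>2)) * sqrt (real N * ln (real p)) + G \<omega>)"
    using G1(3) G2(3) AE_bounded
  proof eventually_elim
    case (elim \<omega>)
    have "\<bar>\<Sum>i<N. design m i k \<omega> * noise m i \<omega>\<bar>
          \<le> (2 + 2 * (K\<^sup>2 * \<sigma>\<^sup>2)) * sqrt (real N * ln (real p)) + G \<omega>" if k: "k < p" for k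
    proof -
      have "\<bar>\<Sum>t<N. xrows \<omega> t k * noise m t \<omega>\<bar> \<le> ln (2 * real (card ?I)) / \<theta>
         + (\<Sum>t<N. \<Sum>l\<in>?I. soft_weight \<theta> ?I (\<lambda>l. \<Sum>s<t. xrows \<omega> s l * noise m s \<omega>) l * (xrows \<omega> t l * noise m t \<omega>))
         + (\<Sum>t<N. 2 / \<theta> * min ((\<theta> * (K * \<bar>noise m t \<omega>\<bar>))\<^sup>2) (\<theta> * (K * \<bar>noise m t \<omega>\<bar>)))"
        using k elim
        by (intro abs_sum_le_soft_max_path[OF I(1) _ \<theta>]) (auto simp: abs_mult xrows_entry intro!: mult_right_mono)
      also have "(\<Sum>t<N. \<Sum>l\<in>?I. soft_weight \<theta> ?I (\<lambda>l. \<Sum>s<t. xrows \<omega> s l * noise m s \<omega>) l * (xrows \<omega> t l * noise m t \<omega>))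
         = (\<Sum>t<N. v t \<omega> * noise m t \<omega>)"
        unfolding v_def V_def by (simp add: sum_distrib_right mult.assoc)
      also have "\<dots> \<le> G1 \<omega>" using elim by (blast intro: order_trans[OF abs_ge_self])
      also have "(\<Sum>t<N. 2 / \<theta> * min ((\<theta> * (K * \<bar>noise m t \<omega>\<bar>))\<^sup>2) (\<theta> * (K * \<bar>noise m t \<omega>\<bar>)))
         = (\<Sum>t<N. h (noise m t \<omega>) - hb t) + (\<Sum>t<N. hb t)"
        unfolding sum.distrib[symmetric] h_def by simp
      also have "(\<Sum>t<N. h (noise m t \<omega>) - hb t) \<le> G2 \<omega>" using elim by (blast intro: order_trans[OF abs_ge_self])
      also have "(\<Sum>t<N. hb t) \<le> (\<Sum>t<N. 2 * \<theta> * (K\<^sup>2 * \<sigma>\<^sup>2))" using hb by (intro sum_mono) auto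
      also have "\<dots> = 2 * (K\<^sup>2 * \<sigma>\<^sup>2) * (real N * \<theta>)" by simp
      also have "ln (2 * real (card ?I)) / \<theta> \<le> 2 * ln (real p) / \<theta>"
        using ln_double_le(1)[OF p] \<theta> by (intro divide_right_mono) auto
      also have "2 * ln (real p) / \<theta> = 2 * sqrt (real N * ln (real p))" using ln\<theta> by simp
      finally have "\<bar>\<Sum>t<N. xrows \<omega> t k * noise m t \<omega>\<bar> \<le> 2 * sqrt (real N * ln (real p)) + G1 \<omega>
         + (G2 \<omega> + 2 * (K\<^sup>2 * \<sigma>\<^sup>2) * (real N * \<theta>))" by simp
      also have "(\<Sum>t<N. xrows \<omega> t k * noise m t \<omega>) = (\<Sum>t<N. design m t k \<omega> * noise m t \<omega>)"
        using k by (intro sum.cong refl) (simp add: xrows_entry)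
      finally show ?thesis unfolding N\<theta> G_def by (simp add: algebra_simps)
    qed
    then show ?case using elim by (simp add: G_def)
  qed
  moreover have "integrable M G" unfolding G_def using G1 G2 by simp
  ultimately show ?thesis using EG by blast
qed

end

section \<open>The remainder of the debiased lasso\<close>

lemma half_le_sqrt_ln:
  assumes "2 \<le> (p::nat)"
  shows "1 / 2 \<le> sqrt (ln (real p))"
proof -
  have "exp (1 / 4) \<le> (2::real)" using exp_bound[of "1 / 4"] by (simp add: power2_eq_square)
  then have "1 / 4 \<le> ln (2::real)" by (rule iffD2[OF ln_ge_iff, rotated]) simp
  also have "\<dots> \<le> ln (real p)" using assms by (intro ln_mono) auto
  finally have "sqrt (1 / 4) \<le> sqrt (ln (real p))" by (rule real_sqrt_le_mono)
  then show ?thesis by (simp add: real_sqrt_divide)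
qed

lemma (in prob_space) Markov_bound:
  assumes "integrable M G" "AE \<omega> in M. 0 \<le> G \<omega>" "expectation G \<le> e" "0 < a"
  shows "prob {\<omega>\<in>space M. a < G \<omega>} \<le> e / a"
proof -
  have [measurable]: "G \<in> borel_measurable M" using assms(1) by simp
  have "prob {\<omega>\<in>space M. a < G \<omega>} \<le> prob {\<omega>\<in>space M. a \<le> G \<omega>}"
    by (intro finite_measure_mono) auto
  also have "\<dots> \<le> expectation G / a"
    by (rule integral_Markov_inequality_measure[OF assms(1) sets.empty_sets assms(2) assms(4), simplified])
  also have "\<dots> \<le> e / a" using assms by (intro divide_right_mono) auto
  finally show ?thesis .
qed

lemma (in prob_space) prob_Un_le: "A \<in> events \<Longrightarrow> B \<in> events \<Longrightarrow> prob A \<le> a \<Longrightarrow> prob B \<le> b \<Longrightarrow> prob (A \<union> B) \<le> a + b"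
  using measure_Un_le[of A M B] by linarith

text \<open>
  The remainder \<open>\<Delta>\<close> of the expansion.
\<close>
definition debias_error ::
    "'w stream_data \<Rightarrow> nat \<Rightarrow> ('w \<Rightarrow> nat \<Rightarrow> real) \<Rightarrow> (nat \<Rightarrow> 'w \<Rightarrow> nat \<Rightarrow> real) \<Rightarrow> 'w \<Rightarrow> real" where
  "debias_error m r bh gh \<omega> = (odl m r bh gh \<omega> - beta0 m r) / tau_hat m r gh \<omega> - W_stat m r gh \<omega>"

lemma zhat_prod_cong:
  assumes "\<And>i. i < total_size m \<Longrightarrow> f i \<omega> = g i \<omega>"
  shows "zhat_prod m r gh f \<omega> = zhat_prod m r gh g \<omega>"
  unfolding zhat_prod_def
proof (intro sum.cong refl)
  fix j i assume j: "j \<in> {1..batches m}" and i: "i \<in> batch_rows m j"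
  have "cum_size m j \<le> total_size m" unfolding total_size_def using j by (intro cum_size_mono) auto
  then have "i < total_size m" using i by (simp add: batch_rows_def)
  then show "node_resid m r (gh j \<omega>) i \<omega> * f i \<omega> = node_resid m r (gh j \<omega>) i \<omega> * g i \<omega>" using assms by simp
qed

lemma zhat_prod_add:
  "zhat_prod m r gh (\<lambda>i \<omega>. f i \<omega> + g i \<omega>) \<omega> = zhat_prod m r gh f \<omega> + zhat_prod m r gh g \<omega>"
  unfolding zhat_prod_def sum.distrib[symmetric] by (simp add: distrib_left)

lemma zhat_prod_lin_pred:
  "zhat_prod m r gh (\<lambda>i \<omega>. lin_pred m (b \<omega>) i \<omega>) \<omega>
    = (\<Sum>k<covariates m. zhat_prod m r gh (\<lambda>i. design m i k) \<omega> * b \<omega> k)"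
proof -
  have "zhat_prod m r gh (\<lambda>i \<omega>. lin_pred m (b \<omega>) i \<omega>) \<omega>
    = (\<Sum>j = 1..batches m. \<Sum>i\<in>batch_rows m j. \<Sum>k<covariates m. node_resid m r (gh j \<omega>) i \<omega> * design m i k \<omega> * b \<omega> k)"
    unfolding zhat_prod_def lin_pred_def by (simp add: sum_distrib_left mult.assoc)
  also have "\<dots> = (\<Sum>j = 1..batches m. \<Sum>k<covariates m. \<Sum>i\<in>batch_rows m j. node_resid m r (gh j \<omega>) i \<omega> * design m i k \<omega> * b \<omega> k)"
    by (intro sum.cong refl sum.swap)
  also have "\<dots> = (\<Sum>k<covariates m. \<Sum>j = 1..batches m. \<Sum>i\<in>batch_rows m j. node_resid m r (gh j \<omega>) i \<omega> * design m i k \<omega> * b \<omega> k)"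
    by (rule sum.swap)
  finally show ?thesis unfolding zhat_prod_def by (simp add: sum_distrib_right)
qed

lemma zhat_prod_lin_pred_fixed:
  "zhat_prod m r gh (lin_pred m b) \<omega> = (\<Sum>k<covariates m. zhat_prod m r gh (\<lambda>i. design m i k) \<omega> * b k)"
  using zhat_prod_lin_pred[of m r gh "\<lambda>_. b" \<omega>] by simp

lemma debias_error_eq:
  assumes r: "r < covariates m" and Q: "zhat_prod m r gh (\<lambda>i. design m i r) \<omega> \<noteq> 0"
  shows "debias_error m r bh gh \<omega> = - (\<Sum>k\<in>{..<covariates m} - {r}.
     zhat_prod m r gh (\<lambda>i. design m i k) \<omega> * (bh \<omega> k - beta0 m k)) / zhat_norm m r gh \<omega>"
proof -
  define U where "U k = zhat_prod m r gh (\<lambda>i. design m i k) \<omega>" for k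
  define E where "E = zhat_prod m r gh (noise m) \<omega>"
  define n where "n = zhat_norm m r gh \<omega>"
  define B where "B = (\<Sum>k\<in>{..<covariates m} - {r}. U k * (bh \<omega> k - beta0 m k))"
  have resp: "zhat_prod m r gh (response m) \<omega> = (\<Sum>k<covariates m. U k * beta0 m k) + E"
  proof -
    have "response m = (\<lambda>i \<omega>. lin_pred m (beta0 m) i \<omega> + noise m i \<omega>)" by (intro ext) (simp add: response_def)
    then show ?thesis using zhat_prod_lin_pred_fixed[of m r gh "beta0 m" \<omega>]
      by (simp add: zhat_prod_add U_def E_def)
  qed
  have "(\<Sum>k<covariates m. U k * beta0 m k) - (\<Sum>k<covariates m. U k * bh \<omega> k)
      = - (\<Sum>k<covariates m. U k * (bh \<omega> k - beta0 m k))"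
    by (simp add: right_diff_distrib sum_subtractf)
  also have "(\<Sum>k<covariates m. U k * (bh \<omega> k - beta0 m k)) = U r * (bh \<omega> r - beta0 m r) + B"
    unfolding B_def using r by (subst sum.remove[of _ r]) auto
  finally have "zhat_prod m r gh (response m) \<omega> - zhat_prod m r gh (lin_pred m (bh \<omega>)) \<omega>
      = E - U r * (bh \<omega> r - beta0 m r) - B"
    unfolding resp zhat_prod_lin_pred_fixed U_def[symmetric] by simp
  then have "odl m r bh gh \<omega> - beta0 m r = (E - B) / U r"
    unfolding odl_def using Q by (simp add: U_def[symmetric] field_simps)
  then have "(odl m r bh gh \<omega> - beta0 m r) / tau_hat m r gh \<omega> = (E - B) / n"
    unfolding tau_hat_def n_def[symmetric] using Q by (cases "n = 0") (simp_all add: U_def[symmetric])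
  then show ?thesis
    unfolding debias_error_def W_stat_def by (simp add: E_def B_def U_def n_def diff_divide_distrib)
qed

text \<open>
  With a single covariate the residuals are the covariate itself.  If all of them vanish, both
  the estimation error over \<open>tau_hat\<close> and \<open>W_stat\<close> are quotients by zero, hence zero.
\<close>
lemma debias_error_single_covariate:
  assumes "covariates m = 1" "r < covariates m"
  shows "debias_error m r bh gh \<omega> = 0"
proof (cases "zhat_prod m r gh (\<lambda>i. design m i r) \<omega> = 0")
  case False
  have none: "{..<covariates m} - {r} = {}" using assms by auto
  show ?thesis using debias_error_eq[OF assms(2) False, of bh] unfolding none by simp
next
  case True
  have none: "{..<covariates m} - {r} = {}" using assms by auto
  have nr: "node_resid m r \<gamma> i \<omega> = design m i r \<omega>" for \<gamma> i
    unfolding node_resid_def lin_pred_without_def none by simp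
  have "(zhat_norm m r gh \<omega>)\<^sup>2 = zhat_prod m r gh (\<lambda>i. design m i r) \<omega>"
    unfolding zhat_norm_def zhat_prod_def nr by (simp add: power2_eq_square sum_nonneg)
  then have "zhat_norm m r gh \<omega> = 0" using True by simp
  then show ?thesis by (simp add: debias_error_def tau_hat_def W_stat_def)
qed

context node_stream
begin

lemma zhat_prod_nres:
  assumes \<omega>: "\<omega> \<in> space M"
  shows "zhat_prod m r gh f \<omega> = (\<Sum>j = 1..batches m. \<Sum>t\<in>batch_rows m j. nres j (xrows \<omega>) t * f t \<omega>)"
  unfolding zhat_prod_def
  by (intro sum.cong refl) (auto simp: batch_rows_def nres_eq_node_resid[OF _ \<omega>])

lemma zhat_prod_design:
  assumes \<omega>: "\<omega> \<in> space M" and k: "k < p"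
  shows "zhat_prod m r gh (\<lambda>i. design m i k) \<omega>
    = (\<Sum>j = 1..batches m. real (batch_size m j) / real (cum_size m j) * (\<Sum>t<cum_size m j. xrows \<omega> t k * nres j (xrows \<omega>) t))
      + (\<Sum>t<N. innov (xrows \<omega>) t k)"
proof -
  have "zhat_prod m r gh (\<lambda>i. design m i k) \<omega> = zhat_prod m r gh (\<lambda>i \<omega>. xrows \<omega> i k) \<omega>"
    using k by (intro zhat_prod_cong) (simp add: xrows_entry)
  also have "\<dots> = (\<Sum>j = 1..batches m. \<Sum>t\<in>batch_rows m j. xrows \<omega> t k * nres j (xrows \<omega>) t)"
    unfolding zhat_prod_nres[OF \<omega>] by (simp add: mult.commute)
  finally show ?thesis unfolding total_score .
qed

lemma zhat_prod_le_norm: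
  "AE \<omega> in M. zhat_prod m r gh (\<lambda>i. design m i r) \<omega> \<le> K * sqrt (real N) * zhat_norm m r gh \<omega>"
  using AE_bounded
proof eventually_elim
  case (elim \<omega>)
  define e where "e t = node_resid m r (gh (batch_of t) \<omega>) t \<omega>" for t
  have Q: "zhat_prod m r gh (\<lambda>i. design m i r) \<omega> = (\<Sum>t<N. e t * design m t r \<omega>)"
    unfolding zhat_prod_def e_def by (rule sum_batches_flat)
  have n: "zhat_norm m r gh \<omega> = L2_set e {..<N}"
    unfolding zhat_norm_def L2_set_def e_def
    by (rule arg_cong[where f = sqrt]) (rule sum_batches_flat[of "\<lambda>j t. (node_resid m r (gh j \<omega>) t \<omega>)\<^sup>2"])
  have "(\<Sum>t<N. e t * design m t r \<omega>) \<le> (\<Sum>t<N. \<bar>e t\<bar> * \<bar>design m t r \<omega>\<bar>)"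
    by (intro sum_mono) (simp flip: abs_mult)
  also have "\<dots> \<le> L2_set e {..<N} * L2_set (\<lambda>t. design m t r \<omega>) {..<N}" by (rule L2_set_mult_ineq)
  also have "\<dots> \<le> L2_set e {..<N} * (K * sqrt (real N))"
  proof (intro mult_left_mono)
    have "(\<Sum>t<N. (design m t r \<omega>)\<^sup>2) \<le> (\<Sum>t<N. K\<^sup>2)"
    proof (rule sum_mono)
      fix t assume "t \<in> {..<N}"
      then have "\<bar>design m t r \<omega>\<bar> \<le> \<bar>K\<bar>" using elim r K_pos by simp
      then show "(design m t r \<omega>)\<^sup>2 \<le> K\<^sup>2" by (rule abs_le_square_iff[THEN iffD1])
    qed
    then have "L2_set (\<lambda>t. design m t r \<omega>) {..<N} \<le> sqrt (real N * K\<^sup>2)" unfolding L2_set_def by simp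
    also have "\<dots> = K * sqrt (real N)" using K_pos by (simp add: real_sqrt_mult mult.commute)
    finally show "L2_set (\<lambda>t. design m t r \<omega>) {..<N} \<le> K * sqrt (real N)" .
  qed (simp add: L2_set_nonneg)
  finally show ?case unfolding Q n by (simp add: mult_ac)
qed

lemma measurable_debias_error:
  assumes bh: "is_online_lasso m lam bh"
  shows "debias_error m r bh gh \<in> borel_measurable M"
proof -
  have ghm: "(\<lambda>\<omega>. gh j \<omega> k) \<in> borel_measurable M" if "j \<in> {1..batches m}" "k \<in> others" for j k
    using node_lasso that unfolding is_node_lasso_def by blast
  have bhm: "(\<lambda>\<omega>. bh \<omega> k) \<in> borel_measurable M" if "k < p" for k
    using bh that unfolding is_online_lasso_def by blast
  have iN: "i < N" if "j \<in> {1..batches m}" "i \<in> batch_rows m j" for i j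
    using that cum_size_le_N[of j] by (auto simp: batch_rows_def)
  have nr: "(\<lambda>\<omega>. node_resid m r (gh j \<omega>) i \<omega>) \<in> borel_measurable M" if "j \<in> {1..batches m}" "i \<in> batch_rows m j" for i j
    unfolding node_resid_def lin_pred_without_def using that iN[OF that] r
    by (intro borel_measurable_diff borel_measurable_sum borel_measurable_times measurable_design ghm) auto
  have zp: "(\<lambda>\<omega>. zhat_prod m r gh f \<omega>) \<in> borel_measurable M" if "\<And>i. i < N \<Longrightarrow> f i \<in> borel_measurable M" for f
    unfolding zhat_prod_def by (intro borel_measurable_sum borel_measurable_times nr that iN) auto
  have zn: "(\<lambda>\<omega>. zhat_norm m r gh \<omega>) \<in> borel_measurable M"
  proof -
    have "(\<lambda>\<omega>. \<Sum>j = 1..batches m. \<Sum>i\<in>batch_rows m j. (node_resid m r (gh j \<omega>) i \<omega>)\<^sup>2) \<in> borel_measurable M"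
      by (intro borel_measurable_sum borel_measurable_power nr)
    then show ?thesis unfolding zhat_norm_def by measurable
  qed
  have respm: "response m i \<in> borel_measurable M" if "i < N" for i
  proof -
    have "(\<lambda>\<omega>. response m i \<omega>) \<in> borel_measurable M"
      unfolding response_def lin_pred_def using that
      by (intro borel_measurable_add borel_measurable_sum borel_measurable_times measurable_design measurable_noise) auto
    then show ?thesis .
  qed
  have zl: "(\<lambda>\<omega>. zhat_prod m r gh (lin_pred m (bh \<omega>)) \<omega>) \<in> borel_measurable M"
    unfolding zhat_prod_lin_pred_fixed
    by (intro borel_measurable_sum borel_measurable_times zp measurable_design bhm) auto
  have "(\<lambda>\<omega>. debias_error m r bh gh \<omega>) \<in> borel_measurable M"
    unfolding debias_error_def odl_def tau_hat_def W_stat_def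
    by (intro borel_measurable_diff borel_measurable_divide borel_measurable_add borel_measurable_times
        borel_measurable_inverse borel_measurable_const zp zn zl bhm respm measurable_design measurable_noise r)
  then show ?thesis .
qed

lemma online_lasso_l1_error:
  fixes L lam0 \<tau> :: real
  assumes \<omega>: "\<omega> \<in> space M" and bh: "is_online_lasso m lam bh" and S: "S \<subseteq> {..<p}"
    and supp: "\<And>k. k < p \<Longrightarrow> k \<notin> S \<Longrightarrow> beta0 m k = 0"
    and L: "0 < L" and coer: "\<And>v. (\<Sum>k<p. (v k)\<^sup>2) \<le> L * quad_form p gram v"
    and lam: "0 < lam (batches m)"
    and score: "\<And>k. k < p \<Longrightarrow> \<bar>\<Sum>i<N. design m i k \<omega> * noise m i \<omega>\<bar> \<le> N * lam0" and lam0: "0 \<le> lam0"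
    and dev: "\<And>k l. k < p \<Longrightarrow> l < p \<Longrightarrow> \<bar>(\<Sum>i<N. design m i k \<omega> * design m i l \<omega>) - N * gram k l\<bar> \<le> N * \<tau>"
    and small: "32 * L * card S * \<tau> \<le> 1" and \<tau>: "0 \<le> \<tau>"
    and cone: "lam0 \<le> lam (batches m) / 2 \<or> S = {..<p}"
  shows "(\<Sum>k<p. \<bar>bh \<omega> k - beta0 m k\<bar>) \<le> 16 * L * card S * (lam0 + lam (batches m))"
proof (rule lasso_l1_error[where X = "\<lambda>i k. design m i k \<omega>" and \<epsilon> = "\<lambda>i. noise m i \<omega>" and n = N and g = gram and \<tau> = \<tau>])
  have "is_arg_min (lasso_obj m (lam (batches m)) \<omega>) (\<lambda>_. True) (bh \<omega>)"
    using bh \<omega> by (simp add: is_online_lasso_def)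
  then have "lasso_obj m (lam (batches m)) \<omega> (bh \<omega>) \<le> lasso_obj m (lam (batches m)) \<omega> (beta0 m)"
    by (simp add: is_arg_min_linorder)
  then show "lasso_loss N (lam (batches m)) {..<p} (\<lambda>i. (\<Sum>k<p. design m i k \<omega> * beta0 m k) + noise m i \<omega>) (\<lambda>i k. design m i k \<omega>) (bh \<omega>)
    \<le> lasso_loss N (lam (batches m)) {..<p} (\<lambda>i. (\<Sum>k<p. design m i k \<omega> * beta0 m k) + noise m i \<omega>) (\<lambda>i k. design m i k \<omega>) (beta0 m)"
    unfolding lasso_obj_def sum_batches lasso_loss_def response_def lin_pred_def by (simp add: total_size_def)
qed (use assms N_pos in auto)

text \<open>
  A tail bound for a single model.  The terms on the right bound, in this order, the probabilities
  that the random constants exceed multiples of \<open>T\<close>, that the inner product with covariate \<open>r\<close>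
  deviates by a fraction of \<open>N\<close>, that the empirical second moments are too far from their means,
  and that the noise dominates the penalty; the last one plays no role when \<open>S\<close> consists of all
  covariates.
\<close>
lemma debias_error_tail:
  fixes L C T \<delta> :: real
  assumes p: "2 \<le> p" and L: "0 < L" and coer: "\<And>v. (\<Sum>k<p. (v k)\<^sup>2) \<le> L * quad_form p gram v"
    and C: "C = 6 + 4 * (K\<^sup>2 * \<sigma>\<^sup>2)"
    and lam: "\<And>j. j \<in> {1..batches m} \<Longrightarrow> lam j = C * sqrt (ln (real p) / real (cum_size m j))"
    and bh: "is_online_lasso m lam bh" and S: "S \<subseteq> {..<p}"
    and supp: "\<And>k. k < p \<Longrightarrow> k \<notin> S \<Longrightarrow> beta0 m k = 0"
    and T: "1 \<le> T"
    and \<delta>: "64 * K * L * (2 * C + 1) * (2 * C + 2) * T ^ 3 * (card S * ln (real p) / sqrt (real N)) \<le> \<delta>"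
  shows "prob {\<omega>\<in>space M. \<bar>debias_error m r bh gh \<omega>\<bar> > \<delta>}
    \<le> (1 + 2 * (1 + 2 * (K\<^sup>2 * L)) + L + 2 * (1 + 8 * K ^ 4) + (2 + 10 * (K\<^sup>2 * \<sigma>\<^sup>2))) / T
      + (16 * (1 + 2 * (K\<^sup>2 * L)) + 8 * (1 + 8 * K ^ 4)) * T / sqrt (real N)
      + 64 * L * (1 + 8 * K ^ 4) * (card S * sqrt (ln (real p) / real N))
      + (if S = {..<p} then 0 else (2 + 10 * (K\<^sup>2 * \<sigma>\<^sup>2)) / sqrt (ln (real p)))"
proof -
  define c0 cz cn where "c0 = 1 + 2 * (K\<^sup>2 * L)" and "cz = 1 + 8 * K ^ 4" and "cn = 2 + 10 * (K\<^sup>2 * \<sigma>\<^sup>2)"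
  have c: "0 < c0" "0 < cz" "0 < cn" unfolding c0_def cz_def cn_def using L K_pos by (auto intro: add_pos_nonneg)
  have C1: "1 \<le> C" unfolding C by simp
  define X where "X = sqrt (real N * ln (real p))"
  define sN where "sN = sqrt (real N)"
  have lnp: "0 < ln (real p)" by (rule ln_double_le(2)[OF p])
  have N0: "0 < real N" using N_pos by simp
  have sN: "0 < sN" "sN * sN = real N" using N0 by (auto simp: sN_def)
  have X: "X = sN * sqrt (ln (real p))" "0 < X" "X * X = real N * ln (real p)"
  proof -
    show "X = sN * sqrt (ln (real p))" by (simp add: X_def sN_def real_sqrt_mult)
    show "0 < X" "X * X = real N * ln (real p)" using N0 lnp by (simp_all add: X_def)
  qed
  obtain Ga Gb where Gab: "integrable M Ga" "integrable M Gb" "expectation Ga \<le> 1 + 2 * c0 + L" "expectation Gb \<le> 2 * c0 * sN"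
    "AE \<omega> in M. 0 \<le> Ga \<omega> \<and> 0 \<le> Gb \<omega> \<and> (\<forall>T>0. Ga \<omega> \<le> T \<longrightarrow>
          real N / (2 * T) - Gb \<omega> \<le> (\<Sum>j = 1..batches m. real (batch_size m j) / real (cum_size m j)
            * (\<Sum>t<cum_size m j. xrows \<omega> t r * nres j (xrows \<omega>) t)))"
    using response_score_lower_bound[OF p L coer C1 lam] unfolding c0_def sN_def by blast
  obtain Gc where Gc: "integrable M Gc" "expectation Gc \<le> cz * sqrt (real N * ln 2)"
     "AE \<omega> in M. 0 \<le> Gc \<omega> \<and> \<bar>\<Sum>t<N. innov (xrows \<omega>) t r\<bar> \<le> Gc \<omega>"
    using innov_max[of "{r}"] r unfolding cz_def by auto
  obtain Gd where Gd: "integrable M Gd" "expectation Gd \<le> cz * sqrt (real N * ln (2 * real p))"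
     "AE \<omega> in M. 0 \<le> Gd \<omega> \<and> (\<forall>k\<in>{..<p}. \<bar>\<Sum>t<N. innov (xrows \<omega>) t k\<bar> \<le> Gd \<omega>)"
    using innov_max[of "{..<p}"] p unfolding cz_def by (auto simp: lessThan_empty_iff)
  obtain Ge where Ge: "integrable M Ge" "expectation Ge \<le> cz * sqrt (real N * ln (2 * (real p)\<^sup>2))"
     "AE \<omega> in M. 0 \<le> Ge \<omega> \<and> (\<forall>k<p. \<forall>l<p. \<bar>(\<Sum>i<N. design m i k \<omega> * design m i l \<omega>) - N * gram k l\<bar> \<le> Ge \<omega>)"
    using gram_max p unfolding cz_def by auto
  obtain Gf where Gf: "integrable M Gf" "expectation Gf \<le> cn * sN"
     "AE \<omega> in M. 0 \<le> Gf \<omega> \<and> (\<forall>k<p. \<bar>\<Sum>i<N. design m i k \<omega> * noise m i \<omega>\<bar> \<le> (2 + 2 * (K\<^sup>2 * \<sigma>\<^sup>2)) * X + Gf \<omega>)"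
    using noise_max[OF p] unfolding cn_def X_def sN_def by blast
  have Gc': "expectation Gc \<le> cz * sN"
  proof -
    have "sqrt (real N * ln 2) \<le> sN" unfolding sN_def using ln_2_le_1 N0 by (simp add: mult_left_le)
    then have "cz * sqrt (real N * ln 2) \<le> cz * sN" using c by (intro mult_left_mono) auto
    then show ?thesis using Gc(2) by simp
  qed
  have sqrtX: "sqrt (real N * a) \<le> 2 * X" if "a \<le> 4 * ln (real p)" for a
  proof -
    have "sqrt (real N * a) \<le> sqrt (4 * (real N * ln (real p)))"
      using mult_left_mono[OF that, of "real N"] N0 by (simp add: mult_ac)
    also have "\<dots> = 2 * X" unfolding X_def real_sqrt_mult by simp
    finally show ?thesis .
  qed
  have Gd': "expectation Gd \<le> 2 * cz * X"
  proof -
    have "cz * sqrt (real N * ln (2 * real p)) \<le> cz * (2 * X)"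
      using c ln_double_le(1)[OF p] lnp by (intro mult_left_mono sqrtX) auto
    then show ?thesis using Gd(2) by simp
  qed
  have Ge': "expectation Ge \<le> 2 * cz * X"
  proof -
    have "ln (2 * (real p)\<^sup>2) = ln (2 * real p) + ln (real p)"
      using p by (simp add: power2_eq_square ln_mult_pos)
    also have "\<dots> \<le> 4 * ln (real p)" using ln_double_le(1)[OF p] lnp by simp
    finally have "cz * sqrt (real N * ln (2 * (real p)\<^sup>2)) \<le> cz * (2 * X)"
      using c by (intro mult_left_mono sqrtX) auto
    then show ?thesis using Ge(2) by simp
  qed
  \<comment> \<open>the exceptional events, whose probabilities are bounded by the Markov inequality\<close>
  define Ba where "Ba = {\<omega>\<in>space M. T < Ga \<omega>}"
  define Bb where "Bb = {\<omega>\<in>space M. real N / (8 * T) < Gb \<omega>}"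
  define Bc where "Bc = {\<omega>\<in>space M. real N / (8 * T) < Gc \<omega>}"
  define Bd where "Bd = {\<omega>\<in>space M. T * X < Gd \<omega>}"
  define Be where "Be = {\<omega>\<in>space M. real N < 32 * L * card S * Ge \<omega>}"
  define Bf where "Bf = {\<omega>\<in>space M. T * sN < Gf \<omega>}"
  define Bg where "Bg = (if S = {..<p} then {} else {\<omega>\<in>space M. X < Gf \<omega>})"
  note [measurable] = borel_measurable_integrable[OF Gab(1)] borel_measurable_integrable[OF Gab(2)]
    borel_measurable_integrable[OF Gc(1)] borel_measurable_integrable[OF Gd(1)]
    borel_measurable_integrable[OF Ge(1)] borel_measurable_integrable[OF Gf(1)]
  have ev: "Ba \<in> events" "Bb \<in> events" "Bc \<in> events" "Bd \<in> events" "Be \<in> events" "Bf \<in> events" "Bg \<in> events"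
    unfolding Ba_def Bb_def Bc_def Bd_def Be_def Bf_def Bg_def by simp_all
  have T0: "0 < T" using T by simp
  have pa: "prob Ba \<le> (1 + 2 * c0 + L) / T"
    unfolding Ba_def using Gab T0 by (intro Markov_bound) auto
  have pb: "prob Bb \<le> 16 * c0 * T / sN"
  proof -
    have "prob Bb \<le> (2 * c0 * sN) / (real N / (8 * T))"
      unfolding Bb_def using Gab T0 N0 by (intro Markov_bound) auto
    also have "\<dots> = 16 * c0 * T / sN" using sN T0 by (simp add: field_simps sN(2)[symmetric])
    finally show ?thesis .
  qed
  have pc: "prob Bc \<le> 8 * cz * T / sN"
  proof -
    have "prob Bc \<le> (cz * sN) / (real N / (8 * T))"
      unfolding Bc_def using Gc Gc' T0 N0 by (intro Markov_bound) auto
    also have "\<dots> = 8 * cz * T / sN" using sN T0 by (simp add: field_simps sN(2)[symmetric])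
    finally show ?thesis .
  qed
  have pd: "prob Bd \<le> 2 * cz / T"
  proof -
    have "prob Bd \<le> (2 * cz * X) / (T * X)"
      unfolding Bd_def using Gd Gd' T0 X by (intro Markov_bound) auto
    then show ?thesis using X(2) by simp
  qed
  have pe: "prob Be \<le> 64 * L * cz * (card S * sqrt (ln (real p) / real N))"
  proof -
    have "prob Be \<le> (32 * L * card S * (2 * cz * X)) / real N"
      unfolding Be_def
    proof (rule Markov_bound)
      show "integrable M (\<lambda>\<omega>. 32 * L * card S * Ge \<omega>)" using Ge(1) by simp
      show "AE \<omega> in M. 0 \<le> 32 * L * card S * Ge \<omega>" using Ge(3) L by auto
      show "expectation (\<lambda>\<omega>. 32 * L * card S * Ge \<omega>) \<le> 32 * L * card S * (2 * cz * X)"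
      proof -
        have "32 * L * card S * expectation Ge \<le> 32 * L * card S * (2 * cz * X)"
          using Ge' L by (intro mult_left_mono) auto
        then show ?thesis by simp
      qed
    qed (rule N0)
    also have "\<dots> = 64 * L * cz * (card S * (X / real N))" by simp
    also have "X / real N = sqrt (ln (real p) / real N)"
      unfolding X(1) sN(2)[symmetric] using sN(1) by (simp add: real_sqrt_divide sN_def[symmetric] real_sqrt_mult)
    finally show ?thesis .
  qed
  have pf: "prob Bf \<le> cn / T"
  proof -
    have "prob Bf \<le> (cn * sN) / (T * sN)"
      unfolding Bf_def using Gf T0 sN by (intro Markov_bound) auto
    then show ?thesis using sN(1) by simp
  qed
  have pg: "prob Bg \<le> (if S = {..<p} then 0 else cn / sqrt (ln (real p)))"
  proof (cases "S = {..<p}")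
    case True
    then show ?thesis by (simp add: Bg_def)
  next
    case False
    have "prob {\<omega>\<in>space M. X < Gf \<omega>} \<le> (cn * sN) / X"
      using Gf X(2) by (intro Markov_bound) auto
    also have "\<dots> = cn / sqrt (ln (real p))" using sN(1) by (simp add: X(1))
    finally show ?thesis using False by (simp add: Bg_def)
  qed
  have key: "AE \<omega> in M. \<omega> \<in> {\<omega>\<in>space M. \<bar>debias_error m r bh gh \<omega>\<bar> > \<delta>}
      \<longrightarrow> \<omega> \<in> Ba \<union> (Bb \<union> (Bc \<union> (Bd \<union> (Be \<union> (Bf \<union> Bg)))))"
    using Gab(5) Gc(3) Gd(3) Ge(3) Gf(3) zhat_prod_le_norm AE_space
  proof eventually_elim
    case (elim \<omega>)
    have \<omega>: "\<omega> \<in> space M" using elim by simp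
    have bound: "\<bar>debias_error m r bh gh \<omega>\<bar> \<le> \<delta>" if good: "\<omega> \<notin> Ba \<union> (Bb \<union> (Bc \<union> (Bd \<union> (Be \<union> (Bf \<union> Bg)))))"
    proof -
      have g: "Ga \<omega> \<le> T" "Gb \<omega> \<le> real N / (8 * T)" "Gc \<omega> \<le> real N / (8 * T)" "Gd \<omega> \<le> T * X"
          "32 * L * card S * Ge \<omega> \<le> real N" "Gf \<omega> \<le> T * sN" "S = {..<p} \<or> Gf \<omega> \<le> X"
        using good \<omega> unfolding Ba_def Bb_def Bc_def Bd_def Be_def Bf_def Bg_def by (auto split: if_splits)
      define U where "U k = zhat_prod m r gh (\<lambda>i. design m i k) \<omega>" for k
      define nm where "nm = zhat_norm m r gh \<omega>"
      define v where "v k = bh \<omega> k - beta0 m k" for k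
      have "real N / (2 * T) - Gb \<omega> \<le> (\<Sum>j = 1..batches m. real (batch_size m j) / real (cum_size m j)
            * (\<Sum>t<cum_size m j. xrows \<omega> t r * nres j (xrows \<omega>) t))"
        using elim(1) g(1) T0 by blast
      moreover have "- Gc \<omega> \<le> (\<Sum>t<N. innov (xrows \<omega>) t r)"
        using elim(2) by (auto simp: abs_le_iff)
      moreover have "real N / (2 * T) = 4 * (real N / (8 * T))" by simp
      ultimately have "2 * (real N / (8 * T)) \<le> U r"
        unfolding U_def zhat_prod_design[OF \<omega> r] using g(2,3) by linarith
      then have Q: "real N / (4 * T) \<le> U r" by simp
      then have Qpos: "0 < U r" using N0 T0 by (meson divide_pos_pos less_le_trans mult_pos_pos zero_less_numeral)
      have nm_low: "sN / (4 * T * K) \<le> nm"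
      proof -
        have "real N / (4 * T) \<le> K * sN * nm" using Q elim(6) unfolding U_def nm_def sN_def by simp
        then have "sN * sN \<le> (4 * T * K) * nm * sN" using T0 by (simp add: sN(2) field_simps)
        then have "sN \<le> (4 * T * K) * nm" using sN(1) by simp
        then show ?thesis using T0 K_pos by (simp add: pos_divide_le_eq mult.commute)
      qed
      have nm_pos: "0 < nm" using nm_low sN T0 K_pos by (meson divide_pos_pos less_le_trans mult_pos_pos zero_less_numeral)
      have Ub: "\<bar>U k\<bar> \<le> (2 * C + 1) * T * X" if k: "k \<in> others" for k
      proof -
        have "\<bar>U k\<bar> \<le> \<bar>\<Sum>j = 1..batches m. real (batch_size m j) / real (cum_size m j)
            * (\<Sum>t<cum_size m j. xrows \<omega> t k * nres j (xrows \<omega>) t)\<bar> + \<bar>\<Sum>t<N. innov (xrows \<omega>) t k\<bar>"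
          using k unfolding U_def by (subst zhat_prod_design[OF \<omega>]) (auto intro: abs_triangle_ineq)
        also have "\<bar>\<Sum>t<N. innov (xrows \<omega>) t k\<bar> \<le> T * X"
        proof -
          have "\<bar>\<Sum>t<N. innov (xrows \<omega>) t k\<bar> \<le> Gd \<omega>" using elim(3) k by blast
          then show ?thesis using g(4) by linarith
        qed
        also have "\<bar>\<Sum>j = 1..batches m. real (batch_size m j) / real (cum_size m j)
            * (\<Sum>t<cum_size m j. xrows \<omega> t k * nres j (xrows \<omega>) t)\<bar>
          \<le> (\<Sum>j = 1..batches m. C * sqrt (ln (real p)) * (real (batch_size m j) / sqrt (real (cum_size m j))))"
        proof (rule order_trans[OF sum_abs], rule sum_mono)
          fix j assume j: "j \<in> {1..batches m}"
          have n: "0 < real (cum_size m j)" using cum_size_pos[OF j] by simp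
          have "\<bar>real (batch_size m j) / real (cum_size m j) * (\<Sum>t<cum_size m j. xrows \<omega> t k * nres j (xrows \<omega>) t)\<bar>
            \<le> real (batch_size m j) / real (cum_size m j) * (cum_size m j * lam j)"
            unfolding abs_mult using nres_KKT[OF j \<omega> k] by (intro mult_mono) auto
          also have "\<dots> = real (batch_size m j) * lam j" using n by simp
          also have "\<dots> = C * sqrt (ln (real p)) * (real (batch_size m j) / sqrt (real (cum_size m j)))"
            unfolding lam[OF j] real_sqrt_divide by simp
          finally show "\<bar>real (batch_size m j) / real (cum_size m j) * (\<Sum>t<cum_size m j. xrows \<omega> t k * nres j (xrows \<omega>) t)\<bar>
            \<le> C * sqrt (ln (real p)) * (real (batch_size m j) / sqrt (real (cum_size m j)))" .
        qed
        also have "\<dots> = C * sqrt (ln (real p)) * (\<Sum>j = 1..batches m. real (batch_size m j) / sqrt (real (cum_size m j)))"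
          by (simp add: sum_distrib_left)
        also have "\<dots> \<le> C * sqrt (ln (real p)) * (2 * sN)"
          using sum_batch_over_sqrt[of m "batches m"] C1 lnp unfolding sN_def total_size_def
          by (intro mult_left_mono) auto
        also have "\<dots> = 2 * C * X" by (simp add: X(1))
        also have "2 * C * X \<le> 2 * C * T * X"
        proof -
          have "2 * C * X * 1 \<le> 2 * C * X * T" using T C1 X(2) by (intro mult_left_mono) auto
          then show ?thesis by (simp add: mult_ac)
        qed
        finally show ?thesis by (simp add: algebra_simps)
      qed
      define lam0 where "lam0 = ((2 + 2 * (K\<^sup>2 * \<sigma>\<^sup>2)) * X + Gf \<omega>) / real N"
      have bb: "batches m \<in> {1..batches m}" using batches(1) by simp
      have lamb: "lam (batches m) = C * X / real N"
      proof -
        have e: "X / real N = sqrt (ln (real p) / real N)"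
          unfolding X(1) sN(2)[symmetric] using sN(1) by (simp add: real_sqrt_divide sN_def[symmetric] real_sqrt_mult)
        have "lam (batches m) = C * sqrt (ln (real p) / real N)" using lam[OF bb] by (simp add: total_size_def)
        then show ?thesis unfolding e[symmetric] by simp
      qed
      have lam0: "0 \<le> lam0" unfolding lam0_def using elim(5) X(2) N0 by (intro divide_nonneg_nonneg add_nonneg_nonneg mult_nonneg_nonneg) auto
      have l1: "(\<Sum>k<p. \<bar>v k\<bar>) \<le> 16 * L * card S * (lam0 + lam (batches m))"
        unfolding v_def
      proof (rule online_lasso_l1_error[OF \<omega> bh S supp L coer])
        show "0 < lam (batches m)" unfolding lamb using C1 X(2) N0 by simp
        show "\<bar>\<Sum>i<N. design m i k \<omega> * noise m i \<omega>\<bar> \<le> N * lam0" if "k < p" for k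
          unfolding lam0_def using elim(5) that N0 by simp
        show "\<bar>(\<Sum>i<N. design m i k \<omega> * design m i l \<omega>) - N * gram k l\<bar> \<le> N * (Ge \<omega> / N)" if "k < p" "l < p" for k l
          using elim(4) that N0 by simp
        show "32 * L * card S * (Ge \<omega> / N) \<le> 1" using g(5) N0 by simp
        show "0 \<le> Ge \<omega> / N" using elim(4) by simp
        show "lam0 \<le> lam (batches m) / 2 \<or> S = {..<p}"
        proof (cases "S = {..<p}")
          case False
          then have "Gf \<omega> \<le> X" using g(7) by simp
          then have "(2 + 2 * (K\<^sup>2 * \<sigma>\<^sup>2)) * X + Gf \<omega> \<le> C / 2 * X" unfolding C by (simp add: algebra_simps)
          then have "lam0 \<le> (C / 2 * X) / real N" unfolding lam0_def using N0 by (intro divide_right_mono) auto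
          then show ?thesis by (simp add: lamb)
        qed simp
      qed (use lam0 in auto)
      have lams: "lam0 + lam (batches m) \<le> (2 * C + 2) * T * X / real N"
      proof -
        have "sN \<le> 2 * X"
        proof -
          have "1 / 2 \<le> sqrt (ln (real p))" by (rule half_le_sqrt_ln[OF p])
          then have "sN * (1 / 2) \<le> sN * sqrt (ln (real p))" using sN(1) by (intro mult_left_mono) auto
          then show ?thesis by (simp add: X(1))
        qed
        then have "T * sN \<le> 2 * (T * X)" using T0 mult_left_mono[of sN "2 * X" T] by simp
        then have "Gf \<omega> \<le> 2 * (T * X)" using g(6) by simp
        moreover have "(2 + 2 * (K\<^sup>2 * \<sigma>\<^sup>2)) * X \<le> C * X" unfolding C using X(2) by (intro mult_right_mono) auto
        moreover have "2 * C * X * 1 \<le> 2 * C * X * T" using T C1 X(2) by (intro mult_left_mono) auto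
        ultimately have "(2 + 2 * (K\<^sup>2 * \<sigma>\<^sup>2)) * X + Gf \<omega> + C * X \<le> (2 * C + 2) * T * X"
          by (simp add: algebra_simps)
        then have "((2 + 2 * (K\<^sup>2 * \<sigma>\<^sup>2)) * X + Gf \<omega> + C * X) / real N \<le> (2 * C + 2) * T * X / real N"
          using N0 by (intro divide_right_mono) auto
        then show ?thesis unfolding lam0_def lamb by (simp add: add_divide_distrib)
      qed
      have l1': "(\<Sum>k<p. \<bar>v k\<bar>) \<le> 16 * L * card S * ((2 * C + 2) * T * X / real N)"
      proof -
        have "16 * L * card S * (lam0 + lam (batches m)) \<le> 16 * L * card S * ((2 * C + 2) * T * X / real N)"
          using lams L by (intro mult_left_mono) auto
        then show ?thesis using l1 by linarith
      qed
      have dE: "\<bar>debias_error m r bh gh \<omega>\<bar> = \<bar>\<Sum>k\<in>others. U k * v k\<bar> / nm"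
        using debias_error_eq[OF r, of gh \<omega> bh] Qpos nm_pos unfolding U_def v_def nm_def by (simp add: abs_divide)
      have "\<bar>\<Sum>k\<in>others. U k * v k\<bar> \<le> (\<Sum>k\<in>others. ((2 * C + 1) * T * X) * \<bar>v k\<bar>)"
        by (rule order_trans[OF sum_abs]) (auto simp: abs_mult intro!: sum_mono mult_right_mono Ub)
      also have "\<dots> \<le> (\<Sum>k<p. ((2 * C + 1) * T * X) * \<bar>v k\<bar>)"
        using C1 T0 X(2) by (intro sum_mono2) auto
      also have "\<dots> = ((2 * C + 1) * T * X) * (\<Sum>k<p. \<bar>v k\<bar>)" by (simp add: sum_distrib_left)
      also have "\<dots> \<le> ((2 * C + 1) * T * X) * (16 * L * card S * ((2 * C + 2) * T * X / real N))"
        using l1' C1 T0 X(2) by (intro mult_left_mono) auto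
      finally have num: "\<bar>\<Sum>k\<in>others. U k * v k\<bar> \<le> ((2 * C + 1) * T * X) * (16 * L * card S * ((2 * C + 2) * T * X / real N))" .
      have "\<bar>debias_error m r bh gh \<omega>\<bar> \<le> \<bar>\<Sum>k\<in>others. U k * v k\<bar> / (sN / (4 * T * K))"
        unfolding dE using nm_low nm_pos sN(1) T0 K_pos
        by (intro divide_left_mono mult_pos_pos divide_pos_pos) auto
      also have "\<dots> \<le> ((2 * C + 1) * T * X) * (16 * L * card S * ((2 * C + 2) * T * X / real N)) / (sN / (4 * T * K))"
        using num sN(1) T0 K_pos by (intro divide_right_mono) auto
      also have "\<dots> = 64 * K * L * (2 * C + 1) * (2 * C + 2) * T ^ 3 * (card S * (X * X / real N) / sN)"
        using sN(1) by (simp add: power3_eq_cube)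
      also have "X * X / real N = ln (real p)" using X(3) N0 by simp
      also have "64 * K * L * (2 * C + 1) * (2 * C + 2) * T ^ 3 * (card S * ln (real p) / sN) \<le> \<delta>"
        using \<delta> by (simp add: sN_def)
      finally show ?thesis .
    qed
    show ?case
    proof (intro impI)
      assume "\<omega> \<in> {\<omega>\<in>space M. \<bar>debias_error m r bh gh \<omega>\<bar> > \<delta>}"
      then have big: "\<delta> < \<bar>debias_error m r bh gh \<omega>\<bar>" by simp
      show "\<omega> \<in> Ba \<union> (Bb \<union> (Bc \<union> (Bd \<union> (Be \<union> (Bf \<union> Bg)))))"
      proof (rule ccontr)
        assume "\<omega> \<notin> Ba \<union> (Bb \<union> (Bc \<union> (Bd \<union> (Be \<union> (Bf \<union> Bg)))))"
        from bound[OF this] big show False by simp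
      qed
    qed
  qed
  have "prob {\<omega>\<in>space M. \<bar>debias_error m r bh gh \<omega>\<bar> > \<delta>} \<le> prob (Ba \<union> (Bb \<union> (Bc \<union> (Bd \<union> (Be \<union> (Bf \<union> Bg))))))"
    using key ev by (intro finite_measure_mono_AE) auto
  also have "\<dots> \<le> (1 + 2 * c0 + L) / T + (16 * c0 * T / sN + (8 * cz * T / sN + (2 * cz / T
      + (64 * L * cz * (card S * sqrt (ln (real p) / real N)) + (cn / T + (if S = {..<p} then 0 else cn / sqrt (ln (real p))))))))"
    by (intro prob_Un_le pa pb pc pd pe pf pg ev sets.Un)
  also have "\<dots> = (1 + 2 * c0 + L + 2 * cz + cn) / T + (16 * c0 + 8 * cz) * T / sN
      + 64 * L * cz * (card S * sqrt (ln (real p) / real N)) + (if S = {..<p} then 0 else cn / sqrt (ln (real p)))"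
    by (simp add: add_divide_distrib distrib_right)
  finally show ?thesis unfolding c0_def cz_def cn_def sN_def .
qed

end

section \<open>The limit along the sequence of models\<close>

lemma debias_error_vanishes:
  fixes K \<sigma> L D :: real
    and m :: "nat \<Rightarrow> 'w stream_data" and lam :: "nat \<Rightarrow> nat \<Rightarrow> real"
  assumes K: "0 < K" and C: "C = 6 + 4 * (K\<^sup>2 * \<sigma>\<^sup>2)"
    and model: "\<And>n. linear_stream_model \<sigma> (m n)"
    and size: "filterlim (\<lambda>n. total_size (m n)) at_top sequentially"
    and B1: "cond_B1 K m" and B2: "cond_B2 L D m"
    and r: "\<And>n. r n < covariates (m n)"
    and lam: "\<And>n j. j \<in> {1..batches (m n)} \<Longrightarrow>
       lam n j = C * sqrt (ln (real (covariates (m n))) / real (cum_size (m n) j))"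
    and bh: "\<And>n. is_online_lasso (m n) (lam n) (bh n)"
    and gh: "\<And>n. is_node_lasso (m n) (r n) (lam n) (gh n)"
    and sparse: "(\<lambda>n. real (s_zero (m n))
       * (ln (real (covariates (m n))) / sqrt (real (total_size (m n))))) \<longlonglongrightarrow> 0"
  shows "vanishes_in_prob (\<lambda>n. law (m n)) (\<lambda>n. debias_error (m n) (r n) (bh n) (gh n))"
proof -
  let ?N = "\<lambda>n. real (total_size (m n))" and ?p = "\<lambda>n. real (covariates (m n))"
  have C0: "0 \<le> C" unfolding C by simp
  have p1: "1 \<le> ?p n" for n using r[of n] by simp
  have ns: "node_stream (m n) \<sigma> K (r n) (lam n) (gh n)" for n
  proof -
    have "prob_space (law (m n))" using model[of n] unfolding linear_stream_model_def Let_def by blast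
    then show ?thesis
      unfolding node_stream_def regression_stream_def regression_stream_axioms_def node_stream_axioms_def
      using model K B1 r gh C0 p1[of n] lam[of _ n] by (auto simp: cond_B1_def)
  qed
  have meas: "debias_error (m n) (r n) (bh n) (gh n) \<in> borel_measurable (law (m n))" for n
    by (rule node_stream.measurable_debias_error[OF ns bh])
  have "(\<lambda>n. measure (law (m n)) {\<omega>\<in>space (law (m n)). \<bar>debias_error (m n) (r n) (bh n) (gh n) \<omega>\<bar> > \<delta>}) \<longlonglongrightarrow> 0"
    if \<delta>: "0 < \<delta>" for \<delta>
  proof (rule tendstoI)
    fix \<eta> :: real assume \<eta>: "0 < \<eta>"
    have evL: "\<forall>\<^sub>F n in sequentially. 1 / min_eigenvalue (Sigma_mat (m n)) \<le> L"
      and pos: "\<And>n. 0 < min_eigenvalue (Sigma_mat (m n))"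
      using B2 by (auto simp: cond_B2_def)
    obtain n0 where "1 / min_eigenvalue (Sigma_mat (m n0)) \<le> L" using eventually_happens'[OF _ evL] by auto
    moreover have "0 < 1 / min_eigenvalue (Sigma_mat (m n0))" using pos by simp
    ultimately have L: "0 < L" by linarith
    define c1 where "c1 = 1 + 2 * (1 + 2 * (K\<^sup>2 * L)) + L + 2 * (1 + 8 * K ^ 4) + (2 + 10 * (K\<^sup>2 * \<sigma>\<^sup>2))"
    define c2 where "c2 = 16 * (1 + 2 * (K\<^sup>2 * L)) + 8 * (1 + 8 * K ^ 4)"
    define c3 where "c3 = 64 * L * (1 + 8 * K ^ 4)"
    define c4 where "c4 = 2 + 10 * (K\<^sup>2 * \<sigma>\<^sup>2)"
    define T where "T = 1 + 4 * c1 / \<eta>"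
    define P where "P = exp ((1 + 4 * c4 / \<eta>)\<^sup>2)"
    define c5 where "c5 = 64 * K * L * (2 * C + 1) * (2 * C + 2) * T ^ 3"
    have c: "0 \<le> c1" "0 \<le> c3" "0 < c4" unfolding c1_def c3_def c4_def using L K by (auto intro!: add_nonneg_nonneg add_pos_nonneg)
    have T: "1 \<le> T" "c1 / T < \<eta> / 4"
    proof -
      show "1 \<le> T" unfolding T_def using c \<eta> by simp
      then have "4 * c1 < \<eta> * T" unfolding T_def using \<eta> by (simp add: field_simps)
      then show "c1 / T < \<eta> / 4" using \<open>1 \<le> T\<close> by (simp add: field_simps)
    qed
    have c5: "0 \<le> c5" unfolding c5_def using K L C0 T by (intro mult_nonneg_nonneg) auto
    define b where "b n = real (s_zero (m n)) * (ln (?p n) / sqrt (?N n)) + P * P / sqrt (?N n)" for n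
    have inv: "(\<lambda>n. a / sqrt (?N n)) \<longlonglongrightarrow> 0" for a
    proof -
      have "filterlim (\<lambda>n. sqrt (?N n)) at_top sequentially"
        by (rule filterlim_compose[OF sqrt_at_top filterlim_compose[OF filterlim_real_sequentially size]])
      then show ?thesis by (intro real_tendsto_divide_at_top[OF tendsto_const])
    qed
    have b0: "b \<longlonglongrightarrow> 0" unfolding b_def using tendsto_add[OF sparse inv[of "P * P"]] by simp
    have e1: "\<forall>\<^sub>F n in sequentially. c2 * T / sqrt (?N n) < \<eta> / 4"
      using order_tendstoD(2)[OF inv, of "\<eta> / 4"] \<eta> by simp
    have e2: "\<forall>\<^sub>F n in sequentially. c3 * (2 * b n) < \<eta> / 4"
    proof (rule order_tendstoD(2))
      show "(\<lambda>n. c3 * (2 * b n)) \<longlonglongrightarrow> 0" using b0 by (auto intro!: tendsto_eq_intros)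
    qed (use \<eta> in simp)
    have e3: "\<forall>\<^sub>F n in sequentially. c5 * b n < \<delta>"
    proof (rule order_tendstoD(2))
      show "(\<lambda>n. c5 * b n) \<longlonglongrightarrow> 0" using b0 by (auto intro!: tendsto_eq_intros)
    qed (rule \<delta>)
    show "\<forall>\<^sub>F n in sequentially. dist (measure (law (m n))
      {\<omega>\<in>space (law (m n)). \<bar>debias_error (m n) (r n) (bh n) (gh n) \<omega>\<bar> > \<delta>}) 0 < \<eta>"
      using e1 e2 e3 evL
    proof eventually_elim
      case (elim n)
      interpret node_stream "m n" \<sigma> K "r n" "lam n" "gh n" by (rule ns)
      let ?A = "{\<omega>\<in>space (law (m n)). \<bar>debias_error (m n) (r n) (bh n) (gh n) \<omega>\<bar> > \<delta>}"
      show ?case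
      proof (cases "covariates (m n) = 1")
        case True
        then have none: "?A = {}" using debias_error_single_covariate[OF True r] \<delta> by simp
        show ?thesis unfolding none using \<eta> by simp
      next
        case False
        then have p2: "2 \<le> covariates (m n)" using r by simp
        have p0: "0 < covariates (m n)" using p2 by simp
        have lnp: "0 < ln (?p n)" by (rule ln_double_le(2)[OF p2])
        have N0: "0 < ?N n" using N_pos by simp
        \<comment> \<open>for few covariates the oracle inequality is used with all of them, because the noise
          exceeds the penalty with a probability that vanishes only as \<open>p\<close> grows\<close>
        define S where "S = (if P \<le> ?p n then {k. k < covariates (m n) \<and> beta0 (m n) k \<noteq> 0} else {..<covariates (m n)})"
        have S: "S \<subseteq> {..<covariates (m n)}" "\<And>k. k < covariates (m n) \<Longrightarrow> k \<notin> S \<Longrightarrow> beta0 (m n) k = 0"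
          by (auto simp: S_def split: if_splits)
        have Sb: "card S * ln (?p n) / sqrt (?N n) \<le> b n"
        proof (cases "P \<le> ?p n")
          case True
          then have "card S * ln (?p n) / sqrt (?N n) = real (s_zero (m n)) * (ln (?p n) / sqrt (?N n))"
            by (simp add: S_def s_zero_def)
          also have "\<dots> \<le> b n" unfolding b_def by simp
          finally show ?thesis .
        next
          case False
          have "ln (?p n) \<le> ?p n" using ln_le_minus_one[of "?p n"] p1[of n] by simp
          then have "card S * ln (?p n) \<le> P * P"
            using False lnp by (intro mult_mono) (auto simp: S_def P_def)
          then have "card S * ln (?p n) / sqrt (?N n) \<le> P * P / sqrt (?N n)" by (intro divide_right_mono) auto
          also have "\<dots> \<le> b n" unfolding b_def using lnp by simp
          finally show ?thesis .
        qed
        have Sb2: "card S * sqrt (ln (?p n) / ?N n) \<le> 2 * b n"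
        proof -
          have "1 \<le> 2 * sqrt (ln (?p n))" using half_le_sqrt_ln[OF p2] by simp
          then have "1 * sqrt (ln (?p n)) \<le> 2 * sqrt (ln (?p n)) * sqrt (ln (?p n))" using lnp by (intro mult_right_mono) auto
          then have "sqrt (ln (?p n)) \<le> 2 * ln (?p n)" using lnp by (simp add: mult.assoc)
          then have "card S * sqrt (ln (?p n)) / sqrt (?N n) \<le> card S * (2 * ln (?p n)) / sqrt (?N n)"
            by (intro divide_right_mono mult_left_mono) auto
          also have "\<dots> = 2 * (card S * ln (?p n) / sqrt (?N n))" by simp
          also have "\<dots> \<le> 2 * b n" using Sb by simp
          finally show ?thesis by (simp add: real_sqrt_divide)
        qed
        have d: "64 * K * L * (2 * C + 1) * (2 * C + 2) * T ^ 3 * (card S * ln (?p n) / sqrt (?N n)) \<le> \<delta>"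
        proof -
          have "c5 * (card S * ln (?p n) / sqrt (?N n)) \<le> c5 * b n" using Sb c5 by (rule mult_left_mono)
          then show ?thesis using elim(3) unfolding c5_def by linarith
        qed
        have "measure (law (m n)) ?A \<le> c1 / T + c2 * T / sqrt (?N n) + c3 * (card S * sqrt (ln (?p n) / ?N n))
            + (if S = {..<covariates (m n)} then 0 else c4 / sqrt (ln (?p n)))"
          unfolding c1_def c2_def c3_def c4_def
          by (rule debias_error_tail[OF p2 L gram_coercive(2)[OF p0 pos elim(4)] C lam bh S T(1) d])
        also have "c3 * (card S * sqrt (ln (?p n) / ?N n)) \<le> c3 * (2 * b n)" using Sb2 c(2) by (rule mult_left_mono)
        also have "(if S = {..<covariates (m n)} then 0 else c4 / sqrt (ln (?p n))) < \<eta> / 4"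
        proof (cases "S = {..<covariates (m n)}")
          case True
          then show ?thesis using \<eta> by simp
        next
          case False
          then have "P \<le> ?p n" by (auto simp: S_def split: if_splits)
          then have "(1 + 4 * c4 / \<eta>)\<^sup>2 \<le> ln (?p n)" unfolding P_def using p1[of n] by (simp add: ln_ge_iff)
          then have "1 + 4 * c4 / \<eta> \<le> sqrt (ln (?p n))" by (rule real_le_rsqrt)
          then have "\<eta> + 4 * c4 \<le> \<eta> * sqrt (ln (?p n))" using \<eta> mult_left_mono[of "1 + 4 * c4 / \<eta>" "sqrt (ln (?p n))" \<eta>]
            by (simp add: distrib_left)
          then have "4 * c4 < \<eta> * sqrt (ln (?p n))" using \<eta> by simp
          then show ?thesis using False lnp by (simp add: pos_divide_less_eq)
        qed
        finally have "measure (law (m n)) ?A < \<eta>" using T(2) elim(1,2) by linarith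
        then show ?thesis by simp
      qed
    qed
  qed
  then show ?thesis using meas unfolding vanishes_in_prob_def by blast
qed

theorem theorem3:
  fixes K \<sigma> L D B Q :: real
  assumes "K > 0"
  shows "\<exists>C>0. \<exists>c>0. \<forall>(m :: nat \<Rightarrow> 'w stream_data) (r :: nat \<Rightarrow> nat)
           (lam :: nat \<Rightarrow> nat \<Rightarrow> real)
           (bh :: nat \<Rightarrow> 'w \<Rightarrow> nat \<Rightarrow> real) (gh :: nat \<Rightarrow> nat \<Rightarrow> 'w \<Rightarrow> nat \<Rightarrow> real).
      (\<forall>n. linear_stream_model \<sigma> (m n)) \<longrightarrow>
      filterlim (\<lambda>n. total_size (m n)) at_top sequentially \<longrightarrow>
      cond_B1 K m \<longrightarrow> cond_B2 L D m \<longrightarrow> cond_B3 K B Q m \<longrightarrow>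
      (\<forall>n. r n < covariates (m n)) \<longrightarrow>
      (\<forall>n. \<forall>j\<in>{1..batches (m n)}.
         lam n j = C * sqrt (ln (real (covariates (m n))) / real (cum_size (m n) j))) \<longrightarrow>
      (\<forall>n. is_online_lasso (m n) (lam n) (bh n)) \<longrightarrow>
      (\<forall>n. is_node_lasso (m n) (r n) (lam n) (gh n)) \<longrightarrow>
      (\<forall>n. real (batch_size (m n) 1)
             \<ge> c * (real (s_node (m n) (r n)))\<^sup>2 * ln (real (covariates (m n)))) \<longrightarrow>
      (\<lambda>n. real (s_zero (m n)) * real (max 1 (s_node (m n) (r n)))
             * (ln (real (covariates (m n))) / sqrt (real (total_size (m n))))) \<longlonglongrightarrow> 0 \<longrightarrow>
      (\<lambda>n. (real (s_node (m n) (r n)))\<^sup>2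
             * (ln (real (covariates (m n))) / real (total_size (m n)))
             * ln (real (total_size (m n)))) \<longlonglongrightarrow> 0 \<longrightarrow>
      (\<exists>\<Delta> :: nat \<Rightarrow> 'w \<Rightarrow> real.
         (\<forall>\<^sub>F n in sequentially. \<forall>\<omega>\<in>space (law (m n)).
            (odl (m n) (r n) (bh n) (gh n) \<omega> - beta0 (m n) (r n)) / tau_hat (m n) (r n) (gh n) \<omega>
              = W_stat (m n) (r n) (gh n) \<omega> + \<Delta> n \<omega>) \<and>
         vanishes_in_prob (\<lambda>n. law (m n)) \<Delta>)"
proof (rule exI[of _ "6 + 4 * (K\<^sup>2 * \<sigma>\<^sup>2)"], rule conjI[rotated],
    rule exI[of _ "1 :: real"], rule conjI[rotated], (rule allI impI)+)
  \<comment> \<open>half of this constant exceeds the leading constant \<open>2 + 2 * (K\<^sup>2 * \<sigma>\<^sup>2)\<close> in \<open>noise_max\<close> by one\<close>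
  show "0 < 6 + 4 * (K\<^sup>2 * \<sigma>\<^sup>2)" by (intro add_pos_nonneg) auto
  show "0 < (1::real)" by simp
  fix m :: "nat \<Rightarrow> 'w stream_data" and r lam bh gh
  assume model: "\<forall>n. linear_stream_model \<sigma> (m n)"
    and size: "filterlim (\<lambda>n. total_size (m n)) at_top sequentially"
    and B1: "cond_B1 K m" and B2: "cond_B2 L D m" and r: "\<forall>n. r n < covariates (m n)"
    and lam: "\<forall>n. \<forall>j\<in>{1..batches (m n)}. lam n j
       = (6 + 4 * (K\<^sup>2 * \<sigma>\<^sup>2)) * sqrt (ln (real (covariates (m n))) / real (cum_size (m n) j))"
    and bh: "\<forall>n. is_online_lasso (m n) (lam n) (bh n)"
    and gh: "\<forall>n. is_node_lasso (m n) (r n) (lam n) (gh n)"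
    and sparse: "(\<lambda>n. real (s_zero (m n)) * real (max 1 (s_node (m n) (r n)))
             * (ln (real (covariates (m n))) / sqrt (real (total_size (m n))))) \<longlonglongrightarrow> 0"
  have s0: "(\<lambda>n. real (s_zero (m n)) * (ln (real (covariates (m n))) / sqrt (real (total_size (m n))))) \<longlonglongrightarrow> 0"
  proof (rule tendsto_sandwich[OF _ _ tendsto_const sparse])
    have q: "0 \<le> ln (real (covariates (m n))) / sqrt (real (total_size (m n)))" for n
      using r[rule_format, of n] by simp
    show "\<forall>\<^sub>F n in sequentially. 0 \<le> real (s_zero (m n)) * (ln (real (covariates (m n))) / sqrt (real (total_size (m n))))"
      using q by (intro always_eventually allI mult_nonneg_nonneg) auto
    show "\<forall>\<^sub>F n in sequentially. real (s_zero (m n)) * (ln (real (covariates (m n))) / sqrt (real (total_size (m n))))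
      \<le> real (s_zero (m n)) * real (max 1 (s_node (m n) (r n))) * (ln (real (covariates (m n))) / sqrt (real (total_size (m n))))"
    proof (intro always_eventually allI mult_right_mono q)
      fix n
      have "real (s_zero (m n)) * 1 \<le> real (s_zero (m n)) * real (max 1 (s_node (m n) (r n)))"
        by (intro mult_left_mono) auto
      then show "real (s_zero (m n)) \<le> real (s_zero (m n)) * real (max 1 (s_node (m n) (r n)))" by simp
    qed
  qed
  let ?\<Delta> = "\<lambda>n. debias_error (m n) (r n) (bh n) (gh n)"
  have "vanishes_in_prob (\<lambda>n. law (m n)) ?\<Delta>"
    by (rule debias_error_vanishes[where lam = lam, OF assms refl _ size B1 B2 _ _ _ _ s0]) (use model r lam bh gh in auto)
  moreover have "\<forall>\<^sub>F n in sequentially. \<forall>\<omega>\<in>space (law (m n)).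
     (odl (m n) (r n) (bh n) (gh n) \<omega> - beta0 (m n) (r n)) / tau_hat (m n) (r n) (gh n) \<omega>
       = W_stat (m n) (r n) (gh n) \<omega> + ?\<Delta> n \<omega>"
    by (simp add: debias_error_def)
  ultimately show "\<exists>\<Delta> :: nat \<Rightarrow> 'w \<Rightarrow> real.
         (\<forall>\<^sub>F n in sequentially. \<forall>\<omega>\<in>space (law (m n)).
            (odl (m n) (r n) (bh n) (gh n) \<omega> - beta0 (m n) (r n)) / tau_hat (m n) (r n) (gh n) \<omega>
              = W_stat (m n) (r n) (gh n) \<omega> + \<Delta> n \<omega>) \<and>
         vanishes_in_prob (\<lambda>n. law (m n)) \<Delta>"
    by (intro exI[of _ ?\<Delta>] conjI)
qed

end
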